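(* Let $n$ and $t$ be positive integers with $n \geq \frac{10t}{3}+10$. Then: (1) $\mathrm{sat}(n, P_6 + tP_2) = \min\{\, n-\lfloor \frac{n}{10}\rfloor,\ 3t+18 \,\}$; (2) if moreover $n > \frac{10t}{3}+20$, then the set of $(P_6+tP_2)$-saturated graphs of order $n$ having exactly $\mathrm{sat}(n,P_6+tP_2)$ edges is $\{K_7 + (t-1)K_3 + \overline{K}_{n-3t-4}\}$ (i.e. this graph is, up to isomorphism, the unique such graph).
   Context: All graphs are finite and simple. For graphs $G,H$, $G+H$ denotes the disjoint union and $tG$ the disjoint union of $t$ copies of $G$. $P_k$ is the path on $k$ vertices, $K_k$ the complete graph on $k$ vertices, and $\overline{K}_m$ the edgeless graph on $m$ vertices. A graph $G$ is $H$-saturated if $G$ contains no subgraph isomorphic to $H$, but $G+e$ (adding the edge $e$) contains a subgraph isomorphic to $H$ for every edge $e$ of the complement of $G$. $\mathrm{sat}(n,H)$ is the minimum number of edges of an $H$-saturated graph on $n$ vertices. *)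

theory Defs
  imports Main "HOL.Real" "HOL-Library.Ramsey"
begin

text \<open>
  A graph is a vertex set together with a set of edges, each edge being a two-element set of
  vertices. The notation \<open>[V]\<^bsup>2\<^esup>\<close> for the set of two-element subsets of \<open>V\<close> is that of
  \<^theory>\<open>HOL-Library.Ramsey\<close>.
\<close>

datatype 'a graph = Graph (verts: "'a set") (edges: "'a set set")

definition simple_graph :: "'a graph \<Rightarrow> bool" where
  "simple_graph G \<longleftrightarrow> finite (verts G) \<and> edges G \<subseteq> [verts G]\<^bsup>2\<^esup>"

definition isomorphic :: "'a graph \<Rightarrow> 'b graph \<Rightarrow> bool"  (infix "\<cong>\<^sub>g" 50) where
  "G \<cong>\<^sub>g H \<longleftrightarrow> (\<exists>f. bij_betw f (verts G) (verts H) \<and>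
     (\<forall>u\<in>verts G. \<forall>v\<in>verts G. {u, v} \<in> edges G \<longleftrightarrow> {f u, f v} \<in> edges H))"

definition subgraph :: "'a graph \<Rightarrow> 'a graph \<Rightarrow> bool" where
  "subgraph S G \<longleftrightarrow> simple_graph S \<and> verts S \<subseteq> verts G \<and> edges S \<subseteq> edges G"

definition contains :: "'a graph \<Rightarrow> 'b graph \<Rightarrow> bool" where
  "contains G H \<longleftrightarrow> (\<exists>S. subgraph S G \<and> S \<cong>\<^sub>g H)"

definition complement :: "'a graph \<Rightarrow> 'a graph" where
  "complement G = Graph (verts G) ([verts G]\<^bsup>2\<^esup> - edges G)"

definition add_edge :: "'a graph \<Rightarrow> 'a set \<Rightarrow> 'a graph" where
  "add_edge G e = Graph (verts G) (insert e (edges G))"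

definition saturated :: "'b graph \<Rightarrow> 'a graph \<Rightarrow> bool" where
  "saturated H G \<longleftrightarrow> simple_graph G \<and> \<not> contains G H \<and>
     (\<forall>e\<in>edges (complement G). contains (add_edge G e) H)"

text \<open>
  The minimum may be taken over graphs with natural numbers as vertices, since every finite
  graph is isomorphic to one of these. If there is no \<open>H\<close>-saturated graph on \<open>n\<close> vertices
  (which can only happen if \<open>H\<close> has no edges), the value of \<open>sat n H\<close> is unspecified.
\<close>

definition sat :: "nat \<Rightarrow> 'b graph \<Rightarrow> nat" where
  "sat n H = (LEAST m. \<exists>G :: nat graph. saturated H G \<and> card (verts G) = n \<and> card (edges G) = m)"

definition disjoint_union :: "'a graph \<Rightarrow> 'b graph \<Rightarrow> ('a + 'b) graph"  (infixl "+\<^sub>g" 65) where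
  "G +\<^sub>g H = Graph (verts G <+> verts H) ((`) Inl ` edges G \<union> (`) Inr ` edges H)"

definition copies :: "nat \<Rightarrow> 'a graph \<Rightarrow> (nat \<times> 'a) graph"  (infixr "*\<^sub>g" 70) where
  "t *\<^sub>g G = Graph ({..<t} \<times> verts G) (\<Union>i<t. (`) (Pair i) ` edges G)"

definition path_graph :: "nat \<Rightarrow> nat graph"  ("P\<^sub>g") where
  "P\<^sub>g k = Graph {..<k} {{i, Suc i} |i. Suc i < k}"

definition complete_graph :: "nat \<Rightarrow> nat graph"  ("K\<^sub>g") where
  "K\<^sub>g k = Graph {..<k} ([{..<k}]\<^bsup>2\<^esup>)"

definition edgeless_graph :: "nat \<Rightarrow> nat graph" where
  "edgeless_graph m = complement (K\<^sub>g m)"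

end

theory Submission
  imports Defs "HOL-Library.Disjoint_Sets"
begin

text \<open>
  Write \<open>H = P\<^sub>6 + t P\<^sub>2\<close> and let \<open>G\<close> be \<open>H\<close>-saturated of order \<open>n\<close> with fewer than
  \<open>n - \<lfloor>n/10\<rfloor>\<close> edges. Then some component \<open>T\<close> is a tree of order at most 9.

  The key fact is that if \<open>G\<close> contains a \<open>P\<^sub>6\<close> and a matching with \<open>t + 3\<close> edges, but no \<open>H\<close>, then every
  \<open>P\<^sub>6\<close> must meet at least four edges of the matching, and this forces a \<open>P\<^sub>6\<close> whose two middle vertices
  each carry a pendant leaf.

  If \<open>G\<close> has an isolated vertex, saturation excludes vertices of degree one. Hence there are two isolated
  vertices, so \<open>G\<close> contains a \<open>P\<^sub>6\<close> and by the key fact its matching number is \<open>t + 2\<close>. Every vertex is missed by a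
  maximum matching, so by Gallai's lemma \<open>G\<close> is a disjoint union of odd cliques, one of order at least 7.
  A clique on \<open>2 k + 1\<close> vertices has \<open>k (2 k + 1) = 3 k + 2 k (k - 1)\<close> edges, and the values \<open>k\<close> sum up to
  \<open>t + 2\<close>, so there are at least \<open>3 (t + 2) + 12\<close> edges, with equality for one \<open>K\<^sub>7\<close> and \<open>t - 1\<close> triangles.

  If \<open>G\<close> has no isolated vertex, the vertices of \<open>T\<close> have degree one or at least three, because a vertex
  of degree two lies in a triangle; so at most three of them are not leaves. If \<open>G\<close> contains a \<open>P\<^sub>6\<close>, adding
  an edge between \<open>T\<close> and a middle vertex of the \<open>P\<^sub>6\<close> from the key fact creates no \<open>H\<close>. If \<open>G\<close>
  contains no \<open>P\<^sub>6\<close>, some edge added inside \<open>T\<close>, or between \<open>T = K\<^sub>2\<close> and a second tree component,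
  creates no \<open>P\<^sub>6\<close>.

  A forest of \<open>\<lfloor>n/10\<rfloor>\<close> trees, each a root with at least three branches that carry at least two
  leaves each, is saturated as well, because an added edge creates a \<open>P\<^sub>6\<close> touching at most three branches.
\<close>

section \<open>Paths meeting few edges of a matching\<close>

text \<open>\<open>R\<close> is adjacency; the involution \<open>m\<close> exchanges the ends of
  each matching edge and fixes the uncovered vertices. \<open>no_cheap_path\<close> says that every
  path on six vertices meets at least four matching edges; \<open>short_paths_mate\<close> derives
  this for matchings with at least \<open>t + 3\<close> edges in graphs without the linear
  forest.\<close>

locale short_paths =
  fixes R :: "'a \<Rightarrow> 'a \<Rightarrow> bool" and m :: "'a \<Rightarrow> 'a"
  assumes R_irrefl: "\<not> R x x"
    and R_sym: "R x y \<Longrightarrow> R y x"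
    and m_m [simp]: "m (m x) = x"
    and R_m: "m x \<noteq> x \<Longrightarrow> R x (m x)"
    and no_cheap_path: "\<lbrakk>distinct [u, v, w, x, y, z]; R u v; R v w; R w x; R x y; R y z;
      {u, v, w, x, y, z} \<subseteq> {a, m a, b, m b, c, m c} \<union> {s. m s = s}\<rbrakk> \<Longrightarrow> False"
begin

lemma m_eq_iff [simp]: "m x = m y \<longleftrightarrow> x = y"
  by (metis m_m)

lemma m_flip: "m x = y \<longleftrightarrow> x = m y"
  by auto

lemma R_m': "m x \<noteq> x \<Longrightarrow> R (m x) x"
  using R_m R_sym by blast

text \<open>Otherwise \<open>m r, r, x, y, s, m s\<close> is a path whose vertices lie in the three
  pairs of \<open>r\<close>, \<open>x\<close> and \<open>s\<close>.\<close>

lemma mate_chain: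
  assumes "m x = y" "x \<noteq> y" "R r x" "R y s" "r \<noteq> y" "s \<noteq> x" "r \<noteq> s" "m r \<noteq> r" "m s \<noteq> s"
  shows "m r = s"
proof (rule ccontr)
  assume "m r \<noteq> s"
  moreover have "r \<noteq> x" "s \<noteq> y" using assms \<open>m r \<noteq> s\<close>
    using R_irrefl by metis+
  ultimately show False
    using no_cheap_path[of "m r" r x y s "m s" r x s] assms R_m'[of r] R_m[of s] R_m[of x]
    by simp (metis m_m)
qed

text \<open>In each excluded case one of the listed paths meets at most three mate pairs.\<close>

context
  fixes p1 p2 p3 p4 p5 p6
  assumes dist: "distinct [p1, p2, p3, p4, p5, p6]"
    and path: "R p1 p2" "R p2 p3" "R p3 p4" "R p4 p5" "R p5 p6"
    and cov: "m p2 \<noteq> p2" "m p5 \<noteq> p5"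
begin

lemma rpath: "R p2 p1" "R p3 p2" "R p4 p3" "R p5 p4" "R p6 p5"
  using path R_sym by auto

lemma m_p2_neq_p3: "m p2 \<noteq> p3"
proof
  assume e: "m p2 = p3"
  then have e': "m p3 = p2" by auto
  consider "m p1 = p1" | "m p1 \<noteq> p1" "m p4 = p4" | "m p1 = p4" | "m p1 \<noteq> p1" "m p4 \<noteq> p4" "m p1 \<noteq> p4" by blast
  then show False
  proof cases
    case 1
    then show False
    proof (cases "m p5 = p4")
      case True
      then show False using 1 e e' dist path no_cheap_path[of p1 p2 p3 p4 p5 p6 p2 p4 p6] by auto
    next
      case False
      then show False using 1 e e' cov dist path R_m[of p5] no_cheap_path[of p1 p2 p3 p4 p5 "m p5" p2 p4 p5]
        by simp (metis m_m)
    qed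
  next
    case 2
    then show False
    proof (cases "m p1 = p5")
      case True
      then show False using 2 e e' dist path no_cheap_path[of p1 p2 p3 p4 p5 p6 p1 p2 p6] by auto
    next
      case False
      then show False using 2 e e' cov dist path R_m'[of p1] no_cheap_path[of "m p1" p1 p2 p3 p4 p5 p1 p2 p5]
        by simp (metis m_m)
    qed
  next
    case 3
    then have "m p4 = p1" by auto
    with 3 e e' cov dist path rpath R_m'[of p5] R_m[of p1] show False
      using no_cheap_path[of "m p5" p5 p4 p1 p2 p3 p5 p4 p2] R_sym[of p1 p4] by simp (metis m_m)
  next
    case 4
    then show False using mate_chain[of p2 p3 p1 p4] e dist path by auto
  qed
qed

lemma m_p2_neq_p4: "m p2 \<noteq> p4"
proof
  assume e: "m p2 = p4"
  then have e': "m p4 = p2" by auto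
  have R24: "R p2 p4" "R p4 p2" using R_m[of p2] R_m[of p4] e e' dist by auto
  consider "m p3 = p3" | "m p3 = p5" | "m p3 \<noteq> p3" "m p3 \<noteq> p5" by blast
  then show False
  proof cases
    case 1
    then show False using e e' dist path no_cheap_path[of p1 p2 p3 p4 p5 p6 p1 p2 p5]
       no_cheap_path[of p1 p2 p3 p4 p5 p6 p1 p2 p5] mate_chain[of p2 p4 p1 p5] R24
        no_cheap_path[of p1 p2 p3 p4 p5 p6 p2 p5 p6]
      by (simp add: cov) (metis m_m)
  next
    case 2
    then show False using mate_chain[of p2 p4 p1 p5] e e' R24 path dist cov
       no_cheap_path[of p1 p2 p3 p4 p5 p6 p2 p3 p6] by (simp add: cov) (metis m_m)
  next
    case 3
    then show False using mate_chain[of p2 p4 p3 p5] e e' R24 path rpath dist cov by auto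
  qed
qed

lemma m_p2_neq_p5: "m p2 \<noteq> p5"
proof
  assume e: "m p2 = p5"
  then have e': "m p5 = p2" by auto
  have R24: "R p2 p5" "R p5 p2" using R_m[of p2] R_m[of p5] e e' dist by auto
  have a: "m p1 = p1 \<or> m p6 = p6 \<or> m p1 = p6"
    using mate_chain[of p2 p5 p1 p6] e path dist by auto
  have b: "m p3 = p3 \<or> m p4 = p4 \<or> m p3 = p4"
    using mate_chain[of p2 p5 p3 p4] e path rpath dist by auto
  \<comment> \<open>Since \<open>p2 p5\<close> is a matching edge, \<open>mate_chain\<close> leaves
    at most one matching edge for \<open>p1\<close>, \<open>p6\<close> together and at most one for
    \<open>p3\<close>, \<open>p4\<close> together. With \<open>x\<close> and \<open>y\<close> naming
    these, the original path meets only the pairs of \<open>p2\<close>, \<open>x\<close> and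
    \<open>y\<close>.\<close>
  obtain x where "m p1 \<in> {p1, x, m x}" "m p6 \<in> {p6, x, m x}" using a by auto
  moreover obtain y where "m p3 \<in> {p3, y, m y}" "m p4 \<in> {p4, y, m y}" using b by auto
  ultimately show False using e e' dist path
       no_cheap_path[of p1 p2 p3 p4 p5 p6 x p2 y] by auto
qed

end

text \<open>By the previous three lemmas, applied also to the reversed path, \<open>m p2\<close> and
  \<open>m p5\<close> are not inner vertices of the path, so they can replace its ends. The new path
  meets only the pairs of \<open>p2\<close>, \<open>p3\<close>, \<open>p4\<close>,
  \<open>p5\<close>; these must be four different pairs, so \<open>p3\<close> and \<open>p4\<close>
  have partners off the path.\<close>

lemma double_broom:
  assumes dist: "distinct [p1, p2, p3, p4, p5, p6]"
    and path: "R p1 p2" "R p2 p3" "R p3 p4" "R p4 p5" "R p5 p6"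
    and cov: "m p2 \<noteq> p2" "m p5 \<noteq> p5"
  shows "distinct [m p2, p2, p3, p4, p5, m p5, m p3, m p4]"
proof -
  have 2: "m p2 \<notin> {p3, p4, p5}"
    using m_p2_neq_p3[OF assms] m_p2_neq_p4[OF assms] m_p2_neq_p5[OF assms] by auto
  have rev: "distinct [p6, p5, p4, p3, p2, p1]" "R p6 p5" "R p5 p4" "R p4 p3" "R p3 p2" "R p2 p1"
    using dist path R_sym by auto
  have 5: "m p5 \<notin> {p2, p3, p4}"
    using m_p2_neq_p3[OF rev cov(2,1)] m_p2_neq_p4[OF rev cov(2,1)] m_p2_neq_p5[OF rev cov(2,1)] by auto
  have P: "distinct [m p2, p2, p3, p4, p5, m p5]" "R (m p2) p2" "R p5 (m p5)"
    using 2 5 dist cov R_m[of p5] R_m'[of p2] by auto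
  have "m p3 \<noteq> p3" "m p4 \<noteq> p4" "m p3 \<noteq> p4"
    using no_cheap_path[of "m p2" p2 p3 p4 p5 "m p5" p2 p5 p4] no_cheap_path[of "m p2" p2 p3 p4 p5 "m p5" p2 p5 p3] P path
    by auto
  then show ?thesis using P 2 5 by simp (metis m_m)
qed

text \<open>A second neighbour \<open>w\<close> of \<open>m p3\<close> would permit a path through
  \<open>m p3\<close> that meets at most three pairs. The cases locate \<open>w\<close> among the
  four pairs of the broom, and otherwise ask whether \<open>w\<close> is uncovered or has its own
  partner.\<close>

lemma broom_leaf:
  assumes dist: "distinct [m p2, p2, p3, p4, p5, m p5, m p3, m p4]"
    and path: "R p2 p3" "R p3 p4" "R p4 p5"
    and w: "R (m p3) w"
  shows "w = p3"
proof (rule ccontr)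
  assume "w \<noteq> p3"
  have "R (m p2) p2" "R p2 (m p2)" "R (m p3) p3" "R p3 (m p3)" "R (m p4) p4" "R p4 (m p4)"
       "R (m p5) p5" "R p5 (m p5)" "R p4 p3" "R w (m p3)"
    using R_m[of p2] R_m'[of p2] R_m[of p3] R_m'[of p3] R_m[of p4] R_m'[of p4]
          R_m[of p5] R_m'[of p5] dist R_sym path w by auto
  note facts = this path w dist \<open>w \<noteq> p3\<close>
  have "w \<noteq> m p3" using w R_irrefl by auto
  consider "w = m p2" | "w = p2" | "w = p4" | "w = m p4" | "w = p5" | "w = m p5" |
    "w \<notin> {p2, m p2, p3, m p3, p4, m p4, p5, m p5}" "m w = w" |
    "w \<notin> {p2, m p2, p3, m p3, p4, m p4, p5, m p5}" "m w \<noteq> w"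
    using \<open>w \<noteq> p3\<close> \<open>w \<noteq> m p3\<close> by blast
  then show False
  proof cases
    case 1 then show False using facts no_cheap_path[of p2 "m p2" "m p3" p3 p4 "m p4" p2 p3 p4] by auto
  next
    case 2 then show False using facts no_cheap_path[of "m p2" p2 "m p3" p3 p4 "m p4" p2 p3 p4] by auto
  next
    case 3 then show False using facts no_cheap_path[of "m p2" p2 p3 "m p3" p4 "m p4" p2 p3 p4] by auto
  next
    case 4 then show False using facts no_cheap_path[of "m p2" p2 p3 "m p3" "m p4" p4 p2 p3 p4] by auto
  next
    case 5 then show False using facts no_cheap_path[of "m p2" p2 p3 "m p3" p5 "m p5" p2 p3 p5] by auto
  next
    case 6 then show False using facts no_cheap_path[of "m p2" p2 p3 "m p3" "m p5" p5 p2 p3 p5] by auto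
  next
    case 7 then show False using facts no_cheap_path[of w "m p3" p3 p4 p5 "m p5" p3 p4 p5] by auto
  next
    case 8
    then have "m w \<notin> {p2, m p2, p3, m p3, p4, m p4, p5, m p5}" by (auto simp: m_flip)
    then show False using facts 8 no_cheap_path[of "m w" w "m p3" p3 p4 "m p4" w p3 p4] R_m'[of w] by auto
  qed
qed

end

section \<open>Linear forests as paths and matchings\<close>

definition matching :: "'a set set \<Rightarrow> 'a set set \<Rightarrow> bool" where
  "matching E M \<longleftrightarrow> M \<subseteq> E \<and> pairwise disjnt M"

definition path6 :: "'a set set \<Rightarrow> 'a \<Rightarrow> 'a \<Rightarrow> 'a \<Rightarrow> 'a \<Rightarrow> 'a \<Rightarrow> 'a \<Rightarrow> bool" where
  "path6 E a b c d e f \<longleftrightarrow> distinct [a, b, c, d, e, f] \<and>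
     {a, b} \<in> E \<and> {b, c} \<in> E \<and> {c, d} \<in> E \<and> {d, e} \<in> E \<and> {e, f} \<in> E"

text \<open>The combinatorial form of containing P6 + tP2, with the copies of P2 gathered into one
  matching; \<open>contains_linear_forest_iff\<close> proves the equivalence with
  \<open>contains\<close>.\<close>

definition has_linear_forest :: "'a set set \<Rightarrow> nat \<Rightarrow> bool" where
  "has_linear_forest E t \<longleftrightarrow> (\<exists>a b c d e f M. path6 E a b c d e f \<and> matching E M \<and> card M = t \<and>
     {a, b, c, d, e, f} \<inter> \<Union>M = {})"

lemma matching_mono: "matching E M \<Longrightarrow> N \<subseteq> M \<Longrightarrow> matching E N"
  unfolding matching_def by (auto intro: pairwise_subset)

lemma path6_rev: "path6 E a b c d e f \<Longrightarrow> path6 E f e d c b a"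
  unfolding path6_def by (auto simp: insert_commute)

lemma matching_disjoint: "matching E M \<Longrightarrow> e \<in> M \<Longrightarrow> f \<in> M \<Longrightarrow> x \<in> e \<Longrightarrow> x \<in> f \<Longrightarrow> e = f"
  unfolding matching_def pairwise_def disjnt_def by auto

lemma matching_insert:
  "matching E M \<Longrightarrow> e \<in> E \<Longrightarrow> e \<inter> \<Union>M = {} \<Longrightarrow> matching E (insert e M)"
  unfolding matching_def by (auto simp: pairwise_insert disjnt_def)

text \<open>\<open>K\<close> contains all edges of \<open>M\<close> that meet the path. Discarding
  them costs at most \<open>k\<close> edges, so \<open>t\<close> edges disjoint from the path
  remain.\<close>

lemma has_linear_forestI:
  assumes "path6 E a b c d e f" "matching E M" "finite M" "{x \<in> M. x \<inter> {a, b, c, d, e, f} \<noteq> {}} \<subseteq> K"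
    "finite K" "card K \<le> k" "t + k \<le> card M"
  shows "has_linear_forest E t"
proof -
  let ?N = "{x \<in> M. x \<inter> {a, b, c, d, e, f} = {}}"
  have "M \<subseteq> ?N \<union> K" using assms(4) by auto
  then have "card M \<le> card (?N \<union> K)" using assms by (intro card_mono) auto
  also have "\<dots> \<le> card ?N + card K" by (rule card_Un_le)
  finally have "t \<le> card ?N" using assms by linarith
  then obtain N where "N \<subseteq> ?N" "card N = t" by (meson obtain_subset_with_card_n)
  moreover from this have "matching E N" using assms(2) matching_mono by (metis (no_types, lifting) mem_Collect_eq subset_eq)
  ultimately show ?thesis unfolding has_linear_forest_def
    using assms(1) by (intro exI[of _ a] exI[of _ b] exI[of _ c] exI[of _ d] exI[of _ e] exI[of _ f] exI[of _ N]) auto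
qed

section \<open>Containment of a graph through injective maps\<close>

lemma isomorphic_image:
  assumes inj: "inj_on g (verts H)" and H: "edges H \<subseteq> [verts H]\<^bsup>2\<^esup>"
  shows "Graph (g ` verts H) ((`) g ` edges H) \<cong>\<^sub>g H"
proof -
  let ?f = "inv_into (verts H) g"
  have "{u, v} \<in> (`) g ` edges H \<longleftrightarrow> {?f u, ?f v} \<in> edges H" if "u \<in> g ` verts H" "v \<in> g ` verts H" for u v
  proof -
    from that obtain x y where x: "x \<in> verts H" "u = g x" and y: "y \<in> verts H" "v = g y" by auto
    have "{g x, g y} \<in> (`) g ` edges H \<longleftrightarrow> {x, y} \<in> edges H"
    proof
      assume "{g x, g y} \<in> (`) g ` edges H"
      then obtain e where e: "e \<in> edges H" "g ` {x, y} = g ` e" by auto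
      with H have "e \<subseteq> verts H" by (auto simp: nsets_def)
      with e have "{x, y} = e" using inj x y by (metis empty_subsetI inj_on_image_eq_iff insert_subset)
      then show "{x, y} \<in> edges H" using e by simp
    next
      assume "{x, y} \<in> edges H"
      then have "g ` {x, y} \<in> (`) g ` edges H" by (rule imageI)
      then show "{g x, g y} \<in> (`) g ` edges H" by simp
    qed
    then show ?thesis using x y inj by simp
  qed
  moreover have "bij_betw ?f (g ` verts H) (verts H)"
    by (simp add: bij_betw_imageI bij_betw_inv_into inj)
  ultimately show ?thesis unfolding isomorphic_def by auto
qed

lemma edges_image_iso:
  assumes f: "bij_betw f (verts G) (verts H)" and G: "edges G \<subseteq> [verts G]\<^bsup>2\<^esup>" and H: "edges H \<subseteq> [verts H]\<^bsup>2\<^esup>"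
    and "\<forall>u\<in>verts G. \<forall>v\<in>verts G. {u, v} \<in> edges G \<longleftrightarrow> {f u, f v} \<in> edges H"
  shows "edges H = (`) f ` edges G"
proof
  show "edges H \<subseteq> (`) f ` edges G"
  proof
    fix e assume e: "e \<in> edges H"
    with H obtain x y where xy: "e = {x, y}" "x \<in> verts H" "y \<in> verts H" by (meson nsets2_E subsetD)
    then obtain u v where "u \<in> verts G" "v \<in> verts G" "x = f u" "y = f v"
      using f by (metis bij_betw_imp_surj_on imageE)
    then have "{u, v} \<in> edges G" "e = f ` {u, v}" using assms(4) e xy by auto
    then show "e \<in> (`) f ` edges G" by blast
  qed
  show "(`) f ` edges G \<subseteq> edges H"
  proof
    fix e assume "e \<in> (`) f ` edges G"
    then obtain e' where e': "e' \<in> edges G" "e = f ` e'" by auto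
    with G obtain x y where "e' = {x, y}" "x \<in> verts G" "y \<in> verts G" by (meson nsets2_E subsetD)
    then show "e \<in> edges H" using e' assms(4) by auto
  qed
qed

text \<open>A copy of \<open>H\<close> in \<open>G\<close> provides the inverse of its isomorphism
  as the map, and a map provides its image as the copy. Copies need not be induced, so only edges
  have to be preserved.\<close>

lemma contains_iff_inj:
  assumes H: "simple_graph H"
  shows "contains G H \<longleftrightarrow> (\<exists>g. inj_on g (verts H) \<and> g ` verts H \<subseteq> verts G \<and> (\<forall>e\<in>edges H. g ` e \<in> edges G))"
proof
  assume "contains G H"
  then obtain S f where S: "subgraph S G" and f: "bij_betw f (verts S) (verts H)"
    "\<forall>u\<in>verts S. \<forall>v\<in>verts S. {u, v} \<in> edges S \<longleftrightarrow> {f u, f v} \<in> edges H"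
    unfolding contains_def isomorphic_def by auto
  have e: "edges H = (`) f ` edges S"
    by (rule edges_image_iso[OF f(1) _ _ f(2)]) (use S H in \<open>auto simp: subgraph_def simple_graph_def\<close>)
  let ?g = "inv_into (verts S) f"
  have g: "bij_betw ?g (verts H) (verts S)" using f(1) by (rule bij_betw_inv_into)
  have "?g ` e \<in> edges G" if "e \<in> edges H" for e
  proof -
    from that obtain d where d: "d \<in> edges S" "e = f ` d" using e by auto
    with S have "d \<subseteq> verts S" by (auto simp: subgraph_def simple_graph_def nsets_def)
    then have "?g ` e = d" using f(1) d by (simp add: bij_betw_def)
    then show ?thesis using d S by (auto simp: subgraph_def)
  qed
  with g S show "\<exists>g. inj_on g (verts H) \<and> g ` verts H \<subseteq> verts G \<and> (\<forall>e\<in>edges H. g ` e \<in> edges G)"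
    unfolding bij_betw_def subgraph_def by metis
next
  assume "\<exists>g. inj_on g (verts H) \<and> g ` verts H \<subseteq> verts G \<and> (\<forall>e\<in>edges H. g ` e \<in> edges G)"
  then obtain g where g: "inj_on g (verts H)" "g ` verts H \<subseteq> verts G" "\<forall>e\<in>edges H. g ` e \<in> edges G" by auto
  let ?S = "Graph (g ` verts H) ((`) g ` edges H)"
  have "?S \<cong>\<^sub>g H" using isomorphic_image g H by (auto simp: simple_graph_def)
  moreover have "g ` e \<in> [g ` verts H]\<^bsup>2\<^esup>" if "e \<in> edges H" for e
    using that H g(1) unfolding simple_graph_def nsets_def
    by (auto simp: card_image inj_on_subset)
  then have "subgraph ?S G" using g H unfolding subgraph_def simple_graph_def by auto
  ultimately show "contains G H" unfolding contains_def by blast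
qed

lemma edges_P6: "edges (P\<^sub>g 6) = {{0, 1}, {1, 2}, {2, 3}, {3, 4}, {4, 5}}"
proof -
  have "Suc i < 6 \<longleftrightarrow> i = 0 \<or> i = 1 \<or> i = 2 \<or> i = 3 \<or> i = 4" for i by auto
  then show ?thesis unfolding path_graph_def by (auto simp: numeral_eq_Suc)
qed

lemma edges_P2: "edges (P\<^sub>g 2) = {{0, 1}}"
  unfolding path_graph_def by (auto simp: numeral_eq_Suc less_Suc_eq)

lemma verts_P: "verts (P\<^sub>g k) = {..<k}"
  unfolding path_graph_def by simp

lemma simple_graph_disjoint_union:
  "simple_graph G \<Longrightarrow> simple_graph H \<Longrightarrow> simple_graph (G +\<^sub>g H)"
  unfolding simple_graph_def disjoint_union_def nsets_def
  by (auto simp: card_image subset_iff)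

lemma simple_graph_copies: "simple_graph G \<Longrightarrow> simple_graph (t *\<^sub>g G)"
  unfolding simple_graph_def copies_def nsets_def
  by (auto simp: card_image inj_on_def subset_iff)

lemma simple_graph_P: "simple_graph (P\<^sub>g k)"
  unfolding simple_graph_def path_graph_def by auto

lemma simple_linear_forest: "simple_graph (P\<^sub>g 6 +\<^sub>g t *\<^sub>g P\<^sub>g 2)"
  by (intro simple_graph_disjoint_union simple_graph_copies simple_graph_P)

lemma edges_linear_forest:
  "edges (P\<^sub>g 6 +\<^sub>g t *\<^sub>g P\<^sub>g 2) = (`) Inl ` edges (P\<^sub>g 6) \<union> {{Inr (i, 0), Inr (i, 1)} | i. i < t}"
  unfolding disjoint_union_def copies_def by (simp add: edges_P2 image_UN) auto

lemma verts_linear_forest: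
  "verts (P\<^sub>g 6 +\<^sub>g t *\<^sub>g P\<^sub>g 2) = {..<6} <+> ({..<t} \<times> {..<2})"
  unfolding disjoint_union_def copies_def by (simp add: verts_P)

lemma lessThan_6: "{..<6} = {0, 1, 2, 3, 4, 5 :: nat}"
  by (auto simp: numeral_eq_Suc less_Suc_eq)

lemma contains_linear_forest_iff:
  assumes G: "simple_graph G"
  shows "contains G (P\<^sub>g 6 +\<^sub>g t *\<^sub>g P\<^sub>g 2) \<longleftrightarrow> has_linear_forest (edges G) t"
proof
  assume "contains G (P\<^sub>g 6 +\<^sub>g t *\<^sub>g P\<^sub>g 2)"
  then obtain g where g: "inj_on g ({..<6} <+> ({..<t} \<times> {..<2}))"
    "\<forall>e\<in>edges (P\<^sub>g 6 +\<^sub>g t *\<^sub>g P\<^sub>g 2). g ` e \<in> edges G"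
    unfolding contains_iff_inj[OF simple_linear_forest] verts_linear_forest by auto
  define p where "p i = g (Inl i)" for i
  define q where "q i j = g (Inr (i, j))" for i j
  have inj: "p i = p j \<longleftrightarrow> i = j" if "i < 6" "j < 6" for i j
    using g(1) that unfolding inj_on_def p_def by auto
  have inj': "p i \<noteq> q j k" if "i < 6" "j < t" "k < 2" for i j k
    using g(1) that unfolding inj_on_def p_def q_def by (metis InlI InrI SigmaI lessThan_iff sum.distinct(1))
  have inj'': "q i j = q k l \<longleftrightarrow> i = k \<and> j = l" if "i < t" "k < t" "j < 2" "l < 2" for i j k l
    using g(1) that unfolding inj_on_def p_def q_def by (metis InrI SigmaI lessThan_iff sum.inject(2) prod.inject)
  have "path6 (edges G) (p 0) (p 1) (p 2) (p 3) (p 4) (p 5)"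
    using g(2) inj unfolding path6_def edges_linear_forest edges_P6 by (auto simp: p_def)
  moreover define M where "M = (\<lambda>i. {q i 0, q i 1}) ` {..<t}"
  have "inj_on (\<lambda>i. {q i 0, q i 1}) {..<t}" using inj'' by (auto simp: inj_on_def doubleton_eq_iff)
  then have "card M = t" unfolding M_def by (simp add: card_image)
  moreover have "g ` {Inr (i, 0), Inr (i, 1)} \<in> edges G" if "i < t" for i
    using g(2) that unfolding edges_linear_forest by blast
  then have "matching (edges G) M"
    unfolding matching_def M_def pairwise_def disjnt_def using inj'' by (auto simp: q_def)
  moreover have "{p 0, p 1, p 2, p 3, p 4, p 5} \<inter> \<Union>M = {}"
    using inj' unfolding M_def by auto
  ultimately show "has_linear_forest (edges G) t" unfolding has_linear_forest_def by blast
next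
  assume "has_linear_forest (edges G) t"
  then obtain a b c d e f M where *: "path6 (edges G) a b c d e f" "matching (edges G) M" "card M = t"
     "{a, b, c, d, e, f} \<inter> \<Union>M = {}" unfolding has_linear_forest_def by blast
  have M: "M \<subseteq> [verts G]\<^bsup>2\<^esup>" using * G unfolding matching_def simple_graph_def by auto
  then have "finite M" using G unfolding simple_graph_def by (meson finite_imp_finite_nsets finite_subset)
  then obtain h where h: "bij_betw h {..<t} M" using * by (metis ex_bij_betw_nat_finite atLeast0LessThan)
  have "\<forall>i. \<exists>x y. i < t \<longrightarrow> h i = {x, y} \<and> x \<noteq> y"
    using h M by (metis bij_betwE lessThan_iff nsets2_E subsetD)
  then obtain x y where xy: "\<And>i. i < t \<Longrightarrow> h i = {x i, y i}" "\<And>i. i < t \<Longrightarrow> x i \<noteq> y i"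
    by metis
  \<comment> \<open>\<open>h\<close> numbers the edges of the matching, so the \<open>i\<close>-th
    copy of P2 is sent onto the ends \<open>x i\<close>, \<open>y i\<close> of
    \<open>h i\<close>.\<close>
  define g where "g s = (case s of Inl i \<Rightarrow> [a, b, c, d, e, f] ! i | Inr (i, j) \<Rightarrow> if j = 0 then x i else y i)" for s :: "nat + nat \<times> nat"
  have hM: "h i \<in> M" if "i < t" for i using h that by (auto simp: bij_betw_def)
  have hdisj: "i = k" if "i < t" "k < t" "z \<in> h i" "z \<in> h k" for i k z
    using that matching_disjoint[OF *(2) hM[of i] hM[of k]] h by (auto simp: bij_betw_def inj_on_def)
  have "inj_on g ({..<6} <+> ({..<t} \<times> {..<2}))"
  proof (rule inj_onI)
    fix r s assume rs: "r \<in> {..<6} <+> ({..<t} \<times> {..<2})" "s \<in> {..<6} <+> ({..<t} \<times> {..<2})" "g r = g s"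
    have out: "[a, b, c, d, e, f] ! i \<notin> h k" if "i < 6" "k < t" for i k
      using *(4) hM[OF that(2)] nth_mem[of i "[a, b, c, d, e, f]"] that(1) by auto
    have L: "g (Inl i) \<noteq> g (Inr k)" if "i < 6" "k \<in> {..<t} \<times> {..<2}" for i k
    proof -
      obtain u v where "k = (u, v)" "u < t" using \<open>k \<in> _\<close> by auto
      then show ?thesis using out[of i u] that xy[of u] unfolding g_def by auto
    qed
    show "r = s"
    proof (cases r; cases s)
      fix i j assume "r = Inl i" "s = Inl j"
      then show "r = s" using rs *(1) unfolding g_def path6_def by (auto simp: nth_eq_iff_index_eq simp del: distinct.simps)
    next
      fix i j assume rs': "r = Inr i" "s = Inr j"
      obtain i1 i2 j1 j2 where ij: "i = (i1, i2)" "j = (j1, j2)" by fastforce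
      then have lt: "i1 < t" "j1 < t" "i2 < 2" "j2 < 2" using rs rs' by auto
      have "g r \<in> h i1" "g s \<in> h j1" unfolding g_def rs' ij using xy lt by auto
      then have "i1 = j1" using hdisj lt rs by auto
      moreover from this have "i2 = j2" using rs(3) xy(2)[OF lt(1)] lt unfolding g_def rs' ij by (auto split: if_splits)
      ultimately show "r = s" using rs' ij by simp
    qed (use rs L in \<open>auto, metis+\<close>)
  qed
  moreover have eG: "g ` u \<in> edges G" if u: "u \<in> edges (P\<^sub>g 6 +\<^sub>g t *\<^sub>g P\<^sub>g 2)" for u
  proof -
    consider "u \<in> (`) Inl ` edges (P\<^sub>g 6)" | i where "u = {Inr (i, 0), Inr (i, 1)}" "i < t"
      using u unfolding edges_linear_forest by blast
    then show ?thesis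
    proof cases
      case 1
      then show ?thesis using *(1) unfolding edges_P6 path6_def by (auto simp: g_def numeral_eq_Suc)
    next
      case 2
      then have "g ` u = h i" using xy by (auto simp: g_def)
      then show ?thesis using hM[OF 2(2)] *(2) unfolding matching_def by auto
    qed
  qed
  moreover have "g ` ({..<6} <+> ({..<t} \<times> {..<2})) \<subseteq> verts G"
  proof -
    have "z \<in> verts G" if "z \<in> e" "e \<in> edges G" for z e
      using G that unfolding simple_graph_def nsets_def by auto
    then have "{a, b, c, d, e, f} \<subseteq> verts G" and "\<And>i. i < t \<Longrightarrow> h i \<subseteq> verts G"
      using *(1) hM *(2) unfolding path6_def matching_def by (blast, blast)
    then show ?thesis unfolding lessThan_6 using xy(1) by (fastforce simp: g_def numeral_eq_Suc)
  qed
  ultimately show "contains G (P\<^sub>g 6 +\<^sub>g t *\<^sub>g P\<^sub>g 2)"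
    unfolding contains_iff_inj[OF simple_linear_forest] verts_linear_forest by blast
qed

lemma saturated_linear_forest_iff:
  "saturated (P\<^sub>g 6 +\<^sub>g t *\<^sub>g P\<^sub>g 2) G \<longleftrightarrow> simple_graph G \<and> \<not> has_linear_forest (edges G) t \<and>
     (\<forall>u\<in>verts G. \<forall>v\<in>verts G. u \<noteq> v \<longrightarrow> {u, v} \<notin> edges G \<longrightarrow> has_linear_forest (insert {u, v} (edges G)) t)"
proof (cases "simple_graph G")
  case True
  have "contains (add_edge G {u, v}) (P\<^sub>g 6 +\<^sub>g t *\<^sub>g P\<^sub>g 2) \<longleftrightarrow> has_linear_forest (insert {u, v} (edges G)) t"
    if "u \<in> verts G" "v \<in> verts G" "u \<noteq> v" for u v
    using contains_linear_forest_iff[of "add_edge G {u, v}"] True that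
    by (auto simp: add_edge_def simple_graph_def)
  then show ?thesis unfolding saturated_def contains_linear_forest_iff[OF True] complement_def
    using True by (fastforce elim!: nsets2_E)
next
  case False
  then show ?thesis unfolding saturated_def by simp
qed

section \<open>Matchings in graphs without the linear forest\<close>

text \<open>Uncovered vertices are their own mates. For a matching \<open>M\<close> this default
  makes \<open>mate M\<close> an involution on the whole type, as \<open>short_paths\<close>
  requires.\<close>

definition mate :: "'a set set \<Rightarrow> 'a \<Rightarrow> 'a" where
  "mate M x = (if \<exists>y. y \<noteq> x \<and> {x, y} \<in> M then SOME y. y \<noteq> x \<and> {x, y} \<in> M else x)"

lemma matching_subset: "matching E M \<Longrightarrow> M \<subseteq> E"
  by (simp add: matching_def)

text \<open>At most one edge of \<open>M\<close> contains \<open>x\<close>; it is given up in favour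
  of \<open>{x, y}\<close>, so the size does not drop. The last clause records the surviving edges,
  for use when two exchanges are combined.\<close>

lemma matching_exchange:
  assumes M: "matching E M" "finite M" and xy: "{x, y} \<in> E" "y \<notin> \<Union>M"
  obtains N where "matching E N" "finite N" "card M \<le> card N" "{x, y} \<in> N" "\<And>e. e \<in> M \<Longrightarrow> x \<notin> e \<Longrightarrow> e \<in> N"
proof
  let ?M = "{e \<in> M. x \<notin> e}"
  let ?N = "insert {x, y} ?M"
  have "matching E ?M" using M(1) by (rule matching_mono) auto
  then show "matching E ?N" by (rule matching_insert) (use xy in auto)
  show "finite ?N" using M by simp
  have "{e \<in> M. x \<in> e} = {} \<or> (\<exists>e. {e \<in> M. x \<in> e} = {e})"
    using matching_disjoint[OF M(1)] by blast
  then have "card {e \<in> M. x \<in> e} \<le> 1"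
  proof
    assume "\<exists>e. {e \<in> M. x \<in> e} = {e}"
    then obtain e where "{e \<in> M. x \<in> e} = {e}" ..
    show ?thesis unfolding \<open>{e \<in> M. x \<in> e} = {e}\<close> by simp
  qed (simp only: card.empty)
  moreover have "card M \<le> card {e \<in> M. x \<in> e} + card ?M"
    by (rule order_trans[OF _ card_Un_le]) (use M in \<open>auto intro!: card_mono\<close>)
  moreover have "card ?N = Suc (card ?M)" using M xy(2) by (intro card_insert_disjoint) auto
  ultimately show "card M \<le> card ?N" by linarith
qed auto

locale finite_simple_graph =
  fixes V :: "'a set" and E :: "'a set set"
  assumes finite_V: "finite V" and E_V: "E \<subseteq> [V]\<^bsup>2\<^esup>"
begin

lemma finite_E: "finite E"
  using finite_V E_V by (meson finite_imp_finite_nsets finite_subset)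

lemma finite_matching: "matching E M \<Longrightarrow> finite M"
  using finite_E finite_subset matching_subset by blast

lemma edgeE: assumes "e \<in> E" obtains x y where "e = {x, y}" "x \<in> V" "y \<in> V" "x \<noteq> y"
  using assms E_V by (meson nsets2_E subsetD)

lemma edge_V: "{x, y} \<in> E \<Longrightarrow> x \<in> V \<and> y \<in> V \<and> x \<noteq> y"
  using E_V by (metis doubleton_in_nsets_2 subsetD)

lemma edge_irrefl [simp]: "{x} \<notin> E"
  using edge_V[of x x] by auto

context
  fixes M
  assumes M: "matching E M"
begin

lemma mate_eq: assumes "{x, y} \<in> M" shows "mate M x = y"
proof -
  have "x \<noteq> y" using assms edge_V matching_subset[OF M] by blast
  moreover have "z = y" if "{x, z} \<in> M" for z
    using matching_disjoint[OF M assms that, of x] by (auto simp: doubleton_eq_iff)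
  ultimately have "z \<noteq> x \<and> {x, z} \<in> M \<longleftrightarrow> z = y" for z using assms by blast
  then have "(SOME y. y \<noteq> x \<and> {x, y} \<in> M) = y" by (simp only: some_eq_trivial)
  then show ?thesis unfolding mate_def using \<open>x \<noteq> y\<close> assms by auto
qed

lemma mate_in: assumes "mate M x \<noteq> x" shows "{x, mate M x} \<in> M"
proof -
  obtain y where "{x, y} \<in> M" using assms unfolding mate_def by (auto split: if_splits)
  then show ?thesis using mate_eq by simp
qed

lemma mate_mate: "mate M (mate M x) = x"
proof (cases "mate M x = x")
  case False
  then show ?thesis using mate_eq[of "mate M x" x] mate_in[OF False] by (simp add: insert_commute)
qed simp

lemma covered_edge: assumes "e \<in> M" "x \<in> e" shows "e = {x, mate M x}"
proof -
  obtain u v where "e = {u, v}" using assms(1) matching_subset[OF M] edgeE by blast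
  then show ?thesis using assms mate_eq[of u v] mate_eq[of v u] by (auto simp: insert_commute)
qed

lemma covered_iff: "x \<in> \<Union>M \<longleftrightarrow> mate M x \<noteq> x"
proof
  assume "x \<in> \<Union>M"
  then obtain e where "e \<in> M" "x \<in> e" by blast
  then have "{x, mate M x} \<in> E" using covered_edge[of e x] matching_subset[OF M] by auto
  from edge_V[OF this] show "mate M x \<noteq> x" by auto
next
  assume "mate M x \<noteq> x"
  then show "x \<in> \<Union>M" using mate_in by blast
qed

end

end

locale linear_forest_free = finite_simple_graph +
  fixes t :: nat
  assumes no_forest: "\<not> has_linear_forest E t"
begin

context
  fixes M
  assumes M: "matching E M"
begin

text \<open>Every edge of \<open>M\<close> that meets the path is one of three given pairs, so
  \<open>t\<close> edges are left to complete a linear forest.\<close>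

lemma cheap_path:
  assumes card: "t + 3 \<le> card M" and p: "path6 E u v w x y z"
    and cov: "\<And>s. s \<in> {u, v, w, x, y, z} \<Longrightarrow> s \<in> \<Union>M \<Longrightarrow> s \<in> {a, mate M a, b, mate M b, c, mate M c}"
  shows False
proof -
  let ?K = "{{a, mate M a}, {b, mate M b}, {c, mate M c}}"
  have "{e \<in> M. e \<inter> {u, v, w, x, y, z} \<noteq> {}} \<subseteq> ?K"
  proof
    fix e assume "e \<in> {e \<in> M. e \<inter> {u, v, w, x, y, z} \<noteq> {}}"
    then obtain s where s: "e \<in> M" "s \<in> e" "s \<in> {u, v, w, x, y, z}" by blast
    then have "s \<in> {a, mate M a, b, mate M b, c, mate M c}" using cov by blast
    then obtain r where r: "r \<in> {a, b, c}" "s \<in> {r, mate M r}" by blast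
    then have "e = {r, mate M r}" using covered_edge[OF M s(1,2)] mate_mate[OF M, of r] by auto
    then show "e \<in> ?K" using r by auto
  qed
  moreover have "card ?K \<le> 3" by (simp add: card_insert_if)
  ultimately show False using has_linear_forestI[OF p M finite_matching[OF M], of ?K 3 t] card no_forest by simp
qed

lemma short_paths_mate:
  assumes "t + 3 \<le> card M"
  shows "short_paths (\<lambda>x y. {x, y} \<in> E) (mate M)"
proof
  show "\<not> {x, x} \<in> E" for x by simp
  show "{x, y} \<in> E \<Longrightarrow> {y, x} \<in> E" for x y by (simp add: insert_commute)
  show "mate M (mate M x) = x" for x by (rule mate_mate[OF M])
  show "mate M x \<noteq> x \<Longrightarrow> {x, mate M x} \<in> E" for x
    using mate_in[OF M] matching_subset[OF M] by blast
  show False if "distinct [u, v, w, x, y, z]" "{u, v} \<in> E" "{v, w} \<in> E" "{w, x} \<in> E" "{x, y} \<in> E" "{y, z} \<in> E"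
    "{u, v, w, x, y, z} \<subseteq> {a, mate M a, b, mate M b, c, mate M c} \<union> {s. mate M s = s}" for u v w x y z a b c
  proof (rule cheap_path[OF assms])
    show "path6 E u v w x y z" unfolding path6_def using that by simp
    show "s \<in> {a, mate M a, b, mate M b, c, mate M c}" if "s \<in> {u, v, w, x, y, z}" "s \<in> \<Union>M" for s
      using that \<open>_ \<subseteq> _\<close> covered_iff[OF M] by blast
  qed
qed

end

text \<open>Exchanges along the end edges \<open>p1 p2\<close> and \<open>p6 p5\<close> cover the
  second and fifth vertex without making the matching smaller.\<close>

lemma matching_covering_second:
  assumes M: "matching E M" and p: "path6 E p1 p2 p3 p4 p5 p6"
  obtains N where "matching E N" "card M \<le> card N" "p2 \<in> \<Union>N" "p5 \<in> \<Union>N"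
proof -
  have e: "{p1, p2} \<in> E" "{p6, p5} \<in> E" "distinct [p1, p2, p3, p4, p5, p6]"
    using p unfolding path6_def by (auto simp: insert_commute)
  obtain M1 where M1: "matching E M1" "card M \<le> card M1" "p2 \<in> \<Union>M1"
  proof (cases "p2 \<in> \<Union>M")
    case False
    obtain N where "matching E N" "card M \<le> card N" "{p1, p2} \<in> N"
      by (rule matching_exchange[OF M finite_matching[OF M] e(1) False])
    then show ?thesis using that[of N] by blast
  qed (use M that in auto)
  show ?thesis
  proof (cases "p5 \<in> \<Union>M1")
    case False
    then obtain M2 where M2: "matching E M2" "card M1 \<le> card M2" "{p6, p5} \<in> M2"
      by (rule matching_exchange[OF M1(1) finite_matching[OF M1(1)] e(2)])
    show ?thesis
    \<comment> \<open>The exchange at \<open>p6\<close> uncovers \<open>p2\<close> again if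
      \<open>{p2, p6}\<close> was the edge given up; a further exchange at \<open>p1\<close> repairs
      this and keeps \<open>{p6, p5}\<close>.\<close>
    proof (cases "p2 \<in> \<Union>M2")
      case False
      then obtain M3 where M3: "matching E M3" "card M2 \<le> card M3" "{p1, p2} \<in> M3" "\<And>e. e \<in> M2 \<Longrightarrow> p1 \<notin> e \<Longrightarrow> e \<in> M3"
        using matching_exchange[OF M2(1) finite_matching[OF M2(1)] e(1)] by metis
      have "{p6, p5} \<in> M3" using M3(4)[OF M2(3)] e(3) by auto
      then show ?thesis using M3 M2 M1 that[of M3] by auto
    qed (use M2 M1 that[of M2] in auto)
  qed (use M1 that[of M1] in auto)
qed

text \<open>The abstract result is applied to a matching \<open>N\<close> that covers
  \<open>p2\<close> and \<open>p5\<close>; \<open>q3\<close> and \<open>q4\<close> are the mates of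
  \<open>p3\<close> and \<open>p4\<close>. The resulting path meets only the four edges of
  \<open>N\<close> at \<open>p2\<close>, ..., \<open>p5\<close>, so \<open>t + 4\<close> edges in
  \<open>N\<close> would leave \<open>t\<close> disjoint ones; this gives the bound on
  \<open>card M\<close>.\<close>

lemma double_broom:
  assumes p: "path6 E p1 p2 p3 p4 p5 p6" and M: "matching E M" "t + 3 \<le> card M"
  obtains r2 r5 q3 q4 where "path6 E r2 p2 p3 p4 p5 r5"
    "{p3, q3} \<in> E" "{p4, q4} \<in> E" "distinct [r2, p2, p3, p4, p5, r5, q3, q4]"
    "\<And>w. {q3, w} \<in> E \<longleftrightarrow> w = p3" "\<And>w. {q4, w} \<in> E \<longleftrightarrow> w = p4" "card M \<le> t + 3"
proof -
  obtain N where N: "matching E N" "card M \<le> card N" "p2 \<in> \<Union>N" "p5 \<in> \<Union>N"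
    using matching_covering_second[OF M(1) p] .
  have tN: "t + 3 \<le> card N" using N M by simp
  interpret short_paths "\<lambda>x y. {x, y} \<in> E" "mate N"
    by (rule short_paths_mate[OF N(1) tN])
  let ?m = "mate N"
  have cov: "?m p2 \<noteq> p2" "?m p5 \<noteq> p5" using N covered_iff[OF N(1)] by auto
  have e: "distinct [p1, p2, p3, p4, p5, p6]"
    "{p1, p2} \<in> E" "{p2, p3} \<in> E" "{p3, p4} \<in> E" "{p4, p5} \<in> E" "{p5, p6} \<in> E"
    using p unfolding path6_def by auto
  have d: "distinct [?m p2, p2, p3, p4, p5, ?m p5, ?m p3, ?m p4]"
    by (rule double_broom[OF e cov])
  have inE: "{p3, ?m p3} \<in> E" "{p4, ?m p4} \<in> E" "{p2, ?m p2} \<in> E" "{p5, ?m p5} \<in> E"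
    using R_m[of p3] R_m[of p4] R_m[of p2] R_m[of p5] d by auto
  have P: "path6 E (?m p2) p2 p3 p4 p5 (?m p5)"
    unfolding path6_def using d e inE by (auto simp: insert_commute)
  have l3: "w = p3" if "{?m p3, w} \<in> E" for w
    by (rule broom_leaf[OF d e(3,4,5) that])
  have l4: "w = p4" if "{?m p4, w} \<in> E" for w
    by (rule broom_leaf[of p5 p4 p3 p2]) (use d e that in \<open>auto simp: insert_commute\<close>)
  have "card N \<le> t + 3"
  proof (rule ccontr)
    assume "\<not> card N \<le> t + 3"
    let ?K = "{{p2, ?m p2}, {p3, ?m p3}, {p4, ?m p4}, {p5, ?m p5}}"
    have "{e \<in> N. e \<inter> {?m p2, p2, p3, p4, p5, ?m p5} \<noteq> {}} \<subseteq> ?K"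
    proof
      fix e assume "e \<in> {e \<in> N. e \<inter> {?m p2, p2, p3, p4, p5, ?m p5} \<noteq> {}}"
      then obtain s where s: "e \<in> N" "s \<in> e" "s \<in> {?m p2, p2, p3, p4, p5, ?m p5}" by blast
      then have "e = {s, ?m s}" using covered_edge[OF N(1)] by blast
      with s(3) show "e \<in> ?K" by (auto simp: insert_commute)
    qed
    moreover have "card ?K \<le> 4" by (simp add: card_insert_if)
    ultimately have "has_linear_forest E t"
      using has_linear_forestI[OF P N(1) finite_matching[OF N(1)], of ?K 4 t] \<open>\<not> card N \<le> t + 3\<close> by simp
    with no_forest show False by simp
  qed
  then have "card M \<le> t + 3" using N by simp
  with that[OF P inE(1,2) d] l3 l4 inE show ?thesis by (metis insert_commute)
qed

end

section \<open>Local structure of saturated graphs\<close>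

lemma has_linear_forestE:
  assumes "has_linear_forest E t"
  obtains a b c d e f M where "path6 E a b c d e f" "matching E M" "card M = t" "{a, b, c, d, e, f} \<inter> \<Union>M = {}"
  using assms unfolding has_linear_forest_def by blast

locale linear_forest_saturated = linear_forest_free +
  assumes saturated: "\<lbrakk>x \<in> V; y \<in> V; x \<noteq> y; {x, y} \<notin> E\<rbrakk> \<Longrightarrow> has_linear_forest (insert {x, y} E) t"
begin

lemma no_path_matching:
  assumes "path6 E a b c d e f" "matching E M" "card M = t" "{a, b, c, d, e, f} \<inter> \<Union>M = {}"
  shows False
  using assms no_forest unfolding has_linear_forest_def by blast

lemma matching_delete_edge: "matching (insert e E) M \<Longrightarrow> matching E (M - {e})"
  unfolding matching_def by (auto intro: pairwise_subset)

text \<open>Trades the edge \<open>e\<close> added to the graph for an old edge \<open>d\<close>,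
  which turns a linear forest that uses \<open>e\<close> only in its matching into one inside
  \<open>E\<close>.\<close>

lemma matching_replace:
  assumes M: "matching (insert e E) M" "e \<in> M" and "d \<in> E" "d \<inter> \<Union>(M - {e}) = {}" "card M = t"
  shows "matching E (insert d (M - {e}))" "card (insert d (M - {e})) = t"
proof -
  have m: "matching E (M - {e})" using M(1) by (rule matching_delete_edge)
  then show "matching E (insert d (M - {e}))" using assms by (intro matching_insert)
  have fin: "finite (M - {e})" using m by (rule finite_matching)
  have "d \<noteq> {}" using \<open>d \<in> E\<close> edgeE by blast
  then have "d \<notin> M - {e}" using assms(4) by blast
  then have "card (insert d (M - {e})) = Suc (card (M - {e}))" using fin by simp
  also have "\<dots> = card M" using fin M(2) by (metis card.insert_remove finite_insert insert_Diff insert_Diff_single)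
  finally show "card (insert d (M - {e})) = t" using assms by simp
qed

lemma path6_neighbour:
  assumes "path6 F a b c d e f" "x \<in> {a, b, c, d, e, f}"
  obtains y where "y \<in> {a, b, c, d, e, f}" "{x, y} \<in> F"
proof -
  have "{a, b} \<in> F" "{b, c} \<in> F" "{c, d} \<in> F" "{d, e} \<in> F" "{e, d} \<in> F" "{f, e} \<in> F"
    using assms(1) unfolding path6_def by (simp_all add: insert_commute)
  then show ?thesis using assms(2) that[of b] that[of c] that[of d] that[of e] by blast
qed

lemma path6_delete_edge:
  assumes "path6 (insert {u, v} E) a b c d e f"
    "{u, v} \<notin> {{a, b}, {b, c}, {c, d}, {d, e}, {e, f}}"
  shows "path6 E a b c d e f"
proof -
  have E: "g \<in> E" if "g \<in> insert {u, v} E" "g \<in> {{a, b}, {b, c}, {c, d}, {d, e}, {e, f}}" for g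
    using that assms(2) by (metis insertE)
  have "distinct [a, b, c, d, e, f]" using assms(1) unfolding path6_def by simp
  moreover have e: "{a, b} \<in> insert {u, v} E" "{b, c} \<in> insert {u, v} E" "{c, d} \<in> insert {u, v} E"
    "{d, e} \<in> insert {u, v} E" "{e, f} \<in> insert {u, v} E"
    using assms(1) unfolding path6_def by simp_all
  have "{a, b} \<in> E" "{b, c} \<in> E" "{c, d} \<in> E" "{d, e} \<in> E" "{e, f} \<in> E"
    using E[OF e(1)] E[OF e(2)] E[OF e(3)] E[OF e(4)] E[OF e(5)] by simp_all
  ultimately show ?thesis unfolding path6_def by simp
qed

section \<open>Edges added at the neighbour of a leaf\<close>

context
  fixes l u v a b c d e f M
  assumes leaf: "\<And>w. {l, w} \<in> E \<longleftrightarrow> w = u"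
    and uv: "u \<noteq> v" "{u, v} \<notin> E"
    and p: "path6 (insert {u, v} E) a b c d e f"
    and M: "matching (insert {u, v} E) M" "card M = t" "{a, b, c, d, e, f} \<inter> \<Union>M = {}"
begin

lemma leaf_only_neighbour: "{l, w} \<in> insert {u, v} E \<Longrightarrow> w = u" "l \<noteq> v" "l \<noteq> u"
proof -
  show "l \<noteq> v" using leaf uv by (auto simp: insert_commute)
  show "l \<noteq> u" using leaf[of u] by auto
  with \<open>l \<noteq> v\<close> show "{l, w} \<in> insert {u, v} E \<Longrightarrow> w = u" using leaf by (auto simp: doubleton_eq_iff)
qed

text \<open>If \<open>{u, v}\<close> were matched, \<open>u\<close> would be off the path, hence
  also the leaf \<open>l\<close>, whose only neighbour is \<open>u\<close>. Then
  \<open>{l, u}\<close> could replace \<open>{u, v}\<close>, and the linear forest would lie in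
  \<open>E\<close>.\<close>

lemma support_not_matched: "{u, v} \<notin> M"
proof
  assume uvM: "{u, v} \<in> M"
  have up: "u \<notin> {a, b, c, d, e, f}" using uvM M(3) by blast
  then have lp: "l \<notin> {a, b, c, d, e, f}"
    using path6_neighbour[OF p, of l] leaf_only_neighbour by metis
  have "u \<notin> \<Union>(M - {{u, v}})" using matching_disjoint[OF M(1) _ uvM, of _ u] by blast
  moreover have "l \<notin> \<Union>(M - {{u, v}})"
  proof
    assume "l \<in> \<Union>(M - {{u, v}})"
    then obtain g where g: "g \<in> M" "g \<noteq> {u, v}" "l \<in> g" by auto
    then have "g \<in> E" using matching_subset[OF M(1)] by auto
    then obtain w where "g = {l, w}" using g(3) by (elim edgeE) auto
    then have "u \<in> g" using \<open>g \<in> E\<close> leaf by auto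
    then show False using matching_disjoint[OF M(1) g(1) uvM, of u] g by auto
  qed
  ultimately have disj: "{l, u} \<inter> \<Union>(M - {{u, v}}) = {}" by blast
  have "{l, u} \<in> E" using leaf by simp
  note N = matching_replace[OF M(1) uvM this disj M(2)]
  have "path6 E a b c d e f" by (rule path6_delete_edge[OF p]) (use up in \<open>auto simp: doubleton_eq_iff\<close>)
  moreover have "{a, b, c, d, e, f} \<inter> \<Union>(insert {l, u} (M - {{u, v}})) = {}"
    using M(3) up lp by auto
  ultimately show False using no_path_matching N by blast
qed

lemma support_matching: "matching E M"
  using matching_delete_edge[OF M(1)] support_not_matched by simp

text \<open>A path beginning with \<open>v, u\<close> could begin with \<open>l, u\<close> instead:
  \<open>l\<close> is not matched, because its partner would be \<open>u\<close>, and it is not on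
  the path, because it would have a path neighbour other than \<open>u\<close>.\<close>

lemma support_path_start: "\<not> (a = v \<and> b = u)"
proof
  assume ab: "a = v \<and> b = u"
  have d: "distinct [a, b, c, d, e, f]" and
    e: "{c, d} \<in> insert {u, v} E" "{e, d} \<in> insert {u, v} E" "{f, e} \<in> insert {u, v} E" "{d, c} \<in> insert {u, v} E"
    using p unfolding path6_def by (auto simp: insert_commute)
  have lp: "l \<notin> {a, b, c, d, e, f}" using leaf_only_neighbour(1)[of d] leaf_only_neighbour(1)[of e]
    leaf_only_neighbour(1)[of c] leaf_only_neighbour(2,3) e d ab by auto
  have "l \<notin> \<Union>M"
  proof
    assume "l \<in> \<Union>M"
    then obtain g where g: "g \<in> M" "l \<in> g" by auto
    then have "g \<in> E" using matching_subset[OF support_matching] by auto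
    then obtain w where "g = {l, w}" using g(2) by (elim edgeE) auto
    then have "u \<in> g" using \<open>g \<in> E\<close> leaf by auto
    then show False using g(1) M(3) ab by auto
  qed
  moreover have "path6 E l b c d e f"
    using p d lp ab leaf[of u] unfolding path6_def by (auto simp: doubleton_eq_iff)
  ultimately show False using M(2,3) support_matching by (intro no_path_matching[of l b c d e f M]) auto
qed

end

text \<open>The copy must use \<open>{u, v}\<close> in its path, and by
  \<open>support_path_start\<close> not as an end edge with \<open>v\<close> outermost. Reversing
  the path if necessary puts \<open>v\<close> before \<open>u\<close>, so \<open>v\<close> always
  has a predecessor.\<close>

lemma added_edge_at_support:
  assumes leaf: "\<And>w. {l, w} \<in> E \<longleftrightarrow> w = u" and v: "v \<in> V" "u \<noteq> v" "{u, v} \<notin> E"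
  obtains a b c d e f M where "path6 (insert {u, v} E) a b c d e f" "matching E M" "card M = t"
    "{a, b, c, d, e, f} \<inter> \<Union>M = {}"
    "b = v \<and> c = u \<or> c = v \<and> d = u \<or> d = v \<and> e = u \<or> e = v \<and> f = u"
proof -
  have "{l, u} \<in> E" using leaf by simp
  then have "u \<in> V" using edge_V by blast
  then obtain a b c d e f M where F: "path6 (insert {u, v} E) a b c d e f" "matching (insert {u, v} E) M" "card M = t"
    "{a, b, c, d, e, f} \<inter> \<Union>M = {}" by (rule has_linear_forestE[OF saturated[OF _ v]])
  have M: "matching E M" by (rule support_matching[OF leaf v(2,3) F])
  have F': "path6 (insert {u, v} E) f e d c b a" "{f, e, d, c, b, a} \<inter> \<Union>M = {}"
    using path6_rev[OF F(1)] F(4) by auto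
  have start: "\<not> (a = v \<and> b = u)" by (rule support_path_start[OF leaf v(2,3) F])
  have "end": "\<not> (f = v \<and> e = u)" by (rule support_path_start[OF leaf v(2,3) F'(1) F(2,3) F'(2)])
  have "{u, v} \<in> {{a, b}, {b, c}, {c, d}, {d, e}, {e, f}}"
  proof (rule ccontr)
    assume "{u, v} \<notin> {{a, b}, {b, c}, {c, d}, {d, e}, {e, f}}"
    from path6_delete_edge[OF F(1) this] show False by (rule no_path_matching[OF _ M F(3,4)])
  qed
  then have "(b = v \<and> c = u \<or> c = v \<and> d = u \<or> d = v \<and> e = u \<or> e = v \<and> f = u) \<or>
      (e = v \<and> d = u \<or> d = v \<and> c = u \<or> c = v \<and> b = u \<or> b = v \<and> a = u)"
    using start "end" by (auto simp: doubleton_eq_iff)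
  then show ?thesis
    using that[OF F(1) M F(3,4)] that[OF F'(1) M F(3) F'(2)] by blast
qed

text \<open>Adding \<open>{u, v}\<close> would put the isolated vertex \<open>v\<close> inside a
  path, between \<open>u\<close> and a second neighbour that it does not have.\<close>

lemma isolated_imp_no_leaf:
  assumes v: "v \<in> V" "\<And>w. {v, w} \<notin> E" and leaf: "\<And>w. {l, w} \<in> E \<longleftrightarrow> w = u"
  shows False
proof -
  have "u \<noteq> v" using leaf[of u] v(2)[of l] by (auto simp: insert_commute)
  moreover have "{u, v} \<notin> E" using v(2)[of u] by (simp add: insert_commute)
  ultimately obtain a b c d e f where p: "path6 (insert {u, v} E) a b c d e f"
    and pos: "b = v \<and> c = u \<or> c = v \<and> d = u \<or> d = v \<and> e = u \<or> e = v \<and> f = u"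
    by (rule added_edge_at_support[OF leaf v(1)])
  have nb: "w = u" if "{w, v} \<in> insert {u, v} E" for w
    using that v(2)[of w] by (auto simp: insert_commute doubleton_eq_iff)
  have "distinct [a, b, c, d, e, f]" "{a, b} \<in> insert {u, v} E" "{b, c} \<in> insert {u, v} E"
    "{c, d} \<in> insert {u, v} E" "{d, e} \<in> insert {u, v} E"
    using p unfolding path6_def by auto
  then show False using pos nb[of a] nb[of b] nb[of c] nb[of d] by (elim disjE) simp_all
qed

section \<open>Vertices of degree two\<close>

context
  fixes x y z a b c d e f M
  assumes nbrs: "\<And>w. {x, w} \<in> E \<longleftrightarrow> w = y \<or> w = z" and yz: "y \<noteq> z" "{y, z} \<notin> E"
    and p: "path6 (insert {y, z} E) a b c d e f"
    and M: "matching (insert {y, z} E) M" "card M = t" "{a, b, c, d, e, f} \<inter> \<Union>M = {}"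
begin

lemma degree_two_neighbour: "{x, w} \<in> insert {y, z} E \<Longrightarrow> w = y \<or> w = z" "x \<noteq> y" "x \<noteq> z"
proof -
  show "x \<noteq> y" "x \<noteq> z" using nbrs[of x] by auto
  then show "{x, w} \<in> insert {y, z} E \<Longrightarrow> w = y \<or> w = z" using nbrs by (auto simp: doubleton_eq_iff)
qed

lemma degree_two_in_matching: assumes "g \<in> M" "x \<in> g" shows "y \<in> g \<or> z \<in> g"
proof -
  have "g \<in> insert {y, z} E" using matching_subset[OF M(1)] assms by auto
  then have "g \<in> E" using assms(2) degree_two_neighbour by auto
  then obtain w where "g = {x, w}" using assms(2) by (elim edgeE) auto
  then show ?thesis using \<open>g \<in> E\<close> nbrs by auto
qed

text \<open>The exchange used for leaves applies with \<open>{x, y}\<close>: both neighbours of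
  \<open>x\<close> are off the path, hence so is \<open>x\<close>.\<close>

lemma degree_two_not_matched: "{y, z} \<notin> M"
proof
  assume yzM: "{y, z} \<in> M"
  have yzp: "y \<notin> {a, b, c, d, e, f}" "z \<notin> {a, b, c, d, e, f}" using yzM M(3) by blast+
  then have xp: "x \<notin> {a, b, c, d, e, f}"
    using path6_neighbour[OF p, of x] degree_two_neighbour by metis
  have "y \<notin> \<Union>(M - {{y, z}})" using matching_disjoint[OF M(1) _ yzM, of _ y] by blast
  moreover have "x \<notin> \<Union>(M - {{y, z}})"
  proof
    assume "x \<in> \<Union>(M - {{y, z}})"
    then obtain g where g: "g \<in> M" "g \<noteq> {y, z}" "x \<in> g" by auto
    then show False using degree_two_in_matching[of g] matching_disjoint[OF M(1) g(1) yzM, of y]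
       matching_disjoint[OF M(1) g(1) yzM, of z] by auto
  qed
  ultimately have disj: "{x, y} \<inter> \<Union>(M - {{y, z}}) = {}" by blast
  have "{x, y} \<in> E" using nbrs by simp
  note N = matching_replace[OF M(1) yzM this disj M(2)]
  have "path6 E a b c d e f" by (rule path6_delete_edge[OF p]) (use yzp in \<open>auto simp: doubleton_eq_iff\<close>)
  moreover have "{a, b, c, d, e, f} \<inter> \<Union>(insert {x, y} (M - {{y, z}})) = {}"
    using M(3) yzp xp by auto
  ultimately show False using no_path_matching N by blast
qed

lemma degree_two_matching: "matching E M"
  using matching_delete_edge[OF M(1)] degree_two_not_matched by simp

text \<open>A path that uses \<open>{y, z}\<close> can be rerouted through \<open>x\<close>, which
  no edge of \<open>M\<close> covers. Only the first three edges are treated, as the others follow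
  by reversal.\<close>

lemma degree_two_path: "{y, z} \<notin> {{a, b}, {b, c}, {c, d}}"
proof
  assume e: "{y, z} \<in> {{a, b}, {b, c}, {c, d}}"
  have dist: "distinct [a, b, c, d, e, f]" using p unfolding path6_def by simp
  have "x \<notin> \<Union>M" using degree_two_in_matching M(3) e by (auto simp: doubleton_eq_iff)
  then have disj: "{x, a, b, c, d, e, f} \<inter> \<Union>M = {}" using M(3) by simp
  have subset_disjoint: "A \<subseteq> B \<Longrightarrow> B \<inter> C = {} \<Longrightarrow> A \<inter> C = {}" for A B C :: "'a set" by blast
  have bad: "\<not> path6 E a' b' c' d' e' f'"
    if "{a', b', c', d', e', f'} \<subseteq> {x, a, b, c, d, e, f}" for a' b' c' d' e' f'
    using no_path_matching[OF _ degree_two_matching M(2) subset_disjoint[OF that disj]] by metis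
  have nb: "{r, s} = {y, z}" if "{x, r} \<in> insert {y, z} E" "{x, s} \<in> insert {y, z} E" "r \<noteq> s" for r s
    using degree_two_neighbour(1)[OF that(1)] degree_two_neighbour(1)[OF that(2)] that(3) by auto
  have xE: "{x, r} \<in> E \<and> {r, x} \<in> E" if "r \<in> {y, z}" for r using nbrs[of r] that by (auto simp: insert_commute)
  have pE: "{a, b} \<in> insert {y, z} E" "{b, c} \<in> insert {y, z} E" "{c, d} \<in> insert {y, z} E"
    "{d, e} \<in> insert {y, z} E" "{e, f} \<in> insert {y, z} E" using p unfolding path6_def by auto
  show False
  proof (cases "x \<in> {a, b, c, d, e, f}")
    case False
    \<comment> \<open>With \<open>x\<close> off the path, insert it between \<open>y\<close> and
      \<open>z\<close> and drop the last vertex \<open>f\<close>.\<close>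
    consider "{y, z} = {a, b}" | "{y, z} = {b, c}" | "{y, z} = {c, d}" using e by auto
    then show False
    proof cases
      case 1
      then have "y = a \<and> z = b \<or> y = b \<and> z = a" by (simp add: doubleton_eq_iff)
      then have "path6 E a x b c d e" unfolding path6_def using False dist pE xE[of a] xE[of b]
        by (elim disjE conjE; auto simp add: doubleton_eq_iff)
      then show False using bad[of a x b c d e] by simp
    next
      case 2
      then have "y = b \<and> z = c \<or> y = c \<and> z = b" by (simp add: doubleton_eq_iff)
      then have "path6 E a b x c d e" unfolding path6_def using False dist pE xE[of b] xE[of c]
        by (elim disjE conjE; auto simp add: doubleton_eq_iff)
      then show False using bad[of a b x c d e] by simp
    next
      case 3
      then have "y = c \<and> z = d \<or> y = d \<and> z = c" by (simp add: doubleton_eq_iff)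
      then have "path6 E a b c x d e" unfolding path6_def using False dist pE xE[of c] xE[of d]
        by (elim disjE conjE; auto simp add: doubleton_eq_iff)
      then show False using bad[of a b c x d e] by simp
    qed
  next
    case True
    have pE': "{b, a} \<in> insert {y, z} E" "{c, b} \<in> insert {y, z} E" "{d, c} \<in> insert {y, z} E"
      "{e, d} \<in> insert {y, z} E" "{f, e} \<in> insert {y, z} E" using pE by (simp_all only: insert_commute)
    \<comment> \<open>An inner \<open>x\<close> would have \<open>y\<close> and \<open>z\<close> as
      its two path neighbours, and the path edge \<open>{y, z}\<close> would close a triangle. A
      last vertex \<open>x = f\<close> would put \<open>e\<close> into \<open>{y, z}\<close>, beyond
      the first three edges.\<close>
    have "x \<noteq> b" "x \<noteq> c" "x \<noteq> d" "x \<noteq> e"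
      using e dist nb[of a c] nb[of b d] nb[of c e] nb[of d f] pE pE' by (auto simp: doubleton_eq_iff)
    moreover have "x \<noteq> f" using e dist degree_two_neighbour(1)[of e] pE' by (auto simp: doubleton_eq_iff)
    ultimately have "x = a" using True by simp
    \<comment> \<open>Only \<open>{y, z} = {b, c}\<close> is left; swapping the first two vertices
      yields the path \<open>b, x, c, d, e, f\<close>.\<close>
    moreover from this have "{y, z} = {b, c}"
      using e dist degree_two_neighbour(1)[of b] degree_two_neighbour(2,3) pE by (auto simp: doubleton_eq_iff)
    ultimately have "x = a" "y = b \<and> z = c \<or> y = c \<and> z = b" by (simp_all add: doubleton_eq_iff)
    from this(2) have "path6 E b x c d e f" unfolding path6_def \<open>x = a\<close> using dist pE xE[of b] xE[of c]
      by (elim disjE conjE; auto simp add: doubleton_eq_iff \<open>x = a\<close>)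
    then show False using bad[of b x c d e f] by simp
  qed
qed

end

text \<open>Otherwise the added edge \<open>{y, z}\<close> would be among the first three edges of
  the path read from one of its two ends, which \<open>degree_two_path\<close> rules out.\<close>

lemma degree_two_triangle:
  assumes nbrs: "\<And>w. {x, w} \<in> E \<longleftrightarrow> w = y \<or> w = z" and yz: "y \<noteq> z"
  shows "{y, z} \<in> E"
proof (rule ccontr)
  assume n: "{y, z} \<notin> E"
  have "y \<in> V" "z \<in> V" using nbrs edge_V by blast+
  then obtain a b c d e f M where F: "path6 (insert {y, z} E) a b c d e f" "matching (insert {y, z} E) M" "card M = t"
    "{a, b, c, d, e, f} \<inter> \<Union>M = {}" by (rule has_linear_forestE[OF saturated[OF _ _ yz n]])
  have M: "matching E M" by (rule degree_two_matching[OF nbrs yz n F])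
  have F': "path6 (insert {y, z} E) f e d c b a" "{f, e, d, c, b, a} \<inter> \<Union>M = {}"
    using path6_rev[OF F(1)] F(4) by auto
  have "{y, z} \<notin> {{a, b}, {b, c}, {c, d}}" by (rule degree_two_path[OF nbrs yz n F])
  moreover have "{y, z} \<notin> {{f, e}, {e, d}, {d, c}}" by (rule degree_two_path[OF nbrs yz n F'(1) F(2,3) F'(2)])
  ultimately have "path6 E a b c d e f" by (intro path6_delete_edge[OF F(1)]) (auto simp: insert_commute)
  then show False using no_path_matching[OF _ M F(3,4)] by blast
qed

end

context linear_forest_free
begin

lemma matching_insert_edge:
  assumes "matching E M" "{x, y} \<in> E" "x \<notin> \<Union>M" "y \<notin> \<Union>M"
  shows "matching E (insert {x, y} M)" "card (insert {x, y} M) = Suc (card M)"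
    "\<Union>(insert {x, y} M) = {x, y} \<union> \<Union>M"
proof -
  show "matching E (insert {x, y} M)" using assms by (intro matching_insert) auto
  have "{x, y} \<notin> M" using assms by auto
  then show "card (insert {x, y} M) = Suc (card M)" using finite_matching[OF assms(1)] by simp
qed simp

lemma leaf_uncovered:
  assumes "matching E M" "\<And>w. {l, w} \<in> E \<longleftrightarrow> w = u" "u \<notin> \<Union>M"
  shows "l \<notin> \<Union>M"
proof
  assume "l \<in> \<Union>M"
  then obtain g where g: "g \<in> M" "l \<in> g" by auto
  then have "g \<in> E" using matching_subset[OF assms(1)] by auto
  then obtain w where "g = {l, w}" using g(2) by (elim edgeE) auto
  then show False using g \<open>g \<in> E\<close> assms(2)[of w] assms(3) by auto
qed

end

context linear_forest_saturated
begin

text \<open>Adding \<open>{p3, a}\<close> creates no linear forest, against saturation. The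
  hypothesis \<open>short\<close> limits how much of a new path can lie behind \<open>a\<close>; in
  the remaining cases its pieces are recombined into a matching with \<open>t + 4\<close> edges, or
  into a path meeting at most three edges of a matching with \<open>t + 3\<close> edges.\<close>

lemma no_distant_support:
  assumes p: "path6 E p1 p2 p3 p4 p5 p6" and M0: "matching E M0" "t + 3 \<le> card M0"
    and leaf: "\<And>w. {b, w} \<in> E \<longleftrightarrow> w = a"
    and short: "\<And>u v w. {a, u} \<in> E \<Longrightarrow> {u, v} \<in> E \<Longrightarrow> {v, w} \<in> E \<Longrightarrow> distinct [a, u, v, w] \<Longrightarrow> False"
    and far: "a \<noteq> p3" "{p3, a} \<notin> E"
  shows False
proof -
  \<comment> \<open>By the double broom, the presence of one path bounds all matchings.\<close>
  have max: "card M \<le> t + 3" if "matching E M" for M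
  proof (cases "t + 3 \<le> card M")
    case True
    show ?thesis by (rule double_broom[OF p that True])
  qed simp
  obtain r2 r5 q3 q4 where P: "path6 E r2 p2 p3 p4 p5 r5"
    and q: "{p3, q3} \<in> E" "{p4, q4} \<in> E" and dist: "distinct [r2, p2, p3, p4, p5, r5, q3, q4]"
    and l3: "\<And>w. {q3, w} \<in> E \<longleftrightarrow> w = p3" and l4: "\<And>w. {q4, w} \<in> E \<longleftrightarrow> w = p4"
    by (rule double_broom[OF p M0]) (rule that)
  have e: "{r2, p2} \<in> E" "{p2, p3} \<in> E" "{p3, p4} \<in> E" "{p4, p5} \<in> E" "{p5, r5} \<in> E"
    "{p3, p2} \<in> E" "{p4, p3} \<in> E" "{p5, p4} \<in> E" "{r5, p5} \<in> E"
    using P unfolding path6_def by (simp_all add: insert_commute)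
  have ab: "{a, b} \<in> E" "{b, a} \<in> E" using leaf[of a] by (simp_all add: insert_commute)
  then have aV: "a \<in> V" "a \<noteq> b" using edge_V by blast+
  have far': "{a, p3} \<notin> E" "p3 \<noteq> a" using far by (simp_all add: insert_commute)
  have b_ne: "b \<noteq> p3" "b \<noteq> q3" "b \<noteq> q4" "b \<noteq> p4" "a \<noteq> p4" "a \<noteq> q3" "a \<noteq> q4"
    using leaf[of p4] leaf[of p3] l3[of a] l4[of a] l3[of b] l4[of b] e(3) e(7) far far' dist ab by auto
  \<comment> \<open>\<open>p3\<close> is the neighbour of the leaf \<open>q3\<close>, so
    \<open>added_edge_at_support\<close> applies and puts \<open>a\<close> before \<open>p3\<close>
    on the new path.\<close>
  obtain v1 v2 v3 v4 v5 v6 M where F: "path6 (insert {p3, a} E) v1 v2 v3 v4 v5 v6" "matching E M" "card M = t"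
    "{v1, v2, v3, v4, v5, v6} \<inter> \<Union>M = {}"
    and pos: "v2 = a \<and> v3 = p3 \<or> v3 = a \<and> v4 = p3 \<or> v4 = a \<and> v5 = p3 \<or> v5 = a \<and> v6 = p3"
    by (rule added_edge_at_support[OF l3 aV(1) far'(2) far(2)])
  have vd: "distinct [v1, v2, v3, v4, v5, v6]" and
    vE: "{v1, v2} \<in> insert {p3, a} E" "{v2, v3} \<in> insert {p3, a} E" "{v3, v4} \<in> insert {p3, a} E"
    "{v4, v5} \<in> insert {p3, a} E" "{v5, v6} \<in> insert {p3, a} E"
    using F(1) unfolding path6_def by simp_all
  have vM: "v1 \<notin> \<Union>M" "v2 \<notin> \<Union>M" "v3 \<notin> \<Union>M" "v4 \<notin> \<Union>M" "v5 \<notin> \<Union>M" "v6 \<notin> \<Union>M" using F(4) by blast+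
  have apM: "a \<notin> \<Union>M" "p3 \<notin> \<Union>M" using pos vM by auto
  then have bqM: "b \<notin> \<Union>M" "q3 \<notin> \<Union>M"
    using leaf_uncovered[OF F(2) leaf] leaf_uncovered[OF F(2) l3] by auto
  note N1 = matching_insert_edge[OF F(2) ab(1) apM(1) bqM(1)]
  have pN1: "p3 \<notin> \<Union>(insert {a, b} M)" "q3 \<notin> \<Union>(insert {a, b} M)"
    using apM bqM b_ne far' unfolding N1(3) by auto
  \<comment> \<open>Both leaf edges can be added to \<open>M\<close>, as \<open>a\<close> and
    \<open>p3\<close> lie on the new path and are therefore uncovered. \<open>N\<close> has
    \<open>t + 2\<close> edges, and two more contradict \<open>max\<close>.\<close>
  define N where "N = insert {p3, q3} (insert {a, b} M)"
  note N2 = matching_insert_edge[OF N1(1) q(1) pN1, folded N_def]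
  have N: "matching E N" "card N = t + 2" "\<Union>N = {p3, q3, a, b} \<union> \<Union>M"
    using N2 N1 F(3) by auto
  have off: "{x, y} \<in> E \<Longrightarrow> x \<notin> \<Union>N" if "x \<notin> \<Union>M" "x \<noteq> p3" "x \<noteq> a" "y \<noteq> a" "y \<noteq> p3" for x y
    using that leaf[of y] l3[of y] unfolding N(3) by auto
  consider "v2 = a" "v3 = p3" | "v3 = a" "v4 = p3" | "v4 = a" "v5 = p3" | "v5 = a" "v6 = p3" using pos by blast
  then show False
  proof cases
    \<comment> \<open>With \<open>a\<close> in fourth or fifth position, the three vertices before
      it continue from \<open>a\<close> as a path that \<open>short\<close> forbids.\<close>
    case 3
    then have "{v3, v4} \<in> E" "{v2, v3} \<in> E" "{v1, v2} \<in> E" using vE vd by (auto simp: doubleton_eq_iff)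
    then show False using short[of v3 v2 v1] vd 3 by (auto simp: insert_commute)
  next
    case 4
    then have "{v4, v5} \<in> E" "{v3, v4} \<in> E" "{v2, v3} \<in> E" using vE vd by (auto simp: doubleton_eq_iff)
    then show False using short[of v4 v3 v2] vd 4 by (auto simp: insert_commute)
  next
    \<comment> \<open>The edges \<open>{v1, v2}\<close> and \<open>{v5, v6}\<close> on both sides
      extend \<open>N\<close> to \<open>t + 4\<close> edges.\<close>
    case 2
    then have ve: "{v1, v2} \<in> E" "{v2, v1} \<in> E" "{v5, v6} \<in> E" "{v6, v5} \<in> E" using vE vd by (auto simp: doubleton_eq_iff insert_commute)
    then have vN: "v1 \<notin> \<Union>N" "v2 \<notin> \<Union>N" "v5 \<notin> \<Union>N" "v6 \<notin> \<Union>N"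
      using off[of v1 v2] off[of v2 v1] off[of v5 v6] off[of v6 v5] vM vd 2 by auto
    note A = matching_insert_edge[OF N(1) ve(1) vN(1,2)]
    have "v5 \<notin> \<Union>(insert {v1, v2} N)" "v6 \<notin> \<Union>(insert {v1, v2} N)" using vN vd unfolding A(3) by auto
    note B = matching_insert_edge[OF A(1) ve(3) this]
    show False using max[OF B(1)] A(2) B(2) N(2) by simp
  next
    \<comment> \<open>Three vertices \<open>v4, v5, v6\<close> follow \<open>p3\<close>, and the
      position of the other broom centre \<open>p4\<close> among them decides. In first or last
      place, \<open>{p4, q4}\<close> and the edge between the other two extend \<open>N\<close> to
      \<open>t + 4\<close> edges.\<close>
    case 1
    then have ye: "{p3, v4} \<in> E" "{v4, p3} \<in> E" "{v4, v5} \<in> E" "{v5, v4} \<in> E" "{v5, v6} \<in> E" "{v6, v5} \<in> E"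
      using vE vd by (auto simp: doubleton_eq_iff insert_commute)
    have yN: "v4 \<notin> \<Union>N" "v5 \<notin> \<Union>N" "v6 \<notin> \<Union>N"
      using off[of v4 v5] off[of v5 v4] off[of v6 v5] vM vd 1 ye by auto
    have yd: "distinct [v4, v5, v6]" "p3 \<notin> {v4, v5, v6}" "a \<notin> {v4, v5, v6}" using vd 1 by auto
    have q4y: "q4 \<noteq> v4" "q4 = v5 \<Longrightarrow> p4 = v4 \<and> p4 = v6" "q4 = v6 \<Longrightarrow> p4 = v5"
      using l4[of p3] l4[of v4] l4[of v5] l4[of v6] ye dist by auto
    have q4N: "q4 \<notin> \<Union>N" if "p4 \<notin> \<Union>M"
      using leaf_uncovered[OF F(2) l4 that] dist b_ne unfolding N(3) by auto
    note A = matching_insert_edge[OF N(1) ye(5) yN(2,3)]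
    consider "p4 = v4" | "p4 = v5" | "p4 = v6" | "p4 \<notin> {v4, v5, v6}" by blast
    then show False
    proof cases
      case c: 1
      then have "v4 \<notin> \<Union>(insert {v5, v6} N)" "q4 \<notin> \<Union>(insert {v5, v6} N)"
        using yN yd q4N q4y vM unfolding A(3) by auto
      note B = matching_insert_edge[OF A(1) q(2)[unfolded c] this]
      show False using max[OF B(1)] A(2) B(2) N(2) by simp
    next
      case c: 3
      note A' = matching_insert_edge[OF N(1) ye(3) yN(1,2)]
      have "v6 \<notin> \<Union>(insert {v4, v5} N)" "q4 \<notin> \<Union>(insert {v4, v5} N)"
        using yN yd q4N q4y vM c unfolding A'(3) by auto
      note B = matching_insert_edge[OF A'(1) q(2)[unfolded c] this]
      show False using max[OF B(1)] A'(2) B(2) N(2) by simp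
    next
      case c: 4
      let ?N = "insert {v5, v6} N"
      have big: "t + 3 \<le> card ?N" using A(2) N(2) by simp
      \<comment> \<open>Going back from \<open>v6\<close> to \<open>p3\<close> and on through
        \<open>p4\<close> to its leaf meets only the edges at \<open>v5\<close>, \<open>p3\<close>
        and \<open>p4\<close>, while \<open>v4\<close> is uncovered.\<close>
      have "path6 E v6 v5 v4 p3 p4 q4" unfolding path6_def using ye yd c q4y dist e(3) q(2) by auto
      then show False
      proof (rule cheap_path[OF A(1) big])
        have m: "mate ?N v5 = v6" by (rule mate_eq[OF A(1)]) simp
        show "s \<in> {v5, mate ?N v5, p3, mate ?N p3, p4, mate ?N p4}"
          if "s \<in> {v6, v5, v4, p3, p4, q4}" "s \<in> \<Union>?N" for s
        proof -
          have "v4 \<notin> \<Union>?N" using yN yd unfolding A(3) by auto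
          with that(2) have "s \<noteq> v4" by metis
          moreover have "s = mate ?N p4" if "s = q4"
          proof -
            have "mate ?N q4 \<noteq> q4" using \<open>s \<in> \<Union>?N\<close> that covered_iff[OF A(1)] by metis
            then have "{q4, mate ?N q4} \<in> E" using mate_in[OF A(1)] matching_subset[OF A(1)] by blast
            then have "mate ?N q4 = p4" using l4 by blast
            then show ?thesis using mate_mate[OF A(1), of q4] that by simp
          qed
          ultimately show ?thesis using that(1) m by auto
        qed
      qed
    next
      \<comment> \<open>Now \<open>v4\<close> is uncovered and adjacent to both \<open>p3\<close>
        and \<open>p4\<close>. One arm of the broom, the detour \<open>p3, v4, p4\<close> and a leaf
        form a path that meets at most three matching edges.\<close>
      case c: 2
      have "p4 \<notin> \<Union>N" "q4 \<notin> \<Union>N" using c yN q4N vM by auto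
      note B = matching_insert_edge[OF N(1) q(2) this]
      let ?N = "insert {p4, q4} N"
      have mates: "mate ?N p3 = q3" "mate ?N q3 = p3" "mate ?N p4 = q4" "mate ?N q4 = p4"
        by (rule mate_eq[OF B(1)], simp add: N_def insert_commute)+
      have y: "v4 \<notin> \<Union>?N" "v4 \<noteq> q3" "{v4, p4} \<in> E" "{p4, v4} \<in> E" "v4 \<noteq> p4" "v4 \<noteq> p3"
        using yN yd q4y c ye unfolding B(3) by (auto simp: N(3))
      \<comment> \<open>\<open>r\<close> is chosen as the mate of \<open>s\<close> when
        \<open>s\<close> is covered, so that \<open>{r, s}\<close> meets at most one matching edge
        in either case.\<close>
      have ext: "\<exists>r. {r, s} \<in> E \<and> r \<notin> {p3, p4, q3, q4, v4, s} \<and> (s \<in> \<Union>?N \<longrightarrow> s = mate ?N r)"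
        if s: "{r0, s} \<in> E" "s \<notin> {p3, p4, q3, q4, v4}" "r0 \<notin> {p3, p4, q3, q4, v4}" for r0 s
      proof (cases "s \<in> \<Union>?N")
        case True
        let ?r = "mate ?N s"
        have "?r \<noteq> s" using True covered_iff[OF B(1)] by blast
        then have "{s, ?r} \<in> ?N" by (rule mate_in[OF B(1)])
        moreover from this have "?r \<in> \<Union>?N" by blast
        moreover have "?r \<notin> {p3, p4, q3, q4}"
        proof
          assume "?r \<in> {p3, p4, q3, q4}"
          then have "mate ?N ?r \<in> {p3, p4, q3, q4}" using mates by auto
          then show False using s(2) mate_mate[OF B(1), of s] by simp
        qed
        ultimately show ?thesis using y(1) \<open>?r \<noteq> s\<close> matching_subset[OF B(1)] mate_mate[OF B(1), of s]
          by (intro exI[of _ ?r]) (auto simp: insert_commute)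
      next
        case False
        moreover have "r0 \<noteq> s" using s edge_V by blast
        ultimately show ?thesis using s by (intro exI[of _ r0]) auto
      qed
      have big: "t + 3 \<le> card ?N" using B(2) N(2) by simp
      show False
      \<comment> \<open>\<open>v4\<close> may itself belong to one arm; the arm at \<open>p2\<close>
        is used if it avoids \<open>v4\<close>, and otherwise the arm at \<open>p5\<close>.\<close>
      proof (cases "v4 \<in> {r2, p2}")
        case False
        then obtain r where r: "{r, p2} \<in> E" "r \<notin> {p3, p4, q3, q4, v4, p2}" "p2 \<in> \<Union>?N \<Longrightarrow> p2 = mate ?N r"
          using ext[of r2 p2] e(1) dist by auto
        have "path6 E r p2 p3 v4 p4 q4" unfolding path6_def using r False y e q ye dist q4y by auto
        then show False
        proof (rule cheap_path[OF B(1) big])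
          show "s \<in> {r, mate ?N r, p3, mate ?N p3, p4, mate ?N p4}"
            if "s \<in> {r, p2, p3, v4, p4, q4}" "s \<in> \<Union>?N" for s
          proof -
            have "s \<noteq> v4" "s = p2 \<Longrightarrow> s = mate ?N r" using that(2) r(3) y(1) by metis+
            then show ?thesis using that(1) mates by auto
          qed
        qed
      next
        case True
        then have "v4 \<notin> {r5, p5}" using dist by auto
        then obtain r where r: "{r, p5} \<in> E" "r \<notin> {p3, p4, q3, q4, v4, p5}" "p5 \<in> \<Union>?N \<Longrightarrow> p5 = mate ?N r"
          using ext[of r5 p5] e(9) dist by auto
        have "path6 E r p5 p4 v4 p3 q3" unfolding path6_def using r \<open>v4 \<notin> {r5, p5}\<close> y e q ye dist q4y by auto
        then show False
        proof (rule cheap_path[OF B(1) big])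
          show "s \<in> {r, mate ?N r, p3, mate ?N p3, p4, mate ?N p4}"
            if "s \<in> {r, p5, p4, v4, p3, q3}" "s \<in> \<Union>?N" for s
          proof -
            have "s \<noteq> v4" "s = p5 \<Longrightarrow> s = mate ?N r" using that(2) r(3) y(1) by metis+
            then show ?thesis using that(1) mates by auto
          qed
        qed
      qed
    qed
  qed
qed

end

section \<open>Components and trees\<close>

definition adj_rel :: "'a set set \<Rightarrow> 'a rel" where
  "adj_rel E = {(x, y). {x, y} \<in> E}"

definition component :: "'a set set \<Rightarrow> 'a \<Rightarrow> 'a set" where
  "component E x = {y. (x, y) \<in> (adj_rel E)\<^sup>*}"

definition inner_edges :: "'a set set \<Rightarrow> 'a set \<Rightarrow> 'a set set" where
  "inner_edges E C = {e \<in> E. e \<subseteq> C}"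

definition degree :: "'a set set \<Rightarrow> 'a \<Rightarrow> nat" where
  "degree E x = card {y. {x, y} \<in> E}"

lemma sym_adj_rel: "sym (adj_rel E)"
  unfolding adj_rel_def sym_def by (auto simp: insert_commute)

lemma component_refl: "x \<in> component E x"
  unfolding component_def by simp

lemma component_closed: "y \<in> component E x \<Longrightarrow> {y, z} \<in> E \<Longrightarrow> z \<in> component E x"
  unfolding component_def adj_rel_def by (auto intro: rtrancl_into_rtrancl)

lemma component_sym: "y \<in> component E x \<Longrightarrow> x \<in> component E y"
  unfolding component_def using symD[OF sym_rtrancl[OF sym_adj_rel]] by auto

lemma component_eq: "y \<in> component E x \<Longrightarrow> component E y = component E x"
  using component_sym[of y E x] unfolding component_def by (auto intro: rtrancl_trans)

lemma rtrancl_crossing: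
  assumes "(x, y) \<in> R\<^sup>*" "x \<in> W" "y \<notin> W"
  obtains u v where "u \<in> W" "v \<notin> W" "(u, v) \<in> R" "(x, v) \<in> R\<^sup>*"
proof -
  have "y \<in> W \<or> (\<exists>u v. u \<in> W \<and> v \<notin> W \<and> (u, v) \<in> R \<and> (x, v) \<in> R\<^sup>*)"
    using assms(1)
  proof (induction rule: rtrancl_induct)
    case base
    then show ?case using assms by simp
  next
    case (step y z)
    then show ?case using rtrancl_into_rtrancl[of x y R z] by blast
  qed
  then show ?thesis using assms that by blast
qed

text \<open>The cut condition expresses connectedness. Growing a set from a single vertex along
  crossing edges adds at least one inner edge per new vertex, until \<open>C\<close> is
  exhausted.\<close>

lemma card_le_inner_edges:
  assumes C: "finite C" "C \<noteq> {}" and F: "finite F"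
    and cut: "\<And>W. W \<subset> C \<Longrightarrow> W \<noteq> {} \<Longrightarrow> \<exists>u\<in>W. \<exists>v\<in>C - W. {u, v} \<in> F"
  shows "card C \<le> card (inner_edges F C) + 1"
proof -
  have "\<exists>W\<subseteq>C. card W = Suc k \<and> k \<le> card (inner_edges F W)" if "k < card C" for k
    using that
  proof (induction k)
    case 0
    obtain x where "x \<in> C" using C by blast
    then show ?case by (intro exI[of _ "{x}"]) auto
  next
    case (Suc k)
    then obtain W where W: "W \<subseteq> C" "card W = Suc k" "k \<le> card (inner_edges F W)" by auto
    then have "W \<noteq> C" "W \<noteq> {}" using Suc.prems by auto
    with W cut obtain u v where uv: "u \<in> W" "v \<in> C - W" "{u, v} \<in> F" by blast
    have fin: "finite W" "finite (inner_edges F W)" "finite (inner_edges F (insert v W))"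
      using W(1) C(1) F finite_subset unfolding inner_edges_def by auto
    have "{u, v} \<notin> inner_edges F W" using uv unfolding inner_edges_def by auto
    then have "Suc (card (inner_edges F W)) = card (insert {u, v} (inner_edges F W))" using fin by simp
    also have "\<dots> \<le> card (inner_edges F (insert v W))"
      using uv fin unfolding inner_edges_def by (intro card_mono) auto
    finally show ?case using W uv fin by (intro exI[of _ "insert v W"]) auto
  qed
  from this[of "card C - 1"] obtain W where W: "W \<subseteq> C" "card W = card C" "card C - 1 \<le> card (inner_edges F W)"
    using C by (metis Suc_diff_1 card_gt_0_iff diff_less zero_less_one)
  then have "W = C" using C by (simp add: card_subset_eq)
  then show ?thesis using W by simp
qed

context finite_simple_graph
begin

lemma component_subset: assumes "x \<in> V" shows "component E x \<subseteq> V"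
proof
  fix y assume "y \<in> component E x"
  then have "(x, y) \<in> (adj_rel E)\<^sup>*" by (simp add: component_def)
  then show "y \<in> V" using assms
    by (induction rule: rtrancl_induct) (use edge_V in \<open>auto simp: adj_rel_def\<close>)
qed

lemma finite_component: "x \<in> V \<Longrightarrow> finite (component E x)"
  using component_subset finite_V finite_subset by blast

lemma cut_edge:
  assumes W: "W \<subset> component E x" "W \<noteq> {}"
  shows "\<exists>u\<in>W. \<exists>v\<in>component E x - W. {u, v} \<in> E"
proof -
  obtain w z where w: "w \<in> W" "z \<in> component E x" "z \<notin> W" using W by blast
  then have "z \<in> component E w" using component_eq[of w E x] W by auto
  then have "(w, z) \<in> (adj_rel E)\<^sup>*" unfolding component_def by simp
  then obtain u v where uv: "u \<in> W" "v \<notin> W" "(u, v) \<in> adj_rel E"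
    by (rule rtrancl_crossing[OF _ w(1,3)])
  then have "{u, v} \<in> E" "v \<in> component E x" using component_closed[of u E x v] W by (auto simp: adj_rel_def)
  with uv show ?thesis by blast
qed

text \<open>Consequently a component with fewer edges than vertices has exactly one edge less, i.e.
  is a tree; this inequality is how trees are expressed from here on.\<close>

lemma card_component_le:
  assumes "x \<in> V"
  shows "card (component E x) \<le> card (inner_edges E (component E x)) + 1"
  using card_le_inner_edges[OF finite_component[OF assms] _ finite_E] cut_edge component_refl by (metis empty_iff)

text \<open>If \<open>u\<close> and \<open>v\<close> stayed connected without \<open>{u, v}\<close>,
  so would the whole component. Connectedness without this edge already needs
  \<open>card - 1\<close> edges, so with it there would be at least as many edges as
  vertices.\<close>

lemma tree_bridge:
  assumes x: "x \<in> V" and tree: "card (inner_edges E (component E x)) < card (component E x)"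
    and uv: "{u, v} \<in> E" "u \<in> component E x"
  shows "(u, v) \<notin> (adj_rel (E - {{u, v}}))\<^sup>*"
proof
  let ?C = "component E x" and ?F = "E - {{u, v}}"
  assume path: "(u, v) \<in> (adj_rel ?F)\<^sup>*"
  have v: "v \<in> ?C" using component_closed uv by metis
  have sub: "(adj_rel ?F)\<^sup>* \<subseteq> (adj_rel E)\<^sup>*" by (rule rtrancl_mono) (auto simp: adj_rel_def)
  have cr: "\<exists>w\<in>W. \<exists>z\<in>?C - W. {w, z} \<in> ?F"
    if rs: "(r, s) \<in> (adj_rel ?F)\<^sup>*" "r \<in> W" "s \<notin> W" "r \<in> ?C" for r s W
  proof -
    obtain w z where "w \<in> W" "z \<notin> W" "(w, z) \<in> adj_rel ?F" "(r, z) \<in> (adj_rel ?F)\<^sup>*"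
      by (rule rtrancl_crossing[OF rs(1-3)])
    moreover from this have "z \<in> component E r" using sub unfolding component_def by auto
    ultimately show ?thesis using component_eq[OF rs(4)] unfolding adj_rel_def by blast
  qed
  have "(v, u) \<in> (adj_rel ?F)\<^sup>*" using symD[OF sym_rtrancl[OF sym_adj_rel] path] .
  have "card ?C \<le> card (inner_edges ?F ?C) + 1"
  proof (rule card_le_inner_edges)
    show "finite ?C" using finite_component x .
    show "?C \<noteq> {}" using uv by blast
    show "finite ?F" using finite_E by simp
    show "\<exists>w\<in>W. \<exists>z\<in>?C - W. {w, z} \<in> ?F" if W: "W \<subset> ?C" "W \<noteq> {}" for W
    \<comment> \<open>If \<open>W\<close> does not separate \<open>u\<close> from \<open>v\<close>,
      a cut edge of the original graph differs from \<open>{u, v}\<close>; otherwise the assumed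
      detour crosses the cut.\<close>
    proof (cases "u \<in> W \<longleftrightarrow> v \<in> W")
      case True
      obtain w z where wz: "w \<in> W" "z \<in> ?C - W" "{w, z} \<in> E" using cut_edge[OF W] by blast
      then have "{w, z} \<noteq> {u, v}" using True by (auto simp: doubleton_eq_iff)
      then show ?thesis using wz by blast
    next
      case False
      then show ?thesis using cr[OF path] cr[OF \<open>(v, u) \<in> _\<close>] uv(2) v by blast
    qed
  qed
  moreover have "inner_edges ?F ?C = inner_edges E ?C - {{u, v}}" "{u, v} \<in> inner_edges E ?C"
    using uv v unfolding inner_edges_def by auto
  then have "Suc (card (inner_edges ?F ?C)) = card (inner_edges E ?C)"
    using finite_E unfolding inner_edges_def by (metis (no_types, lifting) card_Suc_Diff1 finite_Collect_conjI finite_subset mem_Collect_eq subsetI)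
  ultimately show False using tree by simp
qed

lemma tree_no_triangle:
  assumes "x \<in> V" "card (inner_edges E (component E x)) < card (component E x)"
    and "u \<in> component E x" "{u, v} \<in> E" "{u, w} \<in> E" "{v, w} \<in> E"
  shows False
proof -
  have "u \<noteq> v" "u \<noteq> w" "v \<noteq> w" using assms(4-6) edge_V by blast+
  then have "(u, w) \<in> adj_rel (E - {{u, v}})" "(w, v) \<in> adj_rel (E - {{u, v}})"
    using assms(4-6) by (auto simp: adj_rel_def doubleton_eq_iff insert_commute)
  then have "(u, v) \<in> (adj_rel (E - {{u, v}}))\<^sup>*" by (meson rtrancl.rtrancl_into_rtrancl r_into_rtrancl)
  then show False using tree_bridge[OF assms(1,2,4,3)] by simp
qed

lemma sum_over_components:
  "card V = (\<Sum>C\<in>component E ` V. card C)"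
  "(\<Sum>C\<in>component E ` V. card (inner_edges E C)) \<le> card E"
proof -
  have disj: "C \<inter> D = {}" if "C \<in> component E ` V" "D \<in> component E ` V" "C \<noteq> D" for C D
  proof (rule ccontr)
    assume "C \<inter> D \<noteq> {}"
    then obtain z where "z \<in> C" "z \<in> D" by blast
    then show False using that component_eq[of z E] by auto
  qed
  have "V = \<Union>(component E ` V)" using component_subset component_refl by fastforce
  then have "card V = card (\<Union>(component E ` V))" by simp
  also have "\<dots> = (\<Sum>C\<in>component E ` V. card C)"
    by (rule card_Union_disjoint) (use disj finite_component in \<open>auto simp: pairwise_def disjnt_def\<close>)
  finally show "card V = (\<Sum>C\<in>component E ` V. card C)" .
  have "e \<noteq> {}" if "e \<in> E" for e using that by (rule edgeE) simp
  then have "inner_edges E C \<inter> inner_edges E D = {}" if "C \<in> component E ` V" "D \<in> component E ` V" "C \<noteq> D" for C D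
    using disj[OF that] unfolding inner_edges_def by blast
  moreover have "finite (inner_edges E C)" for C using finite_E unfolding inner_edges_def by simp
  ultimately have "(\<Sum>C\<in>component E ` V. card (inner_edges E C)) = card (\<Union>C\<in>component E ` V. inner_edges E C)"
    using finite_V by (intro card_UN_disjoint[symmetric]) auto
  also have "\<dots> \<le> card E" using finite_E by (intro card_mono) (auto simp: inner_edges_def)
  finally show "(\<Sum>C\<in>component E ` V. card (inner_edges E C)) \<le> card E" .
qed

text \<open>A tree on at least ten vertices has at least nine tenths as many edges as vertices, and
  a component that is no tree has at least as many. Without a small tree, summation gives
  \<open>9 * card V \<le> 10 * card E\<close>.\<close>

lemma small_tree_component:
  assumes "card E < card V - card V div 10"
  obtains x where "x \<in> V" "card (inner_edges E (component E x)) < card (component E x)" "card (component E x) \<le> 9"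
proof (rule ccontr)
  assume *: "\<not> thesis"
  note found = that
  have "9 * card C \<le> 10 * card (inner_edges E C)" if "C \<in> component E ` V" for C
  proof -
    from that obtain x where x: "x \<in> V" "C = component E x" by auto
    then show ?thesis using found[of x] * card_component_le[OF x(1)] by fastforce
  qed
  then have "(\<Sum>C\<in>component E ` V. 9 * card C) \<le> (\<Sum>C\<in>component E ` V. 10 * card (inner_edges E C))"
    by (rule sum_mono)
  then have "9 * card V \<le> 10 * card E"
    using sum_over_components by (simp flip: sum_distrib_left)
  then show False using assms by linarith
qed

text \<open>If no component other than \<open>T\<close> were a tree, the sum over components would
  give \<open>card V \<le> card E + 1\<close>.\<close>

lemma second_tree_component:
  assumes "card E + 1 < card V" "T \<in> component E ` V"
  obtains x where "x \<in> V" "card (inner_edges E (component E x)) < card (component E x)" "component E x \<noteq> T"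
proof (rule ccontr)
  assume *: "\<not> thesis"
  note found = that
  have "card C \<le> card (inner_edges E C) + (if C = T then 1 else 0)" if "C \<in> component E ` V" for C
  proof -
    from that obtain x where x: "x \<in> V" "C = component E x" by auto
    then show ?thesis using found[of x] * card_component_le[OF x(1)] by fastforce
  qed
  then have "(\<Sum>C\<in>component E ` V. card C) \<le> (\<Sum>C\<in>component E ` V. card (inner_edges E C) + (if C = T then 1 else 0))"
    by (rule sum_mono)
  also have "\<dots> = (\<Sum>C\<in>component E ` V. card (inner_edges E C)) + 1"
    using assms(2) finite_V by (simp add: sum.distrib)
  finally show False using assms(1) sum_over_components by simp
qed

section \<open>Degrees in components\<close>

lemma finite_nbrs: "finite {y. {x, y} \<in> E}"
  by (rule finite_subset[OF _ finite_V]) (use edge_V in auto)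

text \<open>Double counting of incidences; the first part matches the neighbours of \<open>y\<close>
  with the edges at \<open>y\<close>, all of which stay in the component.\<close>

lemma handshake:
  assumes "x \<in> V"
  shows "(\<Sum>y\<in>component E x. degree E y) = 2 * card (inner_edges E (component E x))"
proof -
  let ?C = "component E x"
  have deg: "degree E y = card {e \<in> inner_edges E ?C. y \<in> e}" if "y \<in> ?C" for y
  proof -
    have "inj_on (\<lambda>z. {y, z}) {z. {y, z} \<in> E}" by (auto simp: inj_on_def doubleton_eq_iff)
    then have "degree E y = card ((\<lambda>z. {y, z}) ` {z. {y, z} \<in> E})" unfolding degree_def by (simp add: card_image)
    also have "(\<lambda>z. {y, z}) ` {z. {y, z} \<in> E} = {e \<in> inner_edges E ?C. y \<in> e}"
    proof
      show "(\<lambda>z. {y, z}) ` {z. {y, z} \<in> E} \<subseteq> {e \<in> inner_edges E ?C. y \<in> e}"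
        using that component_closed[OF that] unfolding inner_edges_def by auto
      show "{e \<in> inner_edges E ?C. y \<in> e} \<subseteq> (\<lambda>z. {y, z}) ` {z. {y, z} \<in> E}"
      proof
        fix e assume "e \<in> {e \<in> inner_edges E ?C. y \<in> e}"
        then have e: "e \<in> E" "y \<in> e" unfolding inner_edges_def by auto
        then obtain z where "e = {y, z}" by (elim edgeE) auto
        then show "e \<in> (\<lambda>z. {y, z}) ` {z. {y, z} \<in> E}" using e by auto
      qed
    qed
    finally show ?thesis .
  qed
  have fin: "finite ?C" "finite (inner_edges E ?C)"
    using finite_component[OF assms] finite_E unfolding inner_edges_def by auto
  have "{y \<in> ?C. y \<in> e} = e \<and> card e = 2" if "e \<in> inner_edges E ?C" for e
    using that E_V unfolding inner_edges_def nsets_def by auto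
  then have "(\<Sum>y\<in>?C. card {e \<in> inner_edges E ?C. y \<in> e}) = 2 * card (inner_edges E ?C)"
    using fin by (intro sum_multicount) auto
  then show ?thesis using deg by simp
qed

lemma tree_has_leaf:
  assumes "x \<in> V" "card (inner_edges E (component E x)) < card (component E x)"
  obtains l where "l \<in> component E x" "degree E l \<le> 1"
proof (rule ccontr)
  assume *: "\<not> thesis"
  note found = that
  have "2 \<le> degree E y" if "y \<in> component E x" for y using that found[of y] * by fastforce
  then have "(\<Sum>y\<in>component E x. 2) \<le> (\<Sum>y\<in>component E x. degree E y)" by (intro sum_mono) auto
  then show False using handshake[OF assms(1)] assms(2) by simp
qed

lemma degree_0_iff: "degree E x = 0 \<longleftrightarrow> (\<forall>y. {x, y} \<notin> E)"
  unfolding degree_def using finite_nbrs by auto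

lemma degree_1E: assumes "degree E x = 1" obtains u where "\<And>w. {x, w} \<in> E \<longleftrightarrow> w = u"
  using assms unfolding degree_def by (auto simp: card_1_singleton_iff)

lemma degree_2E: assumes "degree E x = 2" obtains u v where "u \<noteq> v" "\<And>w. {x, w} \<in> E \<longleftrightarrow> w = u \<or> w = v"
proof -
  obtain u v where "{y. {x, y} \<in> E} = {u, v}" "u \<noteq> v" using assms unfolding degree_def by (auto simp: card_2_iff)
  then show ?thesis using that[of u v] by blast
qed

lemma degree_ge_2: assumes "{x, u} \<in> E" "{x, v} \<in> E" "u \<noteq> v" shows "2 \<le> degree E x"
proof -
  have "card {u, v} \<le> degree E x" unfolding degree_def
    by (rule card_mono[OF finite_nbrs]) (use assms in auto)
  then show ?thesis using assms by simp
qed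

end

section \<open>Small tree components\<close>

context finite_simple_graph
begin

lemma path6_component:
  assumes "path6 E p1 p2 p3 p4 p5 p6" "{p1, p2, p3, p4, p5, p6} \<inter> component E x \<noteq> {}"
  shows "{p1, p2, p3, p4, p5, p6} \<subseteq> component E x"
proof -
  have e: "{p1, p2} \<in> E" "{p2, p3} \<in> E" "{p3, p4} \<in> E" "{p4, p5} \<in> E" "{p5, p6} \<in> E"
    "{p2, p1} \<in> E" "{p3, p2} \<in> E" "{p4, p3} \<in> E" "{p5, p4} \<in> E" "{p6, p5} \<in> E"
    using assms(1) unfolding path6_def by (simp_all add: insert_commute)
  have "p1 \<in> component E x \<longleftrightarrow> p2 \<in> component E x" "p2 \<in> component E x \<longleftrightarrow> p3 \<in> component E x"
    "p3 \<in> component E x \<longleftrightarrow> p4 \<in> component E x" "p4 \<in> component E x \<longleftrightarrow> p5 \<in> component E x"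
    "p5 \<in> component E x \<longleftrightarrow> p6 \<in> component E x"
    using e component_closed by metis+
  then show ?thesis using assms(2) by auto
qed

lemma path6_degrees:
  assumes "path6 E p1 p2 p3 p4 p5 p6" "s \<in> {p2, p3, p4, p5}"
  shows "2 \<le> degree E s"
proof -
  have e: "distinct [p1, p2, p3, p4, p5, p6]" "{p1, p2} \<in> E" "{p2, p3} \<in> E" "{p3, p4} \<in> E" "{p4, p5} \<in> E" "{p5, p6} \<in> E"
    "{p2, p1} \<in> E" "{p3, p2} \<in> E" "{p4, p3} \<in> E" "{p5, p4} \<in> E" "{p6, p5} \<in> E"
    using assms(1) unfolding path6_def by (simp_all add: insert_commute)
  then show ?thesis
    using degree_ge_2[of p2 p1 p3] degree_ge_2[of p3 p2 p4] degree_ge_2[of p4 p3 p5] degree_ge_2[of p5 p4 p6] assms(2)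
    by auto
qed

text \<open>For a tree on \<open>c\<close> vertices, \<open>i\<close> of them of degree at least
  three, the degree sum gives \<open>c + 2 * i \<le> 2 * (c - 1)\<close>, so
  \<open>2 * i \<le> 7\<close>.\<close>

lemma small_tree_branching:
  assumes x: "x \<in> V" and tree: "card (inner_edges E (component E x)) < card (component E x)"
    and small: "card (component E x) \<le> 9"
    and deg: "\<And>y. y \<in> component E x \<Longrightarrow> degree E y = 1 \<or> 3 \<le> degree E y"
  shows "card {y \<in> component E x. 3 \<le> degree E y} \<le> 3"
proof -
  let ?C = "component E x"
  let ?I = "{y \<in> ?C. 3 \<le> degree E y}"
  have fin: "finite ?C" using finite_component x .
  have "(\<Sum>y\<in>?C. 1 + (if y \<in> ?I then 2 else 0)) \<le> (\<Sum>y\<in>?C. degree E y)"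
    by (rule sum_mono) (use deg in fastforce)
  moreover have "(\<Sum>y\<in>?C. 1 + (if y \<in> ?I then 2 else 0)) = card ?C + 2 * card ?I"
  proof -
    have "(\<Sum>y\<in>?C. if y \<in> ?I then 2 else 0) = (\<Sum>y\<in>?I. 2::nat)"
      by (rule sum.mono_neutral_cong_right) (use fin in auto)
    then show ?thesis by (simp only: sum.distrib) simp
  qed
  ultimately show ?thesis using handshake[OF x] tree small by linarith
qed

text \<open>Supplies the vertex \<open>a\<close> for \<open>no_distant_support\<close>: the second
  and third vertex of a path on four vertices from \<open>a\<close> would be adjacent branching
  vertices other than \<open>a\<close>. Among three branching vertices two are non-adjacent, since a
  tree has no triangle, and \<open>a\<close> is the third. As \<open>a\<close> has at least three
  neighbours and there are at most two other branching vertices, some neighbour \<open>b\<close> is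
  a leaf. Without branching vertices, any leaf and its neighbour serve.\<close>

lemma small_tree_centre:
  assumes x: "x \<in> V" and tree: "card (inner_edges E (component E x)) < card (component E x)"
    and small: "card (component E x) \<le> 9"
    and deg: "\<And>y. y \<in> component E x \<Longrightarrow> degree E y = 1 \<or> 3 \<le> degree E y"
  shows "\<exists>a\<in>component E x. \<exists>b. (\<forall>w. {b, w} \<in> E \<longleftrightarrow> w = a) \<and>
    ({y \<in> component E x. 3 \<le> degree E y} = {} \<or> 3 \<le> degree E a) \<and>
    (\<forall>u\<in>component E x - {a}. \<forall>v\<in>component E x - {a}. 3 \<le> degree E u \<longrightarrow> 3 \<le> degree E v \<longrightarrow> {u, v} \<notin> E)"
proof -
  let ?C = "component E x"
  let ?I = "{y \<in> ?C. 3 \<le> degree E y}"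
  have fin: "finite ?I" using finite_component x by simp
  have I3: "card ?I \<le> 3" by (rule small_tree_branching[OF assms])
  show ?thesis
  proof (cases "?I = {}")
    case True
    obtain b where b: "b \<in> ?C" "degree E b \<le> 1" using tree_has_leaf[OF x tree] .
    then have "degree E b = 1" using deg by force
    then obtain a where a: "\<And>w. {b, w} \<in> E \<longleftrightarrow> w = a" by (rule degree_1E) (rule that)
    have "a \<in> ?C" using component_closed[OF b(1)] a by simp
    then show ?thesis using a True by (intro bexI[of _ a] exI[of _ b]) auto
  next
    case False
    have "\<exists>a\<in>?I. \<forall>u\<in>?I - {a}. \<forall>v\<in>?I - {a}. {u, v} \<notin> E"
    proof (cases "card ?I = 3")
      case True
      then obtain a b c where abc: "?I = {a, b, c}" by (auto simp: card_3_iff)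
      then have "a \<in> ?C" by blast
      have "{a, b} \<notin> E \<or> {a, c} \<notin> E \<or> {b, c} \<notin> E"
        using tree_no_triangle[OF x tree \<open>a \<in> ?C\<close>, of b c] by blast
      then show ?thesis unfolding abc by (auto simp: insert_commute)
    next
      case c: False
      obtain a where a: "a \<in> ?I" using False by blast
      have "card (?I - {a}) \<le> 1" using a c I3 fin by simp
      then have eq: "u = v" if "u \<in> ?I - {a}" "v \<in> ?I - {a}" for u v
        using that fin card_le_Suc0_iff_eq[of "?I - {a}"] by auto
      have "\<forall>u\<in>?I - {a}. \<forall>v\<in>?I - {a}. {u, v} \<notin> E"
      proof (intro ballI)
        fix u v assume "u \<in> ?I - {a}" "v \<in> ?I - {a}"
        from eq[OF this] show "{u, v} \<notin> E" by simp
      qed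
      then show ?thesis using a by blast
    qed
    then obtain a where a: "a \<in> ?I" and na: "\<forall>u\<in>?I - {a}. \<forall>v\<in>?I - {a}. {u, v} \<notin> E" by blast
    have "\<not> {y. {a, y} \<in> E} \<subseteq> ?I - {a}"
    proof
      assume "{y. {a, y} \<in> E} \<subseteq> ?I - {a}"
      then have "card {y. {a, y} \<in> E} \<le> card (?I - {a})" using fin by (intro card_mono) auto
      then have "degree E a \<le> card (?I - {a})" by (simp add: degree_def[of E a])
      moreover have "card (?I - {a}) = card ?I - 1" using a by (simp only: card_Diff_singleton)
      moreover have "3 \<le> degree E a" using a by simp
      ultimately show False using I3 by linarith
    qed
    then obtain b where b: "{a, b} \<in> E" "b \<notin> ?I - {a}" by blast
    then have "b \<in> ?C" "b \<noteq> a" using component_closed[of a E x b] a edge_V[of a b] by auto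
    then have "degree E b = 1" using deg[of b] b(2) by auto
    then obtain a' where a': "\<And>w. {b, w} \<in> E \<longleftrightarrow> w = a'" by (rule degree_1E) (rule that)
    then have "a' = a" using b(1) by (metis insert_commute)
    then have leaf: "\<And>w. {b, w} \<in> E \<longleftrightarrow> w = a" using a' by simp
    then show ?thesis using a na by (intro bexI[of _ a] exI[of _ b]) auto
  qed
qed

end

text \<open>Alternate edges of the path add three to the matching.\<close>

lemma linear_forest_matching:
  assumes "path6 F a b c d e f" "matching F M" "finite M" "card M = t" "{a, b, c, d, e, f} \<inter> \<Union>M = {}"
  obtains N where "matching F N" "finite N" "card N = t + 3"
proof -
  have e: "distinct [a, b, c, d, e, f]" "{a, b} \<in> F" "{c, d} \<in> F" "{e, f} \<in> F"
    using assms(1) unfolding path6_def by simp_all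
  have n: "a \<notin> \<Union>M" "b \<notin> \<Union>M" "c \<notin> \<Union>M" "d \<notin> \<Union>M" "e \<notin> \<Union>M" "f \<notin> \<Union>M"
    using assms(5) by blast+
  let ?A = "insert {a, b} M" let ?B = "insert {c, d} ?A" let ?C = "insert {e, f} ?B"
  have A: "matching F ?A" "{a, b} \<notin> M" using e n by (auto intro!: matching_insert assms)
  have B: "matching F ?B" "{c, d} \<notin> ?A" using e n by (auto intro!: matching_insert A(1) simp: doubleton_eq_iff)
  have C: "matching F ?C" "{e, f} \<notin> ?B" using e n by (auto intro!: matching_insert B(1) simp: doubleton_eq_iff)
  show ?thesis by (rule that[of ?C]) (use A B C assms in auto)
qed

context linear_forest_saturated
begin

text \<open>The neighbour \<open>u\<close> of the leaf cannot be adjacent to all other vertices, as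
  this needs \<open>card V - 1\<close> edges. Adding a missing edge at \<open>u\<close> yields a
  matching with \<open>t + 3\<close> edges; if it uses the added edge, \<open>{u, l}\<close> can
  replace it.\<close>

lemma leaf_imp_large_matching:
  assumes leaf: "\<And>w. {l, w} \<in> E \<longleftrightarrow> w = u" and few: "card E + 1 < card V"
  obtains N where "matching E N" "t + 3 \<le> card N"
proof -
  have u: "u \<in> V" "l \<in> V" "{u, l} \<in> E" using leaf[of u] edge_V[of l u] by (auto simp: insert_commute)
  have "\<exists>v\<in>V. v \<noteq> u \<and> {u, v} \<notin> E"
  proof (rule ccontr)
    assume "\<not> ?thesis"
    then have "(\<lambda>v. {u, v}) ` (V - {u}) \<subseteq> E" by blast
    then have "card ((\<lambda>v. {u, v}) ` (V - {u})) \<le> card E" by (rule card_mono[OF finite_E])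
    moreover have "inj_on (\<lambda>v. {u, v}) (V - {u})" by (auto simp: inj_on_def doubleton_eq_iff)
    ultimately have "card (V - {u}) \<le> card E" by (simp add: card_image)
    then show False using few u by simp
  qed
  then obtain v where v: "v \<in> V" "v \<noteq> u" "{u, v} \<notin> E" by blast
  let ?F = "insert {u, v} E"
  obtain a b c d e f M where F: "path6 ?F a b c d e f" "matching ?F M" "card M = t" "{a, b, c, d, e, f} \<inter> \<Union>M = {}"
    by (rule has_linear_forestE[OF saturated[OF u(1) v(1) _ v(3)]]) (use v in auto)
  have "finite M" using matching_subset[OF F(2)] finite_E finite_subset by blast
  then obtain N where N: "matching ?F N" "finite N" "card N = t + 3" using linear_forest_matching[OF F(1,2) _ F(3,4)] by blast
  let ?N = "N - {{u, v}}"
  have m: "matching E ?N" by (rule matching_delete_edge[OF N(1)])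
  show ?thesis
  proof (cases "{u, v} \<in> N")
    case True
    have uN: "u \<notin> \<Union>?N" using matching_disjoint[OF N(1) True, of _ u] by blast
    then have "l \<notin> \<Union>?N" by (rule leaf_uncovered[OF m leaf])
    with uN matching_insert_edge[OF m u(3)] have "matching E (insert {u, l} ?N)" "card (insert {u, l} ?N) = Suc (card ?N)" by auto
    then show ?thesis using that[of "insert {u, l} ?N"] True N(2,3) by simp
  next
    case False
    then show ?thesis using that[of N] m N(3) by simp
  qed
qed

text \<open>A path using the added edge would stay in the component, with each of its four inner
  vertices branching or an end of the added edge. At most three vertices qualify, so the path
  created by saturation lies in \<open>E\<close>.\<close>

lemma few_branching_imp_path6:
  assumes x: "x \<in> V" and uv: "u \<in> component E x" "v \<in> component E x" "u \<noteq> v" "{u, v} \<notin> E"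
    and deg: "\<And>y. y \<in> component E x \<Longrightarrow> degree E y = 1 \<or> 3 \<le> degree E y"
    and I: "card ({y \<in> component E x. 3 \<le> degree E y} \<union> {u, v}) \<le> 3"
  shows "\<exists>a b c d e f. path6 E a b c d e f"
proof -
  let ?C = "component E x" and ?F = "insert {u, v} E"
  have uV: "u \<in> V" "v \<in> V" using uv component_subset[OF x] by auto
  obtain a b c d e f where p: "path6 ?F a b c d e f"
    by (rule has_linear_forestE[OF saturated[OF uV uv(3,4)]])
  show ?thesis
  proof (cases "path6 E a b c d e f")
    case False
    interpret F: finite_simple_graph V ?F
      by unfold_locales (use finite_V E_V uV uv(3) in auto)
    have cl: "z \<in> ?C" if "y \<in> ?C" "{y, z} \<in> ?F" for y z
      using that uv component_closed[of y E x z] by (auto simp: doubleton_eq_iff)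
    have "component ?F u \<subseteq> ?C"
    proof
      fix y assume "y \<in> component ?F u"
      then have "(u, y) \<in> (adj_rel ?F)\<^sup>*" by (simp add: component_def)
      then show "y \<in> ?C" by (induction rule: rtrancl_induct) (use uv cl in \<open>auto simp: adj_rel_def\<close>)
    qed
    moreover have "{u, v} \<in> {{a, b}, {b, c}, {c, d}, {d, e}, {e, f}}"
    proof (rule ccontr)
      assume "{u, v} \<notin> {{a, b}, {b, c}, {c, d}, {d, e}, {e, f}}"
      from path6_delete_edge[OF p this] show False using False by simp
    qed
    then have "u \<in> {a, b, c, d, e, f}" by (auto simp: doubleton_eq_iff)
    then have "{a, b, c, d, e, f} \<subseteq> component ?F u" using F.path6_component[OF p] component_refl[of u ?F] by blast
    ultimately have pC: "{b, c, d, e} \<subseteq> ?C" by blast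
    have "{b, c, d, e} \<subseteq> {y \<in> ?C. 3 \<le> degree E y} \<union> {u, v}"
    proof
      fix s assume s: "s \<in> {b, c, d, e}"
      show "s \<in> {y \<in> ?C. 3 \<le> degree E y} \<union> {u, v}"
      proof (cases "s \<in> {u, v}")
        case False
        then have "{y. {s, y} \<in> ?F} = {y. {s, y} \<in> E}" by (auto simp: doubleton_eq_iff)
        then have "2 \<le> degree E s" using F.path6_degrees[OF p s] unfolding degree_def by simp
        then show ?thesis using deg[of s] s pC by auto
      qed blast
    qed
    then have "card {b, c, d, e} \<le> card ({y \<in> ?C. 3 \<le> degree E y} \<union> {u, v})"
      using finite_component[OF x] by (intro card_mono) auto
    moreover have "card {b, c, d, e} = 4" using p unfolding path6_def by simp
    ultimately show ?thesis using I by simp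
  qed blast
qed

end

context finite_simple_graph
begin

text \<open>Send every vertex to the second vertex of a path starting there. A tree has fewer edges than
  vertices, so some edge is chosen from both of its ends, and the two paths combine.\<close>

lemma tree_path6:
  assumes x: "x \<in> V" and tree: "card (inner_edges E (component E x)) < card (component E x)"
    and start: "\<And>w. w \<in> component E x \<Longrightarrow>
      \<exists>u y z. {w, u} \<in> E \<and> {u, y} \<in> E \<and> {y, z} \<in> E \<and> distinct [w, u, y, z]"
  shows "\<exists>a b c d e f. path6 E a b c d e f"
proof -
  let ?C = "component E x"
  have "\<forall>w. \<exists>u y z. w \<in> ?C \<longrightarrow> {w, u} \<in> E \<and> {u, y} \<in> E \<and> {y, z} \<in> E \<and> distinct [w, u, y, z]"
    using start by blast
  then obtain g y z where g: "\<And>w. w \<in> ?C \<Longrightarrow>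
      {w, g w} \<in> E \<and> {g w, y w} \<in> E \<and> {y w, z w} \<in> E \<and> distinct [w, g w, y w, z w]"
    by metis
  have img: "(\<lambda>w. {w, g w}) ` ?C \<subseteq> inner_edges E ?C"
    unfolding inner_edges_def using g component_closed by fastforce
  have "finite (inner_edges E ?C)" using finite_E by (simp add: inner_edges_def)
  from le_less_trans[OF card_mono[OF this img] tree]
  have "\<not> inj_on (\<lambda>w. {w, g w}) ?C" by (rule pigeonhole)
  then obtain w w' where w: "w \<in> ?C" "w' \<in> ?C" "w \<noteq> w'" "{w, g w} = {w', g w'}" by (auto simp: inj_on_def)
  then have gw: "g w = w'" "g w' = w" by (auto simp: doubleton_eq_iff)
  have 1: "{w, w'} \<in> E" "{w', y w} \<in> E" "{y w, z w} \<in> E" "distinct [w, w', y w, z w]" using g[OF w(1)] gw by auto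
  have 2: "{w, y w'} \<in> E" "{y w', z w'} \<in> E" "distinct [w', w, y w', z w']" using g[OF w(2)] gw by auto
  let ?R = "(adj_rel (E - {{w, w'}}))\<^sup>*"
  have far: "(w, w') \<notin> ?R" by (rule tree_bridge[OF x tree 1(1) w(1)])
  have r1: "(w', y w) \<in> ?R" "(y w, z w) \<in> ?R"
    using 1 by (auto simp: adj_rel_def doubleton_eq_iff intro!: r_into_rtrancl)
  have r2: "(w, y w') \<in> ?R" "(y w', z w') \<in> ?R"
    using 2 by (auto simp: adj_rel_def doubleton_eq_iff intro!: r_into_rtrancl)
  have ne: "s \<noteq> s'" if "s \<in> {y w, z w}" "s' \<in> {y w', z w'}" for s s'
  proof
    assume "s = s'"
    have "(w', s) \<in> ?R" using r1 that(1) rtrancl_trans[of w' "y w" _ "z w"] by auto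
    then have "(s, w') \<in> ?R" by (rule symD[OF sym_rtrancl[OF sym_adj_rel]])
    moreover have "(w, s) \<in> ?R" using r2 that(2) rtrancl_trans[of w "y w'" _ "z w'"] \<open>s = s'\<close> by auto
    ultimately have "(w, w') \<in> ?R" by (rule rtrancl_trans[rotated])
    then show False using far by contradiction
  qed
  have "y w \<noteq> y w'" "y w \<noteq> z w'" "z w \<noteq> y w'" "z w \<noteq> z w'" by (rule ne; simp)+
  moreover have "{z w', y w'} \<in> E" "{y w', w} \<in> E" using 2 by (simp_all add: insert_commute)
  ultimately have "path6 E (z w') (y w') w w' (y w) (z w)"
    unfolding path6_def using 1 2(3) by auto
  then show ?thesis by blast
qed

end

context linear_forest_saturated
begin

text \<open>Adding \<open>{a, w}\<close> must create a path. Oriented from \<open>a\<close> to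
  \<open>w\<close>, at most the vertex \<open>b\<close> precedes \<open>a\<close> on it, so four
  consecutive vertices begin at \<open>w\<close>.\<close>

lemma isolated_edge_path_start:
  assumes ab: "\<And>s. {a, s} \<in> E \<longleftrightarrow> s = b" "\<And>s. {b, s} \<in> E \<longleftrightarrow> s = a"
    and w: "w \<in> V" "w \<noteq> a" "w \<noteq> b" and no_path: "\<And>a b c d e f. \<not> path6 E a b c d e f"
  shows "\<exists>u y z. {w, u} \<in> E \<and> {u, y} \<in> E \<and> {y, z} \<in> E \<and> distinct [w, u, y, z]"
proof -
  let ?F = "insert {a, w} E"
  have "a \<in> V" "{a, w} \<notin> E" using ab(1) w edge_V by auto
  then obtain v1 v2 v3 v4 v5 v6 where p: "path6 ?F v1 v2 v3 v4 v5 v6"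
    by (rule has_linear_forestE[OF saturated[OF _ w(1) w(2)[symmetric]]])
  have na: "s = b \<or> s = w" if "{a, s} \<in> ?F" for s using that ab(1) w by (auto simp: doubleton_eq_iff)
  have "a \<noteq> b" using ab(1)[of b] edge_V by auto
  then have nb: "s = a" if "{b, s} \<in> ?F" for s using that ab(2) w by (auto simp: doubleton_eq_iff)
  have core: "?thesis" if q: "path6 ?F u1 u2 u3 u4 u5 u6"
    "u1 = a \<and> u2 = w \<or> u2 = a \<and> u3 = w \<or> u3 = a \<and> u4 = w \<or> u4 = a \<and> u5 = w \<or> u5 = a \<and> u6 = w"
    for u1 u2 u3 u4 u5 u6
  proof -
    have d: "distinct [u1, u2, u3, u4, u5, u6]" and e: "{u2, u1} \<in> ?F" "{u3, u2} \<in> ?F" "{u4, u3} \<in> ?F" "{u5, u4} \<in> ?F"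
      "{u2, u3} \<in> ?F" "{u3, u4} \<in> ?F" "{u4, u5} \<in> ?F" "{u5, u6} \<in> ?F"
      using q(1) unfolding path6_def by (simp_all add: insert_commute)
    have behind: False if "u = a" "v = w" "{u, s} \<in> ?F" "s \<noteq> v" "{s, r} \<in> ?F" "r \<noteq> u" for u v s r
      using na[of s] nb[of r] that by auto
    from q(2) consider "u1 = a" "u2 = w" | "u2 = a" "u3 = w" | "u3 = a" "u4 = w" | "u4 = a" "u5 = w" | "u5 = a" "u6 = w"
      by blast
    then show ?thesis
    proof cases
      case 1
      then have "{u2, u3} \<in> E" "{u3, u4} \<in> E" "{u4, u5} \<in> E" using d e by (auto simp: doubleton_eq_iff)
      then show ?thesis using 1 d by (intro exI[of _ u3] exI[of _ u4] exI[of _ u5]) auto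
    next
      case 2
      then have "{u3, u4} \<in> E" "{u4, u5} \<in> E" "{u5, u6} \<in> E" using d e by (auto simp: doubleton_eq_iff)
      then show ?thesis using 2 d by (intro exI[of _ u4] exI[of _ u5] exI[of _ u6]) auto
    next
      case 3
      have False by (rule behind[OF 3 e(2) _ e(1)]) (use d in auto)
      then show ?thesis ..
    next
      case 4
      have False by (rule behind[OF 4 e(3) _ e(2)]) (use d in auto)
      then show ?thesis ..
    next
      case 5
      have False by (rule behind[OF 5 e(4) _ e(3)]) (use d in auto)
      then show ?thesis ..
    qed
  qed
  have "{a, w} \<in> {{v1, v2}, {v2, v3}, {v3, v4}, {v4, v5}, {v5, v6}}"
  proof (rule ccontr)
    assume "{a, w} \<notin> {{v1, v2}, {v2, v3}, {v3, v4}, {v4, v5}, {v5, v6}}"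
    from path6_delete_edge[OF p this] show False using no_path by blast
  qed
  then have "(v1 = a \<and> v2 = w \<or> v2 = a \<and> v3 = w \<or> v3 = a \<and> v4 = w \<or> v4 = a \<and> v5 = w \<or> v5 = a \<and> v6 = w) \<or>
    (v6 = a \<and> v5 = w \<or> v5 = a \<and> v4 = w \<or> v4 = a \<and> v3 = w \<or> v3 = a \<and> v2 = w \<or> v2 = a \<and> v1 = w)"
    by (auto simp: doubleton_eq_iff)
  then show ?thesis using core[OF p] core[OF path6_rev[OF p]] by blast
qed

lemma few_edges_imp_isolated:
  assumes few: "card E < card V - card V div 10" and n: "10 \<le> card V"
  shows "\<exists>v\<in>V. \<forall>w. {v, w} \<notin> E"
proof (rule ccontr)
  assume "\<not> ?thesis"
  then have pos: "degree E v \<noteq> 0" if "v \<in> V" for v using that degree_0_iff by auto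
  have few': "card E + 1 < card V" using few n by linarith
  obtain x where x: "x \<in> V" and tree: "card (inner_edges E (component E x)) < card (component E x)"
    and small: "card (component E x) \<le> 9" by (rule small_tree_component[OF few])
  let ?C = "component E x"
  let ?I = "{y \<in> ?C. 3 \<le> degree E y}"
  have CV: "?C \<subseteq> V" by (rule component_subset[OF x])
  have finI: "finite ?I" using finite_component[OF x] by simp
  have deg: "degree E y = 1 \<or> 3 \<le> degree E y" if y: "y \<in> ?C" for y
  proof -
    have "degree E y \<noteq> 2"
    proof
      assume "degree E y = 2"
      then obtain u v where uv: "u \<noteq> v" "\<And>w. {y, w} \<in> E \<longleftrightarrow> w = u \<or> w = v" by (rule degree_2E) (rule that)
      have "{u, v} \<in> E" by (rule degree_two_triangle[OF uv(2,1)])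
      then show False using tree_no_triangle[OF x tree y, of u v] uv by blast
    qed
    then show ?thesis using pos[of y] y CV by (auto simp: eval_nat_numeral not_less_eq_eq)
  qed
  obtain a b where a: "a \<in> ?C" and leaf_a: "\<forall>w. {b, w} \<in> E \<longleftrightarrow> w = a"
    and Ia: "?I = {} \<or> 3 \<le> degree E a"
    and na: "\<forall>u\<in>?C - {a}. \<forall>v\<in>?C - {a}. 3 \<le> degree E u \<longrightarrow> 3 \<le> degree E v \<longrightarrow> {u, v} \<notin> E"
    using small_tree_centre[OF x tree small deg] by blast
  have leaf: "\<And>w. {b, w} \<in> E \<longleftrightarrow> w = a" using leaf_a by simp
  have centre: "\<And>u v. u \<in> ?I - {a} \<Longrightarrow> v \<in> ?I - {a} \<Longrightarrow> {u, v} \<notin> E" using na by simp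
  have ab: "{a, b} \<in> E" "b \<in> ?C" using leaf[of a] component_closed[OF a, of b] by (simp_all add: insert_commute)
  obtain N where N: "matching E N" "t + 3 \<le> card N" by (rule leaf_imp_large_matching[OF leaf few'])
  have deg3: "3 \<le> degree E u" if "u \<in> ?C" "{u, v} \<in> E" "{u, w} \<in> E" "v \<noteq> w" for u v w
    using deg[OF that(1)] degree_ge_2[OF that(2-4)] by linarith
  have I3: "card ?I \<le> 3" by (rule small_tree_branching[OF x tree small deg])
  show False
  proof (cases "\<exists>a b c d e f. path6 E a b c d e f")
    case True
    then obtain p1 p2 p3 p4 p5 p6 where p: "path6 E p1 p2 p3 p4 p5 p6" by blast
    \<comment> \<open>Otherwise the inner vertices \<open>p2, ..., p5\<close> would be four
      branching vertices of the tree.\<close>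
    have "p3 \<notin> ?C"
    proof
      assume "p3 \<in> ?C"
      then have "{p2, p3, p4, p5} \<subseteq> ?C" using path6_component[OF p, of x] by blast
      then have "{p2, p3, p4, p5} \<subseteq> ?I" using path6_degrees[OF p] deg by fastforce
      then have "card {p2, p3, p4, p5} \<le> card ?I" by (rule card_mono[OF finI])
      moreover have "card {p2, p3, p4, p5} = 4" using p unfolding path6_def by simp
      ultimately show False using I3 by simp
    qed
    then have far: "a \<noteq> p3" "{p3, a} \<notin> E" using a component_closed[OF a, of p3] by (auto simp: insert_commute)
    show False
    proof (rule no_distant_support[OF p N leaf _ far])
      show False if "{a, u} \<in> E" "{u, v} \<in> E" "{v, w} \<in> E" "distinct [a, u, v, w]" for u v w
      proof -
        have C: "u \<in> ?C" "v \<in> ?C" using component_closed a that by metis+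
        have "3 \<le> degree E u" using deg3[OF C(1), of a v] that by (auto simp: insert_commute)
        moreover have "3 \<le> degree E v" using deg3[OF C(2), of u w] that by (auto simp: insert_commute)
        ultimately show False using centre[of u v] C that by auto
      qed
    qed
  next
    case no: False
    have I_subset: "?I = {} \<or> a \<in> ?I" using Ia a by blast
    \<comment> \<open>It suffices to find a non-adjacent pair in the tree that together with the
      branching vertices makes at most three vertices. Which pair works depends on the number of
      branching vertices.\<close>
    have pair: False if "u \<in> ?C" "v \<in> ?C" "u \<noteq> v" "{u, v} \<notin> E" "card (?I \<union> {u, v}) \<le> 3" for u v
      using few_branching_imp_path6[OF x that(1-4) deg that(5)] no by blast
    have leafC: "\<And>w. {l, w} \<in> E \<longleftrightarrow> w = a" if "{a, l} \<in> E" "l \<notin> ?I" for l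
    proof -
      have "l \<in> ?C" using component_closed[OF a that(1)] .
      then have "degree E l = 1" using that(2) deg by blast
      then obtain a' where a': "\<And>w. {l, w} \<in> E \<longleftrightarrow> w = a'" by (rule degree_1E) (rule that)
      then have "a' = a" using that(1) by (metis insert_commute)
      then show "{l, w} \<in> E \<longleftrightarrow> w = a" for w using a' by simp
    qed
    consider "?I = {}" | "?I = {a}" | "card ?I = 2" "a \<in> ?I" | "card ?I = 3" "a \<in> ?I"
    proof (cases "?I = {}")
      case False
      then have aI: "a \<in> ?I" using I_subset by blast
      then have "card ?I \<noteq> 0" using finI by auto
      then consider "card ?I = 1" | "card ?I = 2" | "card ?I = 3" using I3 by linarith
      then show ?thesis
      proof cases
        case 1
        then show ?thesis using aI that(2) by (metis card_1_singletonE singletonD)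
      qed (use that aI in auto)
    qed (use that in auto)
    then show False
    proof cases
      \<comment> \<open>Here the tree is the single edge \<open>{a, b}\<close>. Every vertex of a
        second tree component starts a path on four vertices, and \<open>tree_path6\<close> combines
        two of these.\<close>
      case 1
      then have leaf': "\<And>w. {a, w} \<in> E \<longleftrightarrow> w = b"
      proof -
        have "degree E a = 1" using 1 a deg by blast
        then obtain c where c: "\<And>w. {a, w} \<in> E \<longleftrightarrow> w = c" by (rule degree_1E) (rule that)
        then show "{a, w} \<in> E \<longleftrightarrow> w = b" for w using ab by simp
      qed
      obtain y where y: "y \<in> V" "card (inner_edges E (component E y)) < card (component E y)" "component E y \<noteq> ?C"
        using second_tree_component[OF few', of ?C] x by blast
      have "\<exists>u z z'. {w, u} \<in> E \<and> {u, z} \<in> E \<and> {z, z'} \<in> E \<and> distinct [w, u, z, z']" if w: "w \<in> component E y" for w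
      proof -
        have "component E w = component E y" by (rule component_eq[OF w])
        moreover have "component E a = ?C" "component E b = ?C" using component_eq a ab by metis+
        ultimately have "w \<noteq> a" "w \<noteq> b" using y(3) by metis+
        moreover have "w \<in> V" using component_subset[OF y(1)] w by blast
        ultimately show ?thesis using isolated_edge_path_start[OF leaf' leaf] no by blast
      qed
      then show False using tree_path6[OF y(1,2)] no by blast
    next
      \<comment> \<open>The tree is a star with centre \<open>a\<close>; two of its leaves are
        joined.\<close>
      case 2
      then have "3 \<le> card {y. {a, y} \<in> E}" by (auto simp: degree_def)
      then have "\<not> {y. {a, y} \<in> E} \<subseteq> {b}" using card_mono[of "{b}" "{y. {a, y} \<in> E}"] by auto
      then obtain l where l: "{a, l} \<in> E" "l \<noteq> b" by blast
      have "l \<noteq> a" "b \<noteq> a" using l ab edge_V by blast+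
      moreover have "{b, l} \<notin> E" using leaf[of l] l \<open>l \<noteq> a\<close> by simp
      moreover have "card (?I \<union> {b, l}) \<le> 3" unfolding 2 by (simp add: card_insert_if)
      ultimately show False using pair[of b l] ab(2) component_closed[OF a l(1)] l(2) by blast
    next
      \<comment> \<open>A leaf at \<open>a\<close> is joined to the other branching vertex.\<close>
      case 3
      then obtain a' where a': "a' \<in> ?I" "a' \<noteq> a"
        by (metis card_2_iff insertI1 insert_commute)
      have "\<not> {y. {a, y} \<in> E} \<subseteq> ?I"
      proof
        assume "{y. {a, y} \<in> E} \<subseteq> ?I"
        then have "card {y. {a, y} \<in> E} \<le> card ?I" by (rule card_mono[OF finI])
        moreover have "3 \<le> card {y. {a, y} \<in> E}" using 3(2) by (auto simp: degree_def)
        ultimately show False using 3(1) by simp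
      qed
      then obtain l where l: "{a, l} \<in> E" "l \<notin> ?I" by blast
      have "{l, a'} \<notin> E" using leafC[OF l] a' by simp
      moreover have "?I \<union> {l, a'} = insert l ?I" using a' by blast
      then have "card (?I \<union> {l, a'}) \<le> 3" using 3(1) l(2) finI by simp
      moreover have "l \<noteq> a'" using a' l by blast
      ultimately show False using pair[of l a'] component_closed[OF a l(1)] a' by blast
    next
      \<comment> \<open>The two branching vertices other than \<open>a\<close> are non-adjacent by
        the choice of \<open>a\<close>.\<close>
      case 4
      have "card (?I - {a}) = 2" using 4 by (simp only: card_Diff_singleton)
      then obtain u v where uv: "?I - {a} = {u, v}" "u \<noteq> v" by (auto simp: card_2_iff)
      then have uv': "u \<in> ?I" "v \<in> ?I" "u \<noteq> a" "v \<noteq> a" by blast+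
      then have "{u, v} \<notin> E" using centre[of u v] by blast
      moreover have "?I \<union> {u, v} = ?I" using uv' by blast
      then have "card (?I \<union> {u, v}) \<le> 3" using 4(1) by simp
      ultimately show False using pair[of u v] uv' uv(2) by blast
    qed
  qed
qed

end

section \<open>Saturated graphs with isolated vertices\<close>

text \<open>An intrinsic description of the extremal graph that avoids sum types; the vertices of
  \<open>V\<close> outside the clique and the triangles are isolated.
  \<open>isomorphic_sum_graph_iff\<close> relates it to the disjoint union.\<close>

definition seven_clique_and_triangles :: "'a set \<Rightarrow> 'a set set \<Rightarrow> nat \<Rightarrow> 'a set \<Rightarrow> 'a set set \<Rightarrow> bool" where
  "seven_clique_and_triangles V E t A Bs \<longleftrightarrow> A \<subseteq> V \<and> card A = 7 \<and> (\<forall>B\<in>Bs. B \<subseteq> V \<and> card B = 3 \<and> A \<inter> B = {}) \<and>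
     pairwise disjnt Bs \<and> finite Bs \<and> card Bs = t - 1 \<and> E = [A]\<^bsup>2\<^esup> \<union> (\<Union>B\<in>Bs. [B]\<^bsup>2\<^esup>)"

section \<open>Maximum matchings and Gallai's lemma\<close>

context finite_simple_graph
begin

lemma card_Union_matching:
  assumes "matching E M"
  shows "card (\<Union>M) = 2 * card M"
proof -
  have 2: "card e = 2" if "e \<in> M" for e using that matching_subset[OF assms] E_V by (auto simp: nsets_def)
  have "card (\<Union>M) = (\<Sum>e\<in>M. card e)"
    using assms 2 by (intro card_Union_disjoint) (auto simp: matching_def intro: card_ge_0_finite)
  also have "\<dots> = (\<Sum>e\<in>M. 2)" using 2 by (intro sum.cong) auto
  finally show ?thesis by simp
qed

lemma finite_Union_matching: "matching E M \<Longrightarrow> finite (\<Union>M)"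
  using matching_subset E_V finite_V by (metis (no_types, lifting) Sup_least finite_subset mem_Collect_eq nsets_def subsetD)

lemma card_matching_inside:
  assumes "matching E M" "finite C"
  shows "2 * card {e \<in> M. e \<subseteq> C} \<le> card C"
proof -
  have "matching E {e \<in> M. e \<subseteq> C}" using assms(1) by (rule matching_mono) auto
  from card_Union_matching[OF this] have "2 * card {e \<in> M. e \<subseteq> C} = card (\<Union>{e \<in> M. e \<subseteq> C})" by simp
  also have "\<dots> \<le> card C" using assms(2) by (intro card_mono) auto
  finally show ?thesis .
qed

text \<open>Gallai's lemma. Among the maximum matchings \<open>M\<close> missing \<open>x\<close>, \<open>z\<close> and \<open>N\<close> missing \<open>y\<close>, any pair
  can be replaced by one with a larger intersection.\<close>

lemma matching_intersection_step:
  assumes max: "\<And>M. matching E M \<Longrightarrow> card M \<le> k"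
    and edges: "{x, y} \<in> E" "{z, y} \<in> E" "x \<noteq> z"
    and M: "matching E M" "card M = k" "x \<notin> \<Union>M" "z \<notin> \<Union>M"
    and N: "matching E N" "card N = k" "y \<notin> \<Union>N"
  obtains N' where "matching E N'" "card N' = k" "y \<notin> \<Union>N'" "card (M \<inter> N) < card (M \<inter> N')"
proof -
  have fin: "finite M" "finite N" using M N finite_matching by auto
  have full: "s \<in> \<Union>N" if "{s, r} \<in> E" "r \<notin> \<Union>N" for s r
  proof (rule ccontr)
    assume "s \<notin> \<Union>N"
    then have "matching E (insert {s, r} N)" using that by (intro matching_insert N(1)) auto
    moreover have "{s, r} \<notin> N" using that by blast
    ultimately show False using max[of "insert {s, r} N"] N(2) fin by simp
  qed
  have xz: "{x, z} \<subseteq> \<Union>N - \<Union>M" using full[OF edges(1) N(3)] full[OF edges(2) N(3)] M by blast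
  have fU: "finite (\<Union>M)" "finite (\<Union>N)" using finite_Union_matching M N by auto
  have "card (\<Union>M) = card (\<Union>N)" using card_Union_matching M N by metis
  then have "card (\<Union>M - \<Union>N) = card (\<Union>N - \<Union>M)"
    using fU by (simp add: card_Diff_subset_Int Int_commute)
  moreover have "2 \<le> card (\<Union>N - \<Union>M)" using card_mono[OF _ xz] fU edges(3) by simp
  \<comment> \<open>\<open>M\<close> and \<open>N\<close> cover equally many vertices, so
    \<open>M\<close> covers at least two vertices that \<open>N\<close> misses, and one of them
    differs from \<open>y\<close>.\<close>
  ultimately have "\<not> \<Union>M - \<Union>N \<subseteq> {y}" using card_mono[of "{y}" "\<Union>M - \<Union>N"] by auto
  then obtain w where w: "w \<in> \<Union>M" "w \<notin> \<Union>N" "w \<noteq> y" by blast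
  let ?u = "mate M w"
  have wu: "{w, ?u} \<in> M" using mate_in[OF M(1)] covered_iff[OF M(1)] w(1) by blast
  then have wuE: "{w, ?u} \<in> E" "{?u, w} \<in> E" using matching_subset[OF M(1)] by (auto simp: insert_commute)
  have "?u \<in> \<Union>N" by (rule full[OF wuE(2) w(2)])
  then obtain g where g: "g \<in> N" "?u \<in> g" by blast
  have "?u \<noteq> y" using \<open>?u \<in> \<Union>N\<close> N(3) by metis
  have gM: "g \<notin> M" using matching_disjoint[OF M(1) _ wu g(2)] g(1) w(2) by blast
  \<comment> \<open>In \<open>N\<close>, the edge \<open>g\<close> at \<open>?u\<close> is exchanged
    for \<open>{w, ?u}\<close>. Since \<open>g\<close> is not in \<open>M\<close>, this gains a
    common edge, and \<open>y\<close> stays uncovered.\<close>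
  let ?N = "insert {w, ?u} (N - {g})"
  have u': "?u \<notin> \<Union>(N - {g})" using matching_disjoint[OF N(1) _ g(1) _ g(2)] by blast
  have wN: "{w, ?u} \<notin> N" using w(2) by blast
  have m: "matching E ?N"
    by (rule matching_insert[OF matching_mono[OF N(1)]]) (use wuE u' w(2) in auto)
  have c: "card ?N = k" using card_Suc_Diff1[OF fin(2) g(1)] wN fin N(2) by (subst card_insert_disjoint) (auto simp del: card_Diff_insert)
  have "M \<inter> ?N = insert {w, ?u} (M \<inter> N)" using wu gM by blast
  then have "card (M \<inter> N) < card (M \<inter> ?N)" using wN fin by simp
  moreover have "y \<notin> \<Union>?N" using w(3) \<open>?u \<noteq> y\<close> N(3) by blast
  ultimately show ?thesis using that[OF m c] by blast
qed

text \<open>Repeating the step for a fixed \<open>M\<close> would make the intersection larger than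
  \<open>M\<close> itself.\<close>

lemma missing_neighbours:
  assumes max: "\<And>M. matching E M \<Longrightarrow> card M \<le> k"
    and edges: "{x, y} \<in> E" "{z, y} \<in> E" "x \<noteq> z"
    and M: "matching E M" "card M = k" "x \<notin> \<Union>M" "z \<notin> \<Union>M"
    and N: "matching E N" "card N = k" "y \<notin> \<Union>N"
  shows False
proof -
  have "\<exists>N. matching E N \<and> card N = k \<and> y \<notin> \<Union>N \<and> j \<le> card (M \<inter> N)" for j
  proof (induction j)
    case 0
    then show ?case using N by blast
  next
    case (Suc j)
    then obtain N where N: "matching E N" "card N = k" "y \<notin> \<Union>N" "j \<le> card (M \<inter> N)" by blast
    obtain N' where "matching E N'" "card N' = k" "y \<notin> \<Union>N'" "card (M \<inter> N) < card (M \<inter> N')"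
      by (rule matching_intersection_step[OF max edges M N(1-3)])
    then show ?case using N(4) by (intro exI[of _ N']) auto
  qed
  then obtain N' where "Suc k \<le> card (M \<inter> N')" by blast
  moreover have "card (M \<inter> N') \<le> card M" using finite_matching[OF M(1)] by (intro card_mono) auto
  ultimately show False using M(2) by simp
qed

end

section \<open>Consequences of an isolated vertex\<close>

context linear_forest_saturated
begin

context
  fixes v
  assumes few: "card E + 1 < card V" and v: "v \<in> V" and isolated: "\<And>w. {v, w} \<notin> E"
begin

lemma isolated_no_degree_1: "degree E x \<noteq> 1"
proof
  assume "degree E x = 1"
  then obtain u where "\<And>w. {x, w} \<in> E \<longleftrightarrow> w = u" by (rule degree_1E) (rule that)
  then show False by (rule isolated_imp_no_leaf[OF v isolated])
qed

text \<open>Some tree component differs from that of \<open>v\<close>; it has a vertex of degree at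
  most one, and degree one is excluded.\<close>

lemma second_isolated: obtains l where "l \<in> V" "l \<noteq> v" "\<And>w. {l, w} \<notin> E"
proof -
  obtain x where x: "x \<in> V" "card (inner_edges E (component E x)) < card (component E x)" "component E x \<noteq> component E v"
    using second_tree_component[OF few, of "component E v"] v by blast
  obtain l where l: "l \<in> component E x" "degree E l \<le> 1" by (rule tree_has_leaf[OF x(1,2)])
  then have "degree E l = 0" using isolated_no_degree_1[of l] by linarith
  moreover have "l \<noteq> v" using component_eq[OF l(1)] x(3) by auto
  moreover have "l \<in> V" using l(1) component_subset[OF x(1)] by blast
  ultimately show ?thesis using that[of l] degree_0_iff by blast
qed

text \<open>An edge joining two isolated vertices forms a component of its own, so the path created
  by adding it does not use it.\<close>

lemma isolated_imp_path6: "\<exists>a b c d e f. path6 E a b c d e f"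
proof -
  obtain l where l: "l \<in> V" "l \<noteq> v" "\<And>w. {l, w} \<notin> E" by (rule second_isolated) (rule that)
  obtain a b c d e f where p: "path6 (insert {l, v} E) a b c d e f"
    by (rule has_linear_forestE[OF saturated[OF l(1) v l(2,3)]])
  have nl: "{l, w} \<in> insert {l, v} E \<longleftrightarrow> w = v" "{v, w} \<in> insert {l, v} E \<longleftrightarrow> w = l" for w
    using l isolated by (auto simp: doubleton_eq_iff)
  have pe: "distinct [a, b, c, d, e, f]" "{b, a} \<in> insert {l, v} E" "{b, c} \<in> insert {l, v} E"
    "{c, b} \<in> insert {l, v} E" "{c, d} \<in> insert {l, v} E" "{d, c} \<in> insert {l, v} E" "{d, e} \<in> insert {l, v} E"
    "{e, d} \<in> insert {l, v} E" "{e, f} \<in> insert {l, v} E"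
    using p unfolding path6_def by (simp_all add: insert_commute)
  have mid: "s \<noteq> l \<and> s \<noteq> v" if "{s, r} \<in> insert {l, v} E" "{s, r'} \<in> insert {l, v} E" "r \<noteq> r'" for s r r'
    using that nl by metis
  have "b \<noteq> l \<and> b \<noteq> v" "c \<noteq> l \<and> c \<noteq> v" "d \<noteq> l \<and> d \<noteq> v" "e \<noteq> l \<and> e \<noteq> v"
    using mid[of b a c] mid[of c b d] mid[of d c e] mid[of e d f] pe by auto
  then have "{l, v} \<notin> {{a, b}, {b, c}, {c, d}, {d, e}, {e, f}}" by (auto simp: doubleton_eq_iff)
  from path6_delete_edge[OF p this] show ?thesis by blast
qed

text \<open>A larger matching together with a path would give the leaf \<open>q3\<close> of the
  double broom, but an isolated vertex excludes leaves.\<close>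

lemma isolated_max_matching: assumes "matching E M" shows "card M \<le> t + 2"
proof (rule ccontr)
  assume "\<not> ?thesis"
  then have M: "t + 3 \<le> card M" by simp
  obtain a b c d e f where p: "path6 E a b c d e f" using isolated_imp_path6 by blast
  obtain q3 where "\<And>w. {q3, w} \<in> E \<longleftrightarrow> w = c" by (rule double_broom[OF p assms M]) (rule that)
  then show False by (rule isolated_imp_no_leaf[OF v isolated])
qed

text \<open>Adding \<open>{x, z}\<close> creates a matching with \<open>t + 3\<close> edges. It must
  contain the added edge, whose removal leaves a maximum matching missing both ends.\<close>

lemma matching_missing_pair:
  assumes "x \<in> V" "z \<in> V" "x \<noteq> z" "{x, z} \<notin> E"
  obtains N where "matching E N" "card N = t + 2" "x \<notin> \<Union>N" "z \<notin> \<Union>N"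
proof -
  let ?F = "insert {x, z} E"
  obtain a b c d e f M where F: "path6 ?F a b c d e f" "matching ?F M" "card M = t" "{a, b, c, d, e, f} \<inter> \<Union>M = {}"
    by (rule has_linear_forestE[OF saturated[OF assms]])
  have "finite M" using matching_subset[OF F(2)] finite_E finite_subset by blast
  then obtain N where N: "matching ?F N" "finite N" "card N = t + 3" using linear_forest_matching[OF F(1,2) _ F(3,4)] by blast
  have m: "matching E (N - {{x, z}})" by (rule matching_delete_edge[OF N(1)])
  have xz: "{x, z} \<in> N"
  proof (rule ccontr)
    assume "{x, z} \<notin> N"
    then show False using isolated_max_matching[OF m] N(3) by simp
  qed
  have "x \<notin> \<Union>(N - {{x, z}})" "z \<notin> \<Union>(N - {{x, z}})"
    using matching_disjoint[OF N(1) xz, of _ x] matching_disjoint[OF N(1) xz, of _ z] by blast+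
  then show ?thesis using that[OF m] xz N(2,3) by simp
qed

text \<open>The isolated vertex \<open>v\<close> is non-adjacent to every \<open>y\<close>, so the
  preceding lemma applies; for \<open>y = v\<close> the second isolated vertex takes over.\<close>

lemma matching_missing:
  assumes "y \<in> V"
  obtains N where "matching E N" "card N = t + 2" "y \<notin> \<Union>N"
proof (cases "y = v")
  case True
  obtain l where l: "l \<in> V" "l \<noteq> v" "\<And>w. {l, w} \<notin> E" by (rule second_isolated) (rule that)
  show ?thesis by (rule matching_missing_pair[OF v l(1) l(2)[symmetric] isolated]) (use that True in auto)
next
  case False
  show ?thesis by (rule matching_missing_pair[OF v assms(1) False[symmetric] isolated]) (rule that)
qed

text \<open>Otherwise some maximum matching misses \<open>x\<close> and \<open>z\<close>, and
  another misses their common neighbour \<open>y\<close>, against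
  \<open>missing_neighbours\<close>.\<close>

lemma adjacency_transitive:
  assumes "{x, y} \<in> E" "{y, z} \<in> E" "x \<noteq> z"
  shows "{x, z} \<in> E"
proof (rule ccontr)
  assume n: "{x, z} \<notin> E"
  have V: "x \<in> V" "y \<in> V" "z \<in> V" using assms edge_V by blast+
  obtain M where M: "matching E M" "card M = t + 2" "x \<notin> \<Union>M" "z \<notin> \<Union>M"
    by (rule matching_missing_pair[OF V(1,3) assms(3) n])
  obtain N where N: "matching E N" "card N = t + 2" "y \<notin> \<Union>N" by (rule matching_missing[OF V(2)])
  have zy: "{z, y} \<in> E" using assms(2) by (simp add: insert_commute)
  show False by (rule missing_neighbours[OF isolated_max_matching assms(1) zy assms(3) M N])
qed

lemma component_clique: assumes "x \<in> V" shows "inner_edges E (component E x) = [component E x]\<^bsup>2\<^esup>"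
proof -
  have star: "y = x \<or> {x, y} \<in> E" if "y \<in> component E x" for x y
  proof -
    have "(x, y) \<in> (adj_rel E)\<^sup>*" using that by (simp add: component_def)
    then show ?thesis
    proof (induction rule: rtrancl_induct)
      case (step y z)
      then show ?case using adjacency_transitive[of x y z] by (auto simp: adj_rel_def)
    qed simp
  qed
  have "{y, z} \<in> E" if "y \<in> component E x" "z \<in> component E x" "y \<noteq> z" for y z
    using star[of z y] component_eq[OF that(1)] that by auto
  then show ?thesis unfolding inner_edges_def using E_V by (auto simp: nsets_def card_2_iff)
qed

text \<open>A maximum matching that misses \<open>x\<close> covers every other vertex of its clique,
  since an uncovered one could be matched with \<open>x\<close>. Its edges pair these vertices up
  inside the component.\<close>

lemma component_odd: assumes "x \<in> V" shows "odd (card (component E x))"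
proof -
  let ?C = "component E x"
  obtain N where N: "matching E N" "card N = t + 2" "x \<notin> \<Union>N" by (rule matching_missing[OF assms])
  let ?N = "{e \<in> N. e \<subseteq> ?C}"
  have clq: "{x, y} \<in> E" if "y \<in> ?C" "y \<noteq> x" for y
    using component_clique[OF assms] that component_refl[of x E] unfolding inner_edges_def by (auto simp: set_eq_iff)
  have "\<Union>?N = ?C - {x}"
  proof
    show "\<Union>?N \<subseteq> ?C - {x}" using N(3) by blast
    show "?C - {x} \<subseteq> \<Union>?N"
    proof
      fix y assume y: "y \<in> ?C - {x}"
      have "y \<in> \<Union>N"
      proof (rule ccontr)
        assume "y \<notin> \<Union>N"
        moreover have "{x, y} \<in> E" using clq y by simp
        ultimately have "matching E (insert {x, y} N)" "card (insert {x, y} N) = Suc (card N)"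
          using matching_insert_edge[OF N(1) _ N(3)] by auto
        then show False using isolated_max_matching[of "insert {x, y} N"] N(2) by simp
      qed
      then obtain e where e: "e \<in> N" "y \<in> e" by blast
      then have yE: "{y, mate N y} \<in> E" "e = {y, mate N y}" using covered_edge[OF N(1) e] matching_subset[OF N(1)] by auto
      then have "e \<subseteq> ?C" using y component_closed[of y E x] by simp
      then show "y \<in> \<Union>?N" using e by blast
    qed
  qed
  moreover have "matching E ?N" using N(1) by (rule matching_mono) auto
  ultimately have "card (?C - {x}) = 2 * card ?N" using card_Union_matching by metis
  moreover have "card ?C = Suc (card (?C - {x}))"
    using component_refl[of x E] finite_component[OF assms] by (simp add: card_Suc_Diff1 del: card_Diff_insert)
  ultimately show ?thesis by simp
qed

end

end

lemma card_nsets_2: "finite A \<Longrightarrow> card ([A]\<^bsup>2\<^esup>) = card A choose 2"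
proof -
  assume A: "finite A"
  then have "[A]\<^bsup>2\<^esup> = {B. B \<subseteq> A \<and> card B = 2}" by (auto simp: nsets_def intro: finite_subset)
  then show ?thesis using n_subsets[OF A, of 2] by simp
qed

context linear_forest_saturated
begin

lemma isolated_structure:
  assumes few: "card E + 1 < card V" and v: "v \<in> V" and isolated: "\<And>w. {v, w} \<notin> E"
  shows "3 * t + 18 \<le> card E \<and> (card E = 3 * t + 18 \<longrightarrow> (\<exists>A Bs. seven_clique_and_triangles V E t A Bs))"
proof -
  let ?CC = "component E ` V"
  define k where "k C = card C div 2" for C :: "'a set"
  \<comment> \<open>\<open>h C\<close> counts the edges of a clique on \<open>2 * k C + 1\<close>
    vertices beyond \<open>3 * k C\<close>; it vanishes exactly for
    \<open>k C \<le> 1\<close>.\<close>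
  define h where "h C = 2 * k C * k C - 2 * k C" for C :: "'a set"
  have finCC: "finite ?CC" using finite_V by simp
  have fin: "finite C" "C \<subseteq> V" if "C \<in> ?CC" for C using that finite_component component_subset by auto
  have card_C: "card C = 2 * k C + 1" if "C \<in> ?CC" for C
    using component_odd[OF few v isolated] that unfolding k_def by auto
  have inner: "inner_edges E C = [C]\<^bsup>2\<^esup>" if "C \<in> ?CC" for C
    using component_clique[OF few v isolated] that by auto
  have edges_C: "card (inner_edges E C) = h C + 3 * k C" if "C \<in> ?CC" for C
  proof -
    have "card (inner_edges E C) = (2 * k C + 1) choose 2"
      using inner[OF that] card_nsets_2[OF fin(1)[OF that]] card_C[OF that] by simp
    also have "\<dots> = k C * (2 * k C + 1)" by (simp add: choose_two algebra_simps)
    also have "\<dots> = h C + 3 * k C" unfolding h_def by (cases "k C") (simp_all add: algebra_simps)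
    finally show ?thesis .
  qed
  have "card E = (\<Sum>C\<in>?CC. card (inner_edges E C))"
  proof (rule antisym)
    have "E \<subseteq> (\<Union>C\<in>?CC. inner_edges E C)"
    proof
      fix e assume "e \<in> E"
      then obtain x y where "e = {x, y}" "x \<in> V" by (rule edgeE)
      then have "e \<in> inner_edges E (component E x)"
        using \<open>e \<in> E\<close> component_refl[of x E] component_closed[of x E x y] unfolding inner_edges_def by auto
      then show "e \<in> (\<Union>C\<in>?CC. inner_edges E C)" using \<open>x \<in> V\<close> by blast
    qed
    then have "card E \<le> card (\<Union>C\<in>?CC. inner_edges E C)"
      using finite_V finite_E by (intro card_mono) (auto simp: inner_edges_def)
    also have "\<dots> \<le> (\<Sum>C\<in>?CC. card (inner_edges E C))" by (rule card_UN_le[OF finCC])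
    finally show "card E \<le> (\<Sum>C\<in>?CC. card (inner_edges E C))" .
  qed (rule sum_over_components)
  then have card_E: "card E = (\<Sum>C\<in>?CC. h C) + 3 * (\<Sum>C\<in>?CC. k C)"
    using edges_C by (simp add: sum.distrib sum_distrib_left)
  obtain N where N: "matching E N" "card N = t + 2" by (rule matching_missing[OF few v isolated v])
  \<comment> \<open>Every edge of \<open>N\<close> lies in a component, and a component
    \<open>C\<close> has room for at most \<open>k C\<close> of them.\<close>
  have k_sum: "t + 2 \<le> (\<Sum>C\<in>?CC. k C)"
  proof -
    have "N \<subseteq> (\<Union>C\<in>?CC. {e \<in> N. e \<subseteq> C})"
    proof
      fix e assume "e \<in> N"
      then have "e \<in> E" using matching_subset[OF N(1)] by blast
      then obtain x y where "e = {x, y}" "x \<in> V" by (rule edgeE)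
      then have "e \<subseteq> component E x"
        using \<open>e \<in> E\<close> component_refl[of x E] component_closed[of x E x y] by auto
      then show "e \<in> (\<Union>C\<in>?CC. {e \<in> N. e \<subseteq> C})" using \<open>e \<in> N\<close> \<open>x \<in> V\<close> by blast
    qed
    then have "card N \<le> card (\<Union>C\<in>?CC. {e \<in> N. e \<subseteq> C})"
      using finite_V finite_matching[OF N(1)] by (intro card_mono) auto
    also have "\<dots> \<le> (\<Sum>C\<in>?CC. card {e \<in> N. e \<subseteq> C})" by (rule card_UN_le[OF finCC])
    also have "\<dots> \<le> (\<Sum>C\<in>?CC. k C)"
    proof (rule sum_mono)
      fix C assume "C \<in> ?CC"
      then show "card {e \<in> N. e \<subseteq> C} \<le> k C"
        using card_matching_inside[OF N(1) fin(1)] unfolding k_def by fastforce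
    qed
    finally show ?thesis using N(2) by simp
  qed
  obtain a b c d e f where p: "path6 E a b c d e f" using isolated_imp_path6[OF few v isolated] by blast
  define A where "A = component E a"
  have "{a, b} \<in> E" using p unfolding path6_def by simp
  then have A: "A \<in> ?CC" unfolding A_def using edge_V by blast
  \<comment> \<open>The component of the path has at least six vertices and odd order, hence
    \<open>3 \<le> k A\<close>.\<close>
  have "{a, b, c, d, e, f} \<subseteq> A" unfolding A_def using path6_component[OF p] component_refl[of a E] by blast
  then have "card {a, b, c, d, e, f} \<le> card A" using fin(1)[OF A] by (rule card_mono[rotated])
  then have kA: "3 \<le> k A" using p card_C[OF A] unfolding path6_def by simp
  have h_mono: "2 * m * m - 2 * m \<le> h C" if "1 \<le> m" "m \<le> k C" for m C
  proof -
    have "2 * (m * (m - 1)) \<le> 2 * (k C * (k C - 1))" using that by (intro mult_le_mono) auto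
    then show ?thesis unfolding h_def by (simp add: algebra_simps diff_mult_distrib2)
  qed
  have hA: "12 \<le> h A" using h_mono[of 3 A] kA by simp
  have h_sum: "(\<Sum>C\<in>?CC. h C) = h A + (\<Sum>C\<in>?CC - {A}. h C)" using finCC A by (rule sum.remove)
  have k_sum': "(\<Sum>C\<in>?CC. k C) = k A + (\<Sum>C\<in>?CC - {A}. k C)" using finCC A by (rule sum.remove)
  have "3 * t + 18 \<le> card E" using card_E k_sum hA h_sum by linarith
  moreover have "\<exists>A Bs. seven_clique_and_triangles V E t A Bs" if eq: "card E = 3 * t + 18"
  proof -
    \<comment> \<open>Equality leaves no slack: the large clique has excess exactly 12, and no other
      clique has any.\<close>
    have *: "h A = 12" "(\<Sum>C\<in>?CC - {A}. h C) = 0" "(\<Sum>C\<in>?CC. k C) = t + 2"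
      using eq card_E k_sum hA h_sum by linarith+
    have "\<not> 4 \<le> k A" using h_mono[of 4 A] *(1) by auto
    then have kA3: "k A = 3" using kA by simp
    have k1: "k C \<le> 1" if "C \<in> ?CC - {A}" for C
    proof (rule ccontr)
      assume "\<not> k C \<le> 1"
      then have "4 \<le> h C" using h_mono[of 2 C] by simp
      moreover have "h C = 0" using *(2) that finCC by simp
      ultimately show False by simp
    qed
    define Bs where "Bs = {C \<in> ?CC - {A}. k C = 1}"
    have disj: "C \<inter> D = {}" if "C \<in> ?CC" "D \<in> ?CC" "C \<noteq> D" for C D
    proof (rule ccontr)
      assume "C \<inter> D \<noteq> {}"
      then obtain z where "z \<in> C" "z \<in> D" by blast
      then show False using that component_eq[of z E] by auto
    qed
    have "(\<Sum>C\<in>?CC - {A}. k C) = (\<Sum>C\<in>Bs. 1)"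
      unfolding Bs_def
    proof (rule sum.mono_neutral_cong_right)
      show "\<forall>C\<in>?CC - {A} - {C \<in> ?CC - {A}. k C = 1}. k C = 0"
      proof
        fix C assume "C \<in> ?CC - {A} - {C \<in> ?CC - {A}. k C = 1}"
        then have "C \<in> ?CC - {A}" "k C \<noteq> 1" by blast+
        then show "k C = 0" using k1[of C] by linarith
      qed
    qed (use finCC in auto)
    then have "card Bs = t - 1" using *(3) k_sum' kA3 by simp
    moreover have "E = [A]\<^bsup>2\<^esup> \<union> (\<Union>B\<in>Bs. [B]\<^bsup>2\<^esup>)"
    proof
      show "[A]\<^bsup>2\<^esup> \<union> (\<Union>B\<in>Bs. [B]\<^bsup>2\<^esup>) \<subseteq> E"
        using inner A unfolding Bs_def inner_edges_def by blast
      show "E \<subseteq> [A]\<^bsup>2\<^esup> \<union> (\<Union>B\<in>Bs. [B]\<^bsup>2\<^esup>)"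
      proof
        fix e assume "e \<in> E"
        then obtain x y where xy: "e = {x, y}" "x \<in> V" "x \<noteq> y" by (rule edgeE)
        let ?C = "component E x"
        have C: "?C \<in> ?CC" using xy by blast
        have "y \<in> ?C" using component_closed[of x E x y] component_refl[of x E] \<open>e \<in> E\<close> xy by simp
        then have eC: "e \<in> [?C]\<^bsup>2\<^esup>" using xy component_refl[of x E] by simp
        have "card e \<le> card ?C" using eC fin(1)[OF C] by (intro card_mono) (auto simp: nsets_def)
        moreover have "card e = 2" using xy by simp
        ultimately have "k ?C \<noteq> 0" using card_C[OF C] by linarith
        have "?C = A \<or> ?C \<in> Bs"
        proof (cases "?C = A")
          case False
          then have "?C \<in> ?CC - {A}" using C by blast
          moreover from k1[OF this] have "k ?C = 1" using \<open>k ?C \<noteq> 0\<close> by linarith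
          ultimately show ?thesis unfolding Bs_def by blast
        qed simp
        then show "e \<in> [A]\<^bsup>2\<^esup> \<union> (\<Union>B\<in>Bs. [B]\<^bsup>2\<^esup>)" using eC by blast
      qed
    qed
    moreover have "B \<subseteq> V \<and> card B = 3 \<and> A \<inter> B = {}" if "B \<in> Bs" for B
      using that fin(2)[of B] card_C[of B] disj[of A B] A unfolding Bs_def by auto
    moreover have "pairwise disjnt Bs" using disj unfolding Bs_def pairwise_def disjnt_def by auto
    moreover have "finite Bs" unfolding Bs_def using finCC by simp
    moreover have "A \<subseteq> V" "card A = 7" using fin(2)[OF A] card_C[OF A] kA3 by auto
    ultimately show ?thesis unfolding seven_clique_and_triangles_def by blast
  qed
  ultimately show ?thesis by blast
qed

end

section \<open>The extremal graph\<close>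

lemma isomorphic_sym: assumes "G \<cong>\<^sub>g H" shows "H \<cong>\<^sub>g G"
proof -
  obtain f where f: "bij_betw f (verts G) (verts H)"
    "\<forall>u\<in>verts G. \<forall>v\<in>verts G. {u, v} \<in> edges G \<longleftrightarrow> {f u, f v} \<in> edges H"
    using assms unfolding isomorphic_def by blast
  let ?g = "inv_into (verts G) f"
  have g: "bij_betw ?g (verts H) (verts G)" using f(1) by (rule bij_betw_inv_into)
  have "{u, v} \<in> edges H \<longleftrightarrow> {?g u, ?g v} \<in> edges G" if "u \<in> verts H" "v \<in> verts H" for u v
  proof -
    have "?g u \<in> verts G" "?g v \<in> verts G" "f (?g u) = u" "f (?g v) = v"
      using that g f(1) by (auto simp: bij_betw_apply bij_betw_inv_into_right)
    then show ?thesis using f(2) by auto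
  qed
  then show ?thesis unfolding isomorphic_def using g by blast
qed

lemma nsets_2_image: assumes "inj_on f S" shows "(`) f ` [S]\<^bsup>2\<^esup> = [f ` S]\<^bsup>2\<^esup>"
proof
  show "(`) f ` [S]\<^bsup>2\<^esup> \<subseteq> [f ` S]\<^bsup>2\<^esup>"
  proof
    fix e assume "e \<in> (`) f ` [S]\<^bsup>2\<^esup>"
    then obtain d where d: "d \<subseteq> S" "finite d" "card d = 2" "e = f ` d" by (auto simp: nsets_def)
    then have "card e = 2" using card_image[OF inj_on_subset[OF assms d(1)]] by simp
    then show "e \<in> [f ` S]\<^bsup>2\<^esup>" using d image_mono[OF d(1), of f] by (simp add: nsets_def)
  qed
  show "[f ` S]\<^bsup>2\<^esup> \<subseteq> (`) f ` [S]\<^bsup>2\<^esup>"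
  proof
    fix e assume "e \<in> [f ` S]\<^bsup>2\<^esup>"
    then obtain u v where uv: "e = {u, v}" "u \<in> f ` S" "v \<in> f ` S" "u \<noteq> v" by (rule nsets2_E)
    then obtain x y where "x \<in> S" "y \<in> S" "u = f x" "v = f y" by blast
    then have "{x, y} \<in> [S]\<^bsup>2\<^esup>" "e = f ` {x, y}" using uv by auto
    then show "e \<in> (`) f ` [S]\<^bsup>2\<^esup>" by (rule rev_image_eqI)
  qed
qed

section \<open>Saturation of the clique with triangles\<close>

context
  fixes V :: "'a set" and E t A Bs
  assumes config: "seven_clique_and_triangles V E t A Bs"
begin

lemma config_facts:
  shows config_A: "A \<subseteq> V" "card A = 7" and config_B: "B \<in> Bs \<Longrightarrow> B \<subseteq> V \<and> card B = 3 \<and> A \<inter> B = {}"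
    and config_disjoint: "pairwise disjnt Bs" and config_card: "finite Bs" "card Bs = t - 1"
    and config_E: "E = [A]\<^bsup>2\<^esup> \<union> (\<Union>B\<in>Bs. [B]\<^bsup>2\<^esup>)"
  using config unfolding seven_clique_and_triangles_def by auto

lemma config_finite: "finite A" "B \<in> Bs \<Longrightarrow> finite B"
  using config_A(2) config_B[of B] by (auto intro: card_ge_0_finite)

lemma config_E_V: "E \<subseteq> [V]\<^bsup>2\<^esup>"
proof -
  have "[A]\<^bsup>2\<^esup> \<subseteq> [V]\<^bsup>2\<^esup>" using config_A(1) by (rule nsets_mono)
  moreover have "[B]\<^bsup>2\<^esup> \<subseteq> [V]\<^bsup>2\<^esup>" if "B \<in> Bs" for B using config_B[OF that] by (intro nsets_mono) simp
  ultimately show ?thesis unfolding config_E by blast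
qed

lemma config_edge_iff: "{u, v} \<in> E \<longleftrightarrow> u \<noteq> v \<and> (u \<in> A \<and> v \<in> A \<or> (\<exists>B\<in>Bs. u \<in> B \<and> v \<in> B))"
  unfolding config_E by auto

lemma config_card_edges: assumes "t \<ge> 1" shows "card E = 3 * t + 18"
proof -
  have disj: "[X]\<^bsup>2\<^esup> \<inter> [Y]\<^bsup>2\<^esup> = {}" if "X \<inter> Y = {}" for X Y :: "'a set"
  proof (rule ccontr)
    assume "[X]\<^bsup>2\<^esup> \<inter> [Y]\<^bsup>2\<^esup> \<noteq> {}"
    then obtain e where "e \<subseteq> X \<inter> Y" "card e = 2" unfolding nsets_def by blast
    then show False using that by auto
  qed
  have fin: "finite ([B]\<^bsup>2\<^esup>)" if "B \<in> Bs" for B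
    using config_finite(2)[OF that] by (rule finite_imp_finite_nsets)
  have "card (\<Union>B\<in>Bs. [B]\<^bsup>2\<^esup>) = (\<Sum>B\<in>Bs. card ([B]\<^bsup>2\<^esup>))"
  proof (rule card_UN_disjoint)
    show "\<forall>B\<in>Bs. \<forall>C\<in>Bs. B \<noteq> C \<longrightarrow> [B]\<^bsup>2\<^esup> \<inter> [C]\<^bsup>2\<^esup> = {}"
    proof (intro ballI impI)
      fix B C assume "B \<in> Bs" "C \<in> Bs" "B \<noteq> C"
      then show "[B]\<^bsup>2\<^esup> \<inter> [C]\<^bsup>2\<^esup> = {}"
        using pairwiseD[OF config_disjoint] disj[of B C] by (simp add: disjnt_def)
    qed
  qed (use config_card fin in auto)
  also have "\<dots> = (\<Sum>B\<in>Bs. 3)"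
  proof (rule sum.cong)
    fix B assume B: "B \<in> Bs"
    then have "card ([B]\<^bsup>2\<^esup>) = 3 choose 2" using config_B[OF B] card_nsets_2[OF config_finite(2)[OF B]] by simp
    then show "card ([B]\<^bsup>2\<^esup>) = 3" by (simp add: choose_two)
  qed simp
  finally have "card (\<Union>B\<in>Bs. [B]\<^bsup>2\<^esup>) = 3 * (t - 1)" using config_card by simp
  moreover have "card ([A]\<^bsup>2\<^esup>) = 21"
    using card_nsets_2[OF config_finite(1)] config_A(2) by (simp add: choose_two)
  moreover have "[A]\<^bsup>2\<^esup> \<inter> (\<Union>B\<in>Bs. [B]\<^bsup>2\<^esup>) = {}" using disj config_B by blast
  moreover have "finite ([A]\<^bsup>2\<^esup>)" using config_finite(1) by (rule finite_imp_finite_nsets)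
  moreover have "finite (\<Union>B\<in>Bs. [B]\<^bsup>2\<^esup>)" using config_card(1) fin by blast
  ultimately have "card E = 21 + 3 * (t - 1)" unfolding config_E by (simp add: card_Un_disjoint)
  then show ?thesis using assms by simp
qed

text \<open>A copy would contain a matching with \<open>t + 3\<close> edges, but the clique and the
  triangles provide at most \<open>3 + (t - 1)\<close>.\<close>

lemma config_no_forest:
  assumes V: "finite V" and t: "t \<ge> 1"
  shows "\<not> has_linear_forest E t"
proof
  interpret finite_simple_graph V E by unfold_locales (use V config_E_V in auto)
  assume "has_linear_forest E t"
  then obtain a b c d e f M where F: "path6 E a b c d e f" "matching E M" "card M = t" "{a, b, c, d, e, f} \<inter> \<Union>M = {}"
    by (rule has_linear_forestE)
  obtain N where N: "matching E N" "card N = t + 3"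
    by (rule linear_forest_matching[OF F(1,2) finite_matching[OF F(2)] F(3,4)])
  let ?N = "\<lambda>X. {e \<in> N. e \<subseteq> X}"
  have "N \<subseteq> ?N A \<union> (\<Union>B\<in>Bs. ?N B)"
    using matching_subset[OF N(1)] unfolding config_E nsets_def by blast
  moreover have "finite (?N A \<union> (\<Union>B\<in>Bs. ?N B))" using finite_matching[OF N(1)] config_card by auto
  ultimately have "card N \<le> card (?N A \<union> (\<Union>B\<in>Bs. ?N B))" by (rule card_mono[rotated])
  also have "\<dots> \<le> card (?N A) + card (\<Union>B\<in>Bs. ?N B)" by (rule card_Un_le)
  also have "card (\<Union>B\<in>Bs. ?N B) \<le> (\<Sum>B\<in>Bs. card (?N B))" by (rule card_UN_le[OF config_card(1)])
  also have "\<dots> \<le> (\<Sum>B\<in>Bs. 1)"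
  proof (rule sum_mono)
    fix B assume B: "B \<in> Bs"
    show "card (?N B) \<le> 1" using card_matching_inside[OF N(1) config_finite(2)[OF B]] config_B[OF B] by linarith
  qed
  also have "(\<Sum>B\<in>Bs. 1) = t - 1" using config_card by simp
  finally have "t + 3 \<le> card (?N A) + (t - 1)" using N(2) by simp
  moreover have "card (?N A) \<le> 3" using card_matching_inside[OF N(1) config_finite(1)] config_A(2) by linarith
  ultimately show False using t by linarith
qed

text \<open>No clique contains both \<open>u\<close> and \<open>v\<close>, so each loses at most one
  vertex to the added edge. Six vertices of \<open>A\<close> remain for the path and two of each
  triangle for an edge; with \<open>{u, v}\<close> itself the matching has \<open>t\<close>
  edges.\<close>

lemma config_add_edge:
  assumes t: "t \<ge> 1" and uv: "u \<noteq> v" "{u, v} \<notin> E"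
  shows "has_linear_forest (insert {u, v} E) t"
proof -
  have one: "u \<notin> X \<or> v \<notin> X" if "X = A \<or> X \<in> Bs" for X using uv that config_edge_iff by blast
  have big: "card X \<le> Suc (card (X - {u, v}))" if "X = A \<or> X \<in> Bs" for X
  proof -
    have "X - {u, v} = X - {u} \<or> X - {u, v} = X - {v}" using one[OF that] by blast
    moreover have "card X \<le> Suc (card (X - {w}))" for w
    proof (cases "w \<in> X")
      case True
      have "finite X" using that config_finite by blast
      from card_Suc_Diff1[OF this True] show ?thesis by linarith
    qed simp
    ultimately show ?thesis by metis
  qed
  have "6 \<le> card (A - {u, v})" using big[of A] config_A(2) by simp
  then obtain S where S: "S \<subseteq> A - {u, v}" "card S = 6" by (rule obtain_subset_with_card_n)
  then have "finite S" by (intro card_ge_0_finite) simp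
  then obtain xs where xs: "set xs = S" "distinct xs" using finite_distinct_list by blast
  then have "length xs = 6" using S(2) distinct_card by metis
  then obtain a b c d e f where abc: "xs = [a, b, c, d, e, f]"
    by (auto simp: numeral_eq_Suc length_Suc_conv)
  have AE: "{x, y} \<in> insert {u, v} E" if "x \<in> A" "y \<in> A" "x \<noteq> y" for x y using that config_edge_iff by auto
  have inA: "{a, b, c, d, e, f} \<subseteq> A - {u, v}" using S(1) xs(1) abc by auto
  then have p: "path6 (insert {u, v} E) a b c d e f" unfolding path6_def using AE xs(2) abc by auto
  have "\<forall>B\<in>Bs. \<exists>g. g \<subseteq> B - {u, v} \<and> card g = 2"
  proof
    fix B assume B: "B \<in> Bs"
    then have "2 \<le> card (B - {u, v})" using big[of B] config_B[OF B] by simp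
    then show "\<exists>g. g \<subseteq> B - {u, v} \<and> card g = 2" by (meson obtain_subset_with_card_n)
  qed
  then obtain g where g: "\<And>B. B \<in> Bs \<Longrightarrow> g B \<subseteq> B - {u, v}" "\<And>B. B \<in> Bs \<Longrightarrow> card (g B) = 2" by metis
  have gE: "g B \<in> E" if "B \<in> Bs" for B
  proof -
    have "g B \<in> [B]\<^bsup>2\<^esup>" using g[OF that] unfolding nsets_def by (auto intro: card_ge_0_finite)
    then show ?thesis unfolding config_E using that by blast
  qed
  have ne: "g B \<noteq> {}" if "B \<in> Bs" for B using g(2)[OF that] by auto
  have gd: "g B \<inter> g C = {}" if "B \<in> Bs" "C \<in> Bs" "B \<noteq> C" for B C
    using g(1)[OF that(1)] g(1)[OF that(2)] config_disjoint that unfolding pairwise_def disjnt_def by blast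
  have "inj_on g Bs" using gd ne by (metis inf.idem inj_onI)
  then have "card (g ` Bs) = t - 1" using config_card(2) by (simp add: card_image)
  moreover have "{u, v} \<notin> g ` Bs" using g(1) by blast
  ultimately have "card (insert {u, v} (g ` Bs)) = t" using config_card(1) t by simp
  moreover have "matching (insert {u, v} E) (insert {u, v} (g ` Bs))"
  proof (rule matching_insert)
    show "matching (insert {u, v} E) (g ` Bs)"
      unfolding matching_def pairwise_def disjnt_def using gE gd by auto
    show "{u, v} \<inter> \<Union>(g ` Bs) = {}" using g(1) by blast
  qed simp
  moreover have "A \<inter> g B = {}" if "B \<in> Bs" for B using config_B[OF that] g(1)[OF that] by blast
  then have "{a, b, c, d, e, f} \<inter> \<Union>(insert {u, v} (g ` Bs)) = {}" using inA by blast
  ultimately show ?thesis unfolding has_linear_forest_def using p by blast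
qed

lemma config_saturated:
  assumes "finite V" "t \<ge> 1"
  shows "saturated (P\<^sub>g 6 +\<^sub>g t *\<^sub>g P\<^sub>g 2) (Graph V E)"
  unfolding saturated_linear_forest_iff simple_graph_def
  using assms config_E_V config_no_forest config_add_edge by auto

lemma config_card_Union: "card (\<Union>Bs) = 3 * (t - 1)"
proof -
  have "card (\<Union>Bs) = (\<Sum>B\<in>Bs. card B)"
    using config_disjoint config_finite by (intro card_Union_disjoint) auto
  also have "\<dots> = (\<Sum>B\<in>Bs. 3)" using config_B by (intro sum.cong) auto
  finally show ?thesis using config_card by simp
qed

end

section \<open>Uniqueness up to isomorphism\<close>

lemma config_isomorphic:
  assumes X: "seven_clique_and_triangles V E t A Bs" and Y: "seven_clique_and_triangles V' E' t A' Bs'"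
    and V: "finite V" "finite V'" "card V = card V'"
  shows "Graph V E \<cong>\<^sub>g Graph V' E'"
proof -
  obtain h where h: "bij_betw h Bs Bs'"
    using config_card[OF X] config_card[OF Y] finite_same_card_bij by metis
  have hB: "h B \<in> Bs'" if "B \<in> Bs" for B using h that by (auto simp: bij_betw_def)
  obtain gA where gA: "bij_betw gA A A'"
    using config_finite(1)[OF X] config_finite(1)[OF Y] config_A(2)[OF X] config_A(2)[OF Y] finite_same_card_bij by metis
  have "\<forall>B\<in>Bs. \<exists>g. bij_betw g B (h B)"
  proof
    fix B assume B: "B \<in> Bs"
    show "\<exists>g. bij_betw g B (h B)"
      using finite_same_card_bij[OF config_finite(2)[OF X B] config_finite(2)[OF Y hB[OF B]]]
        config_B[OF X B] config_B[OF Y hB[OF B]] by simp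
  qed
  then obtain gB where gB: "\<And>B. B \<in> Bs \<Longrightarrow> bij_betw (gB B) B (h B)" by metis
  let ?R = "V - (A \<union> \<Union>Bs)" and ?R' = "V' - (A' \<union> \<Union>Bs')"
  have R: "A \<union> \<Union>Bs \<subseteq> V" "A \<inter> \<Union>Bs = {}" using config_A(1)[OF X] config_B[OF X] by blast+
  have R': "A' \<union> \<Union>Bs' \<subseteq> V'" "A' \<inter> \<Union>Bs' = {}" using config_A(1)[OF Y] config_B[OF Y] by blast+
  have finU: "finite (A \<union> \<Union>Bs)" "finite (A' \<union> \<Union>Bs')" using R(1) R'(1) V finite_subset by blast+
  have "card (A \<union> \<Union>Bs) = card (A' \<union> \<Union>Bs')"
    using finU R(2) R'(2) config_card_Union[OF X] config_card_Union[OF Y] config_A(2)[OF X] config_A(2)[OF Y]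
    by (simp add: card_Un_disjoint)
  then have "card ?R = card ?R'" using R(1) R'(1) V finU by (simp add: card_Diff_subset)
  then obtain gR where gR: "bij_betw gR ?R ?R'" using V finite_same_card_bij by (metis finite_Diff)
  \<comment> \<open>\<open>b x\<close> is the triangle containing \<open>x\<close>. The map
    \<open>g\<close> glues the bijections on the clique, on the single triangles and on the isolated
    rest.\<close>
  define b where "b x = (THE B. B \<in> Bs \<and> x \<in> B)" for x
  define g where "g x = (if x \<in> A then gA x else if x \<in> \<Union>Bs then gB (b x) x else gR x)" for x
  have b: "b x = B" if "B \<in> Bs" "x \<in> B" for x B
    unfolding b_def
  proof (rule the_equality)
    fix C assume C: "C \<in> Bs \<and> x \<in> C"
    show "C = B"
    proof (rule ccontr)
      assume "C \<noteq> B"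
      then have "disjnt C B" using pairwiseD[OF config_disjoint[OF X]] C that(1) by blast
      then show False using C that(2) by (auto simp: disjnt_iff)
    qed
  qed (use that in blast)
  have gA': "bij_betw g A A'" using gA by (rule bij_betw_cong[THEN iffD1, rotated]) (simp add: g_def)
  have gB': "bij_betw g B (h B)" if B: "B \<in> Bs" for B
  proof -
    have "gB B x = g x" if "x \<in> B" for x
      unfolding g_def using b[OF B that] that B R(2) by auto
    then show ?thesis using gB[OF B] bij_betw_cong by blast
  qed
  have gR': "bij_betw g ?R ?R'" using gR by (rule bij_betw_cong[THEN iffD1, rotated]) (simp add: g_def)
  have "bij_betw g (\<Union>B\<in>Bs. B) (\<Union>B\<in>Bs. h B)"
  proof (rule bij_betw_UNION_disjoint)
    show "disjoint_family_on h Bs"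
      using h config_disjoint[OF Y] hB unfolding disjoint_family_on_def pairwise_def disjnt_def bij_betw_def inj_on_def
      by metis
  qed (use gB' in auto)
  moreover have "(\<Union>B\<in>Bs. h B) = \<Union>Bs'" using h by (simp add: bij_betw_def)
  ultimately have "bij_betw g (\<Union>Bs) (\<Union>Bs')" by simp
  from bij_betw_combine[OF gA' this R'(2)] have "bij_betw g (A \<union> \<Union>Bs) (A' \<union> \<Union>Bs')" .
  from bij_betw_combine[OF this gR' Diff_disjoint]
  have "bij_betw g ((A \<union> \<Union>Bs) \<union> ?R) ((A' \<union> \<Union>Bs') \<union> ?R')" .
  moreover have "(A \<union> \<Union>Bs) \<union> ?R = V" "(A' \<union> \<Union>Bs') \<union> ?R' = V'" using R(1) R'(1) by blast+
  ultimately have g: "bij_betw g V V'" by simp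
  have inA: "g x \<in> A' \<longleftrightarrow> x \<in> A" if "x \<in> V" for x
    using inj_on_image_mem_iff[of g V x A] g gA' that config_A(1)[OF X] by (simp add: bij_betw_def)
  have inB: "g x \<in> h B \<longleftrightarrow> x \<in> B" if "x \<in> V" "B \<in> Bs" for x B
    using inj_on_image_mem_iff[of g V x B] g gB'[OF that(2)] that config_B[OF X] by (simp add: bij_betw_def)
  have "{u, v} \<in> E \<longleftrightarrow> {g u, g v} \<in> E'" if "u \<in> V" "v \<in> V" for u v
  proof -
    have "(\<exists>B\<in>Bs'. g u \<in> B \<and> g v \<in> B) \<longleftrightarrow> (\<exists>B\<in>Bs. g u \<in> h B \<and> g v \<in> h B)"
      using h unfolding bij_betw_def by blast
    moreover have "g u = g v \<longleftrightarrow> u = v" using g that by (auto simp: bij_betw_def inj_on_eq_iff)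
    ultimately show ?thesis unfolding config_edge_iff[OF X] config_edge_iff[OF Y] using inA inB that by auto
  qed
  then show ?thesis unfolding isomorphic_def using g by auto
qed

lemma config_transfer:
  assumes X: "seven_clique_and_triangles V E t A Bs" and g: "bij_betw g V V'"
  shows "seven_clique_and_triangles V' ((`) ((`) g) E) t (g ` A) ((`) g ` Bs)"
proof -
  have inj: "inj_on g V" and im: "g ` V = V'" using g by (auto simp: bij_betw_def)
  have sub: "inj_on g A" "B \<in> Bs \<Longrightarrow> inj_on g B" for B
    using inj_on_subset[OF inj config_A(1)[OF X]] inj_on_subset[OF inj, of B] config_B[OF X, of B] by simp_all
  have "inj_on ((`) g) Bs" using inj config_B[OF X]
    by (intro inj_onI) (metis inj_on_image_eq_iff)
  then have "card ((`) g ` Bs) = t - 1" using config_card[OF X] by (simp add: card_image)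
  moreover have "(`) g ` E = [g ` A]\<^bsup>2\<^esup> \<union> (\<Union>B\<in>(`) g ` Bs. [B]\<^bsup>2\<^esup>)"
    unfolding config_E[OF X] using sub by (simp add: image_Un image_UN nsets_2_image)
  moreover have "pairwise disjnt ((`) g ` Bs)"
  proof (rule pairwiseI)
    fix C D assume "C \<in> (`) g ` Bs" "D \<in> (`) g ` Bs" "C \<noteq> D"
    then obtain B B' where B: "B \<in> Bs" "B' \<in> Bs" "C = g ` B" "D = g ` B'" "B \<noteq> B'" by blast
    then have "B \<inter> B' = {}" using config_disjoint[OF X] unfolding pairwise_def disjnt_def by blast
    then show "disjnt C D" unfolding disjnt_def B(3,4)
      using inj_on_image_Int[OF inj, of B B'] config_B[OF X] B(1,2) by auto
  qed
  moreover have "g ` B \<subseteq> V' \<and> card (g ` B) = 3 \<and> g ` A \<inter> g ` B = {}" if "B \<in> Bs" for B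
    using inj_on_image_Int[OF inj, of A B] config_B[OF X that] config_A(1)[OF X] im sub(2)[OF that]
    by (auto simp: card_image)
  moreover have "g ` A \<subseteq> V'" "card (g ` A) = 7" using config_A[OF X] im sub(1) by (auto simp: card_image)
  ultimately show ?thesis unfolding seven_clique_and_triangles_def using config_card(1)[OF X] by auto
qed

lemma config_sum_graph:
  fixes m t :: nat
  defines "H \<equiv> K\<^sub>g 7 +\<^sub>g (t - 1) *\<^sub>g K\<^sub>g 3 +\<^sub>g edgeless_graph m"
  obtains A Bs where "seven_clique_and_triangles (verts H) (edges H) t A Bs"
    and "finite (verts H)" and "card (verts H) = 7 + 3 * (t - 1) + m"
proof
  \<comment> \<open>As the sum associates to the left, clique and triangle vertices carry two
    injections and the isolated ones only \<open>Inr\<close>.\<close>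
  let ?A = "(\<lambda>i. Inl (Inl i)) ` {..<7::nat} :: ((nat + nat \<times> nat) + nat) set"
  let ?f = "\<lambda>i j. Inl (Inr (i, j)) :: (nat + nat \<times> nat) + nat"
  let ?B = "\<lambda>i. ?f i ` {..<3::nat}"
  have V: "verts H = ({..<7} <+> {..<t - 1} \<times> {..<3}) <+> {..<m}"
    unfolding H_def disjoint_union_def copies_def complete_graph_def edgeless_graph_def complement_def by simp
  have E: "edges H = [?A]\<^bsup>2\<^esup> \<union> (\<Union>i<t - 1. [?B i]\<^bsup>2\<^esup>)"
  proof -
    have "(`) Inl ` (`) Inl ` [{..<7::nat}]\<^bsup>2\<^esup> = [?A]\<^bsup>2\<^esup>"
      by (simp add: nsets_2_image image_image)
    moreover have "(`) Inl ` (`) Inr ` (`) (Pair i) ` [{..<3::nat}]\<^bsup>2\<^esup> = [?B i]\<^bsup>2\<^esup>" for i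
      by (simp add: nsets_2_image image_image inj_on_def)
    ultimately show ?thesis
      unfolding H_def disjoint_union_def copies_def complete_graph_def edgeless_graph_def complement_def
      by (simp add: image_Un image_UN)
  qed
  show "finite (verts H)" unfolding V by simp
  show "card (verts H) = 7 + 3 * (t - 1) + m" unfolding V by (simp add: card_Plus)
  have "inj_on ?B {..<t - 1}"
  proof (rule inj_onI)
    fix i i' assume "?B i = ?B i'"
    moreover have "?f i 0 \<in> ?B i" by auto
    ultimately have "?f i 0 \<in> ?B i'" by (simp only:)
    then show "i = i'" by auto
  qed
  then have "card (?B ` {..<t - 1}) = t - 1" by (simp add: card_image)
  moreover have "card ?A = 7" by (subst card_image) (auto simp: inj_on_def)
  moreover have "card (?B i) = 3" for i by (subst card_image) (auto simp: inj_on_def)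
  moreover have "pairwise disjnt (?B ` {..<t - 1})" unfolding pairwise_def disjnt_def by auto
  ultimately show "seven_clique_and_triangles (verts H) (edges H) t ?A (?B ` {..<t - 1})"
    unfolding seven_clique_and_triangles_def E unfolding V by auto
qed

lemma isomorphic_sum_graph_iff:
  fixes G :: "'a graph"
  assumes G: "simple_graph G" and n: "card (verts G) = n" and t: "t \<ge> 1" "3 * t + 4 \<le> n"
  shows "G \<cong>\<^sub>g K\<^sub>g 7 +\<^sub>g (t - 1) *\<^sub>g K\<^sub>g 3 +\<^sub>g edgeless_graph (n - 3 * t - 4) \<longleftrightarrow>
    (\<exists>A Bs. seven_clique_and_triangles (verts G) (edges G) t A Bs)"
proof -
  let ?H = "K\<^sub>g 7 +\<^sub>g (t - 1) *\<^sub>g K\<^sub>g 3 +\<^sub>g edgeless_graph (n - 3 * t - 4)"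
  obtain A Bs where H: "seven_clique_and_triangles (verts ?H) (edges ?H) t A Bs" "finite (verts ?H)"
    "card (verts ?H) = 7 + 3 * (t - 1) + (n - 3 * t - 4)" by (rule config_sum_graph)
  have cH: "card (verts ?H) = n" using H(3) t by simp
  have fG: "finite (verts G)" "edges G \<subseteq> [verts G]\<^bsup>2\<^esup>" using G unfolding simple_graph_def by auto
  show ?thesis
  proof
    assume "G \<cong>\<^sub>g ?H"
    then have "?H \<cong>\<^sub>g G" by (rule isomorphic_sym)
    then obtain f where f: "bij_betw f (verts ?H) (verts G)"
      "\<forall>u\<in>verts ?H. \<forall>v\<in>verts ?H. {u, v} \<in> edges ?H \<longleftrightarrow> {f u, f v} \<in> edges G"
      unfolding isomorphic_def by blast
    have "edges G = (`) f ` edges ?H" by (rule edges_image_iso[OF f(1) config_E_V[OF H(1)] fG(2) f(2)])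
    then show "\<exists>A Bs. seven_clique_and_triangles (verts G) (edges G) t A Bs"
      using config_transfer[OF H(1) f(1)] by auto
  next
    assume "\<exists>A Bs. seven_clique_and_triangles (verts G) (edges G) t A Bs"
    then obtain A' Bs' where "seven_clique_and_triangles (verts G) (edges G) t A' Bs'" by blast
    from config_isomorphic[OF this H(1) fG(1) H(2)] show "G \<cong>\<^sub>g ?H" using cH n by simp
  qed
qed

lemma card_verts_isomorphic: "G \<cong>\<^sub>g H \<Longrightarrow> card (verts G) = card (verts H)"
  unfolding isomorphic_def by (auto dest: bij_betw_same_card)

text \<open>\<open>sat\<close> minimises over graphs on natural numbers, so the sum graph is carried
  over to the vertex set \<open>{..<n}\<close>.\<close>

lemma config_exists:
  assumes t: "t \<ge> 1" "3 * t + 4 \<le> n"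
  shows "\<exists>G :: nat graph. saturated (P\<^sub>g 6 +\<^sub>g t *\<^sub>g P\<^sub>g 2) G \<and> card (verts G) = n \<and> card (edges G) = 3 * t + 18"
proof -
  let ?H = "K\<^sub>g 7 +\<^sub>g (t - 1) *\<^sub>g K\<^sub>g 3 +\<^sub>g edgeless_graph (n - 3 * t - 4)"
  obtain A Bs where H: "seven_clique_and_triangles (verts ?H) (edges ?H) t A Bs" "finite (verts ?H)"
    "card (verts ?H) = 7 + 3 * (t - 1) + (n - 3 * t - 4)" by (rule config_sum_graph)
  have "card (verts ?H) = card {..<n}" using H(3) t by simp
  then obtain g where "bij_betw g (verts ?H) {..<n}" using finite_same_card_bij[OF H(2)] by blast
  note Y = config_transfer[OF H(1) this]
  show ?thesis
    using config_saturated[OF Y _ t(1)] config_card_edges[OF Y t(1)]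
    by (intro exI[of _ "Graph {..<n} ((`) g ` edges ?H)"]) auto
qed

section \<open>Saturated forests\<close>

text \<open>A forest of trees of height two: roots \<open>L0\<close>, branches \<open>L1\<close>, leaves \<open>L2\<close>.\<close>

locale branching_forest =
  fixes L0 L1 L2 :: "'a set" and par :: "'a \<Rightarrow> 'a" and t :: nat
  assumes finite_L: "finite L0" "finite L1" "finite L2"
    and disjoint_L: "L0 \<inter> L1 = {}" "L0 \<inter> L2 = {}" "L1 \<inter> L2 = {}"
    and par_L1: "b \<in> L1 \<Longrightarrow> par b \<in> L0" and par_L2: "l \<in> L2 \<Longrightarrow> par l \<in> L1"
    and three_branches: "c \<in> L0 \<Longrightarrow> 3 \<le> card {b \<in> L1. par b = c}"
    and two_leaves: "b \<in> L1 \<Longrightarrow> 2 \<le> card {l \<in> L2. par l = b}"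
    and enough_branches: "t + 3 \<le> card L1"
begin

definition V where "V = L0 \<union> L1 \<union> L2"

definition E where "E = (\<lambda>v. {v, par v}) ` (L1 \<union> L2)"

lemma edge_iff: "{u, v} \<in> E \<longleftrightarrow> u \<in> L1 \<union> L2 \<and> v = par u \<or> v \<in> L1 \<union> L2 \<and> u = par v"
  unfolding E_def by (auto simp: doubleton_eq_iff)

lemma not_par_self: "v \<in> L1 \<union> L2 \<Longrightarrow> par v \<noteq> v"
  using par_L1[of v] par_L2[of v] disjoint_L by auto

lemma E_V: "E \<subseteq> [V]\<^bsup>2\<^esup>"
proof
  fix e assume "e \<in> E"
  then obtain v where v: "v \<in> L1 \<union> L2" "e = {v, par v}" unfolding E_def by blast
  then show "e \<in> [V]\<^bsup>2\<^esup>" unfolding V_def using par_L1[of v] par_L2[of v] not_par_self[OF v(1)] by auto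
qed

lemma finite_V: "finite V"
  unfolding V_def using finite_L by simp

lemma card_V: "card V = card L0 + card L1 + card L2"
proof -
  have "(L0 \<union> L1) \<inter> L2 = {}" using disjoint_L by blast
  then show ?thesis unfolding V_def using finite_L disjoint_L(1) by (simp add: card_Un_disjoint)
qed

lemma card_E: "card E = card L1 + card L2"
proof -
  have "inj_on (\<lambda>v. {v, par v}) (L1 \<union> L2)"
  proof (rule inj_onI)
    fix u v assume uv: "u \<in> L1 \<union> L2" "v \<in> L1 \<union> L2" "{u, par u} = {v, par v}"
    then have "u = v \<or> u = par v \<and> v = par u" by (auto simp: doubleton_eq_iff)
    then show "u = v" using uv(1,2) par_L1 par_L2 disjoint_L by (metis UnE disjoint_iff)
  qed
  then show ?thesis unfolding E_def using finite_L disjoint_L(3) by (simp add: card_image card_Un_disjoint)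
qed

lemma branch_avoiding: assumes "c \<in> L0" obtains b where "b \<in> L1" "par b = c" "b \<noteq> x" "b \<noteq> y"
proof -
  have "\<not> {b \<in> L1. par b = c} \<subseteq> {x, y}"
  proof
    assume "{b \<in> L1. par b = c} \<subseteq> {x, y}"
    then have "card {b \<in> L1. par b = c} \<le> card {x, y}" by (intro card_mono) auto
    also have "\<dots> \<le> 2" by (simp add: card_insert_if)
    finally show False using three_branches[OF assms] by simp
  qed
  then show ?thesis using that by blast
qed

lemma leaf_avoiding: assumes "b \<in> L1" obtains l where "l \<in> L2" "par l = b" "l \<noteq> x"
proof -
  have "\<not> {l \<in> L2. par l = b} \<subseteq> {x}"
  proof
    assume "{l \<in> L2. par l = b} \<subseteq> {x}"
    then have "card {l \<in> L2. par l = b} \<le> card {x}" by (intro card_mono) auto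
    then show False using two_leaves[OF assms] by simp
  qed
  then show ?thesis using that by blast
qed

text \<open>The four inner vertices of a path are no leaves of the forest, so they alternate between
  roots and branches. One of \<open>c\<close> and \<open>d\<close> is then a branch with two roots
  as path neighbours, but a branch is adjacent to only one root, its parent.\<close>

lemma no_forest: "\<not> has_linear_forest E t"
proof
  assume "has_linear_forest E t"
  then obtain a b c d e f where p: "path6 E a b c d e f" by (rule has_linear_forestE)
  have e: "distinct [a, b, c, d, e, f]" "{b, a} \<in> E" "{b, c} \<in> E" "{c, b} \<in> E" "{c, d} \<in> E" "{d, c} \<in> E" "{d, e} \<in> E"
    "{e, d} \<in> E" "{e, f} \<in> E" using p unfolding path6_def by (simp_all add: insert_commute)
  have inner: "s \<in> L0 \<union> L1" if "{s, r} \<in> E" "{s, r'} \<in> E" "r \<noteq> r'" for s r r'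
    using that unfolding edge_iff using par_L1 par_L2 disjoint_L by blast
  have up: "s \<in> L0 \<and> r \<in> L1 \<and> s = par r \<or> r \<in> L0 \<and> s \<in> L1 \<and> r = par s"
    if "{s, r} \<in> E" "s \<in> L0 \<union> L1" "r \<in> L0 \<union> L1" for s r
    using that unfolding edge_iff using par_L1 par_L2 disjoint_L by blast
  have "b \<in> L0 \<union> L1" "c \<in> L0 \<union> L1" "d \<in> L0 \<union> L1" "e \<in> L0 \<union> L1"
    using inner[OF e(2,3)] inner[OF e(4,5)] inner[OF e(6,7)] inner[OF e(8,9)] e(1) by auto
  then have "b = par c \<and> c \<in> L1 \<or> c = par b \<and> c \<in> L0" "c = par d \<and> c \<in> L0 \<and> d \<in> L1 \<or> d = par c \<and> d \<in> L0 \<and> c \<in> L1"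
    "d = par e \<and> d \<in> L0 \<or> e = par d \<and> d \<in> L1"
    using up[OF e(3)] up[OF e(5)] up[OF e(7)] by blast+
  then show False using e(1) disjoint_L(1) by auto
qed

text \<open>Each branch outside \<open>K\<close> can be matched with one of its leaves, and the path
  meets none of these edges. At least \<open>t\<close> such branches remain by
  \<open>enough_branches\<close>.\<close>

lemma forest_from_path:
  assumes p: "path6 F v1 v2 v3 v4 v5 v6" and F: "E \<subseteq> F"
    and K: "K \<subseteq> L1" "finite K" "card K \<le> 3"
    and kill: "{v1, v2, v3, v4, v5, v6} \<subseteq> L0 \<union> K \<union> {l \<in> L2. par l \<in> K}"
  shows "has_linear_forest F t"
proof -
  have "card (L1 - K) = card L1 - card K" using K by (simp add: card_Diff_subset)
  then have "t \<le> card (L1 - K)" using K(3) enough_branches by linarith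
  then obtain S where S: "S \<subseteq> L1 - K" "card S = t" by (rule obtain_subset_with_card_n)
  have "\<forall>b. \<exists>l. b \<in> L1 \<longrightarrow> l \<in> L2 \<and> par l = b" using leaf_avoiding by metis
  then obtain g where g: "\<And>b. b \<in> L1 \<Longrightarrow> g b \<in> L2 \<and> par (g b) = b" by metis
  let ?m = "\<lambda>b. {g b, b}"
  have disj: "?m b \<inter> ?m b' = {}" if "b \<in> S" "b' \<in> S" "b \<noteq> b'" for b b'
  proof -
    have "b \<in> L1" "b' \<in> L1" using that S(1) by auto
    from g[OF this(1)] g[OF this(2)] this show ?thesis using that(3) disjoint_L(3) by auto
  qed
  have "inj_on ?m S"
  proof (rule inj_onI, rule ccontr)
    fix b b' assume b: "b \<in> S" "b' \<in> S" "?m b = ?m b'" "b \<noteq> b'"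
    from disj[OF b(1,2,4)] b(3) show False by simp
  qed
  then have "card (?m ` S) = t" using S(2) by (simp add: card_image)
  moreover have "?m b \<in> F" if "b \<in> S" for b
  proof -
    have "g b \<in> L2" "par (g b) = b" using g[of b] that S(1) by auto
    then have "?m b \<in> E" by (simp add: edge_iff)
    then show ?thesis using F by blast
  qed
  then have "?m ` S \<subseteq> F" by blast
  moreover have "pairwise disjnt (?m ` S)"
  proof (rule pairwiseI)
    fix d d' assume "d \<in> ?m ` S" "d' \<in> ?m ` S" "d \<noteq> d'"
    then obtain b b' where b: "b \<in> S" "b' \<in> S" "d = ?m b" "d' = ?m b'" "b \<noteq> b'" by blast
    from disj[OF b(1,2,5)] show "disjnt d d'" unfolding b(3,4) disjnt_def .
  qed
  ultimately have "card (?m ` S) = t" "matching F (?m ` S)" unfolding matching_def by simp_all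
  moreover have "z \<notin> ?m b" if "b \<in> S" "z \<in> {v1, v2, v3, v4, v5, v6}" for z b
  proof -
    have "b \<in> L1" "b \<notin> K" "g b \<in> L2" "par (g b) = b" using g[of b] that(1) S(1) by auto
    moreover have "z \<in> L0 \<union> K \<union> {l \<in> L2. par l \<in> K}" using that(2) kill by blast
    ultimately show ?thesis using disjoint_L K(1) by auto
  qed
  then have "{v1, v2, v3, v4, v5, v6} \<inter> \<Union>(?m ` S) = {}" by blast
  ultimately show ?thesis unfolding has_linear_forest_def using p by blast
qed

text \<open>\<open>x\<close>, \<open>y\<close>, \<open>z\<close> need not be distinct; one is
  repeated when the path touches only two branches.\<close>

lemma forest_with_three_branches:
  assumes e: "distinct [v1, v2, v3, v4, v5, v6]"
    "{v1, v2} \<in> insert g E" "{v2, v3} \<in> insert g E" "{v3, v4} \<in> insert g E" "{v4, v5} \<in> insert g E" "{v5, v6} \<in> insert g E"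
    and K: "x \<in> L1" "y \<in> L1" "z \<in> L1"
    and kill: "\<And>s. s \<in> {v1, v2, v3, v4, v5, v6} \<Longrightarrow> s \<in> L0 \<or> s \<in> {x, y, z} \<or> s \<in> L2 \<and> par s \<in> {x, y, z}"
  shows "has_linear_forest (insert g E) t"
proof (rule forest_from_path[of _ v1 v2 v3 v4 v5 v6 "{x, y, z}"])
  show "path6 (insert g E) v1 v2 v3 v4 v5 v6" unfolding path6_def using e by simp
  show "{v1, v2, v3, v4, v5, v6} \<subseteq> L0 \<union> {x, y, z} \<union> {l \<in> L2. par l \<in> {x, y, z}}" using kill by blast
qed (use K in \<open>auto simp: card_insert_if\<close>)

lemma branch_facts:
  assumes "b \<in> L1"
  shows "par b \<in> L0" "b \<notin> L0" "b \<notin> L2" "b \<noteq> par b" "par b \<noteq> b" "{b, par b} \<in> E" "{par b, b} \<in> E"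
  using assms par_L1 disjoint_L not_par_self[of b] by (auto simp: edge_iff)

lemma leaf_facts:
  assumes "l \<in> L2"
  shows "par l \<in> L1" "l \<notin> L0" "l \<notin> L1" "l \<noteq> par l" "par l \<noteq> l" "{l, par l} \<in> E" "{par l, l} \<in> E"
  using assms par_L2 disjoint_L not_par_self[of l] by (auto simp: edge_iff)

lemma root_not_branch_leaf: "c \<in> L0 \<Longrightarrow> c \<notin> L1" "c \<in> L0 \<Longrightarrow> c \<notin> L2"
  using disjoint_L by auto

section \<open>Paths created by each kind of added edge\<close>

lemma add_root_root:
  assumes "u \<in> L0" "v \<in> L0" "u \<noteq> v"
  shows "has_linear_forest (insert {u, v} E) t"
proof -
  obtain x where x: "x \<in> L1" "par x = u" using branch_avoiding[OF assms(1)] by metis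
  obtain l where l: "l \<in> L2" "par l = x" using leaf_avoiding[OF x(1)] by metis
  obtain y where y: "y \<in> L1" "par y = v" using branch_avoiding[OF assms(2)] by metis
  obtain m where m: "m \<in> L2" "par m = y" using leaf_avoiding[OF y(1)] by metis
  show ?thesis
    by (rule forest_with_three_branches[of l x u v y m "{u, v}" x y y])
      (use assms x l y m branch_facts[OF x(1)] branch_facts[OF y(1)] leaf_facts[OF l(1)] leaf_facts[OF m(1)] root_not_branch_leaf in auto)
qed

lemma add_root_branch:
  assumes "u \<in> L0" "v \<in> L1" "{u, v} \<notin> E"
  shows "has_linear_forest (insert {u, v} E) t"
proof -
  have ne: "par v \<noteq> u" using assms by (auto simp: edge_iff)
  obtain y where y: "y \<in> L1" "par y = u" using branch_avoiding[OF assms(1)] by metis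
  obtain l where l: "l \<in> L2" "par l = y" using leaf_avoiding[OF y(1)] by metis
  obtain z where z: "z \<in> L1" "par z = par v" "z \<noteq> v" using branch_avoiding[OF par_L1[OF assms(2)]] by metis
  show ?thesis
    by (rule forest_with_three_branches[of l y u v "par v" z "{u, v}" v y z])
      (use assms ne y l z branch_facts[OF y(1)] branch_facts[OF assms(2)] branch_facts[OF z(1)] leaf_facts[OF l(1)] root_not_branch_leaf in auto)
qed

lemma add_root_leaf:
  assumes "u \<in> L0" "v \<in> L2"
  shows "has_linear_forest (insert {u, v} E) t"
proof -
  let ?x = "par v"
  have x: "?x \<in> L1" by (rule par_L2[OF assms(2)])
  obtain y where y: "y \<in> L1" "par y = u" "y \<noteq> ?x" using branch_avoiding[OF assms(1)] by metis
  obtain m where m: "m \<in> L2" "par m = y" using leaf_avoiding[OF y(1)] by metis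
  show ?thesis
  \<comment> \<open>If \<open>v\<close> belongs to the tree of \<open>u\<close>, the path enters
    \<open>v\<close> from its branch and leaves it through the new edge; otherwise it ends by
    climbing from \<open>v\<close> to its own root.\<close>
  proof (cases "par ?x = u")
    case True
    obtain l where l: "l \<in> L2" "par l = ?x" "l \<noteq> v" using leaf_avoiding[OF x] by metis
    show ?thesis
      by (rule forest_with_three_branches[of l ?x v u y m "{u, v}" ?x y y])
        (use assms y l m x True branch_facts[OF y(1)] branch_facts[OF x] leaf_facts[OF l(1)] leaf_facts[OF m(1)] leaf_facts[OF assms(2)] root_not_branch_leaf in auto)
  next
    case False
    show ?thesis
      by (rule forest_with_three_branches[of m y u v ?x "par ?x" "{u, v}" ?x y y])
        (use assms y m x False branch_facts[OF y(1)] branch_facts[OF x] leaf_facts[OF m(1)] leaf_facts[OF assms(2)] root_not_branch_leaf in auto)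
  qed
qed

lemma add_branch_branch:
  assumes "u \<in> L1" "v \<in> L1" "u \<noteq> v"
  shows "has_linear_forest (insert {u, v} E) t"
proof (cases "par u = par v")
  case True
  obtain l where l: "l \<in> L2" "par l = u" using leaf_avoiding[OF assms(1)] by metis
  obtain z where z: "z \<in> L1" "par z = par v" "z \<noteq> u" "z \<noteq> v" using branch_avoiding[OF par_L1[OF assms(2)]] by metis
  obtain m where m: "m \<in> L2" "par m = z" using leaf_avoiding[OF z(1)] by metis
  show ?thesis
    by (rule forest_with_three_branches[of l u v "par v" z m "{u, v}" u v z])
      (use assms l z m branch_facts[OF assms(1)] branch_facts[OF assms(2)] branch_facts[OF z(1)] leaf_facts[OF l(1)] leaf_facts[OF m(1)] root_not_branch_leaf in auto)
next
  case False
  obtain z where z: "z \<in> L1" "par z = par u" "z \<noteq> u" using branch_avoiding[OF par_L1[OF assms(1)]] by metis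
  obtain m where m: "m \<in> L2" "par m = z" using leaf_avoiding[OF z(1)] by metis
  have "z \<noteq> v" using z(2) False by auto
  then show ?thesis
    by (intro forest_with_three_branches[of m z "par u" u v "par v" "{u, v}" u v z])
      (use assms False z m branch_facts[OF assms(1)] branch_facts[OF assms(2)] branch_facts[OF z(1)] leaf_facts[OF m(1)] root_not_branch_leaf in auto)
qed

lemma add_branch_leaf:
  assumes "u \<in> L1" "v \<in> L2" "{u, v} \<notin> E"
  shows "has_linear_forest (insert {u, v} E) t"
proof -
  let ?b = "par v"
  have b: "?b \<in> L1" by (rule par_L2[OF assms(2)])
  have ne: "?b \<noteq> u" using assms by (auto simp: edge_iff)
  obtain m where m: "m \<in> L2" "par m = ?b" "m \<noteq> v" using leaf_avoiding[OF b] by metis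
  obtain z where z: "z \<in> L1" "par z = par u" "z \<noteq> u" "z \<noteq> ?b" using branch_avoiding[OF par_L1[OF assms(1)]] by metis
  show ?thesis
    by (rule forest_with_three_branches[of m ?b v u "par u" z "{u, v}" ?b u z])
      (use assms ne b m z branch_facts[OF assms(1)] branch_facts[OF b] branch_facts[OF z(1)] leaf_facts[OF m(1)] leaf_facts[OF assms(2)] root_not_branch_leaf in auto)
qed

lemma add_leaf_leaf:
  assumes "u \<in> L2" "v \<in> L2" "u \<noteq> v"
  shows "has_linear_forest (insert {u, v} E) t"
proof (cases "par u = par v")
  case True
  have b: "par v \<in> L1" by (rule par_L2[OF assms(2)])
  obtain z where z: "z \<in> L1" "par z = par (par v)" "z \<noteq> par v" using branch_avoiding[OF par_L1[OF b]] by metis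
  obtain m where m: "m \<in> L2" "par m = z" using leaf_avoiding[OF z(1)] by metis
  show ?thesis
    by (rule forest_with_three_branches[of u v "par v" "par (par v)" z m "{u, v}" "par v" z z])
      (use assms True b z m branch_facts[OF b] branch_facts[OF z(1)] leaf_facts[OF m(1)] leaf_facts[OF assms(1)] leaf_facts[OF assms(2)] root_not_branch_leaf in auto)
next
  case False
  have b: "par u \<in> L1" "par v \<in> L1" by (rule par_L2, fact)+
  obtain l where l: "l \<in> L2" "par l = par u" "l \<noteq> u" using leaf_avoiding[OF b(1)] by metis
  obtain m where m: "m \<in> L2" "par m = par v" "m \<noteq> v" using leaf_avoiding[OF b(2)] by metis
  show ?thesis
    by (rule forest_with_three_branches[of l "par u" u v "par v" m "{u, v}" "par u" "par v" "par v"])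
      (use assms False b l m branch_facts[OF b(1)] branch_facts[OF b(2)] leaf_facts[OF l(1)] leaf_facts[OF m(1)] leaf_facts[OF assms(1)] leaf_facts[OF assms(2)] root_not_branch_leaf in auto)
qed

lemma forest_saturated: "saturated (P\<^sub>g 6 +\<^sub>g t *\<^sub>g P\<^sub>g 2) (Graph V E)"
proof -
  have "has_linear_forest (insert {u, v} E) t" if uv: "u \<in> V" "v \<in> V" "u \<noteq> v" "{u, v} \<notin> E" for u v
  proof -
    have vu: "{v, u} \<notin> E" "insert {v, u} E = insert {u, v} E" using uv(4) by (simp_all add: insert_commute)
    consider "u \<in> L0" | "u \<in> L1" | "u \<in> L2" using uv(1) unfolding V_def by blast
    then show ?thesis
    proof cases
      case u: 1
      consider "v \<in> L0" | "v \<in> L1" | "v \<in> L2" using uv(2) unfolding V_def by blast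
      then show ?thesis using u uv add_root_root add_root_branch add_root_leaf by cases auto
    next
      case u: 2
      consider "v \<in> L0" | "v \<in> L1" | "v \<in> L2" using uv(2) unfolding V_def by blast
      then show ?thesis using u uv add_root_branch[OF _ u vu(1)] vu(2) add_branch_branch add_branch_leaf by cases auto
    next
      case u: 3
      consider "v \<in> L0" | "v \<in> L1" | "v \<in> L2" using uv(2) unfolding V_def by blast
      then show ?thesis using u uv add_root_leaf[of v u] add_branch_leaf[of v u] vu add_leaf_leaf by cases auto
    qed
  qed
  then show ?thesis unfolding saturated_linear_forest_iff simple_graph_def
    using finite_V E_V no_forest by auto
qed

end

text \<open>The roots come first, then the \<open>b\<close> branches, then the leaves; branches are
  dealt cyclically to roots, and leaves to branches. \<open>3 * q \<le> b\<close> gives each root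
  three branches, and the at least \<open>2 * b\<close> leaves give each branch two. A forest of
  \<open>q\<close> trees has \<open>n - q\<close> edges.\<close>

lemma forest_exists:
  assumes q: "1 \<le> q" and b: "t + 3 \<le> b" "3 * q \<le> b" "q + 3 * b \<le> n"
  shows "\<exists>G :: nat graph. saturated (P\<^sub>g 6 +\<^sub>g t *\<^sub>g P\<^sub>g 2) G \<and> card (verts G) = n \<and> card (edges G) = n - q"
proof -
  define par where "par v = (if v < q + b then (v - q) mod q else q + (v - q - b) mod b)" for v
  let ?L0 = "{..<q}" and ?L1 = "{q..<q + b}" and ?L2 = "{q + b..<n}"
  interpret branching_forest ?L0 ?L1 ?L2 par t
  proof
    show "par v \<in> ?L0" if "v \<in> ?L1" for v using that q by (auto simp: par_def)
    show "par v \<in> ?L1" if "v \<in> ?L2" for v using that b by (auto simp: par_def)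
    show "3 \<le> card {v \<in> ?L1. par v = c}" if c: "c \<in> ?L0" for c
    proof -
      have "{q + c, q + (c + q), q + (c + 2 * q)} \<subseteq> {v \<in> ?L1. par v = c}"
        using c b(2) by (auto simp: par_def)
      then have "card {q + c, q + (c + q), q + (c + 2 * q)} \<le> card {v \<in> ?L1. par v = c}"
        by (intro card_mono) auto
      then show ?thesis using q by simp
    qed
    show "2 \<le> card {l \<in> ?L2. par l = v}" if v: "v \<in> ?L1" for v
    proof -
      obtain w where w: "v = q + w" "w < b" using v by (auto simp: le_iff_add)
      have "{q + b + w, q + b + (w + b)} \<subseteq> {l \<in> ?L2. par l = v}"
        using w b(3) by (auto simp: par_def)
      then have "card {q + b + w, q + b + (w + b)} \<le> card {l \<in> ?L2. par l = v}"
        by (intro card_mono) auto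
      then show ?thesis using b by simp
    qed
  qed (use b in auto)
  have "card V = n" "card E = n - q" using b by (simp_all add: card_V card_E)
  then show ?thesis using forest_saturated by (intro exI[of _ "Graph V E"]) simp
qed

section \<open>The saturation number\<close>

lemma (in linear_forest_saturated) edge_lower_bound:
  assumes n: "10 \<le> card V"
  shows "card V - card V div 10 \<le> card E \<or>
    3 * t + 18 \<le> card E \<and> (card E = 3 * t + 18 \<longrightarrow> (\<exists>A Bs. seven_clique_and_triangles V E t A Bs))"
proof (cases "card V - card V div 10 \<le> card E")
  case False
  then have few: "card E < card V - card V div 10" by simp
  then obtain v where v: "v \<in> V" "\<And>w. {v, w} \<notin> E" using few_edges_imp_isolated[OF few n] by blast
  have "card E + 1 < card V" using few n by linarith
  then show ?thesis using isolated_structure[OF _ v] by blast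
qed simp

lemma saturated_edge_lower_bound:
  assumes "saturated (P\<^sub>g 6 +\<^sub>g t *\<^sub>g P\<^sub>g 2) G" "10 \<le> card (verts G)"
  shows "card (verts G) - card (verts G) div 10 \<le> card (edges G) \<or>
    3 * t + 18 \<le> card (edges G) \<and>
    (card (edges G) = 3 * t + 18 \<longrightarrow> (\<exists>A Bs. seven_clique_and_triangles (verts G) (edges G) t A Bs))"
proof -
  interpret linear_forest_saturated "verts G" "edges G" t
    by unfold_locales (use assms(1) in \<open>auto simp: saturated_linear_forest_iff simple_graph_def\<close>)
  show ?thesis by (rule edge_lower_bound[OF assms(2)])
qed

theorem theorem1p4:
  fixes n t :: nat
  assumes "n \<ge> 1" and "t \<ge> 1"
    and "real n \<ge> 10 * real t / 3 + 10"
  shows "sat n (P\<^sub>g 6 +\<^sub>g t *\<^sub>g P\<^sub>g 2) = min (n - n div 10) (3 * t + 18) \<and>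
    (real n > 10 * real t / 3 + 20 \<longrightarrow>
       {G :: 'a graph. saturated (P\<^sub>g 6 +\<^sub>g t *\<^sub>g P\<^sub>g 2) G \<and> card (verts G) = n \<and>
          card (edges G) = sat n (P\<^sub>g 6 +\<^sub>g t *\<^sub>g P\<^sub>g 2)}
       = {G. simple_graph G \<and>
          G \<cong>\<^sub>g K\<^sub>g 7 +\<^sub>g (t - 1) *\<^sub>g K\<^sub>g 3 +\<^sub>g edgeless_graph (n - 3 * t - 4)})"
proof -
  let ?F = "P\<^sub>g 6 +\<^sub>g t *\<^sub>g P\<^sub>g 2"
  let ?H = "K\<^sub>g 7 +\<^sub>g (t - 1) *\<^sub>g K\<^sub>g 3 +\<^sub>g edgeless_graph (n - 3 * t - 4)"
  have "10 * t + 30 \<le> 3 * n" using assms(3) by linarith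
  then have n: "10 \<le> n" "3 * t + 4 \<le> n" using assms(2) by linarith+
  let ?q = "n div 10"
  have q: "10 * ?q \<le> n" by simp
  \<comment> \<open>The sum of \<open>3 * m \<le> 9 * n / 10\<close> and
    \<open>k \<le> n / 10\<close>, needed for \<open>m = t + 3\<close> and
    \<open>k = n div 10\<close>.\<close>
  have tenth: "3 * m + k \<le> n" if "10 * m \<le> 3 * n" "10 * k \<le> n" for m k using that by linarith
  have "3 * (t + 3) + ?q \<le> n" using q \<open>10 * t + 30 \<le> 3 * n\<close> by (intro tenth) simp_all
  then have n9: "3 * (t + 3) \<le> n - ?q" by (rule add_le_imp_le_diff)
  \<comment> \<open>The largest number of branches that leaves two leaves for each of them.\<close>
  let ?b = "(n - ?q) div 3"
  have "\<exists>G :: nat graph. saturated ?F G \<and> card (verts G) = n \<and> card (edges G) = n - ?q"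
  proof (rule forest_exists[of ?q t ?b])
    show "1 \<le> ?q" using n by simp
    show "t + 3 \<le> ?b" using n9 by (simp add: less_eq_div_iff_mult_less_eq)
    show "3 * ?q \<le> ?b" using q by (simp add: less_eq_div_iff_mult_less_eq)
    have "3 * ?b \<le> n - ?q" by simp
    then show "?q + 3 * ?b \<le> n" using q by linarith
  qed
  moreover have "\<exists>G :: nat graph. saturated ?F G \<and> card (verts G) = n \<and> card (edges G) = 3 * t + 18"
    using config_exists[OF assms(2) n(2)] .
  ultimately have ex: "\<exists>G :: nat graph. saturated ?F G \<and> card (verts G) = n \<and> card (edges G) = min (n - ?q) (3 * t + 18)"
    unfolding min_def by (cases "n - ?q \<le> 3 * t + 18") simp_all
  have sat: "sat n ?F = min (n - n div 10) (3 * t + 18)"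
    unfolding sat_def
  proof (rule Least_equality)
    show "\<exists>G :: nat graph. saturated ?F G \<and> card (verts G) = n \<and> card (edges G) = min (n - ?q) (3 * t + 18)"
      by (rule ex)
    fix m assume "\<exists>G :: nat graph. saturated ?F G \<and> card (verts G) = n \<and> card (edges G) = m"
    then obtain G :: "nat graph" where G: "saturated ?F G" "card (verts G) = n" "card (edges G) = m" by blast
    then show "min (n - ?q) (3 * t + 18) \<le> m" using saturated_edge_lower_bound[OF G(1)] n(1) by auto
  qed
  moreover have "{G :: 'a graph. saturated ?F G \<and> card (verts G) = n \<and> card (edges G) = sat n ?F}
       = {G. simple_graph G \<and> G \<cong>\<^sub>g ?H}" if "real n > 10 * real t / 3 + 20"
  proof -
    have tenth': "3 * m + k < n" if "10 * m < 3 * n" "10 * k \<le> n" for m k using that by linarith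
    have "10 * t + 60 < 3 * n" using that by linarith
    then have "3 * (t + 6) + ?q < n" using q by (intro tenth') simp_all
    \<comment> \<open>Now \<open>3 * t + 18\<close> is strictly below the forest bound, so a graph
      with that many edges falls under the second alternative of the lower bound, where equality
      forces the structure.\<close>
    then have big: "3 * t + 18 < n - ?q" by simp
    then have sat': "sat n ?F = 3 * t + 18" using sat by simp
    have H: "card (verts ?H) = n"
    proof -
      obtain A Bs where "card (verts ?H) = 7 + 3 * (t - 1) + (n - 3 * t - 4)" by (rule config_sum_graph)
      then show ?thesis using n(2) assms(2) by simp
    qed
    have "saturated ?F G \<and> card (verts G) = n \<and> card (edges G) = 3 * t + 18 \<longleftrightarrow> simple_graph G \<and> G \<cong>\<^sub>g ?H"
      for G :: "'a graph"
    proof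
      assume G: "saturated ?F G \<and> card (verts G) = n \<and> card (edges G) = 3 * t + 18"
      then have s: "simple_graph G" by (simp add: saturated_def)
      have "\<exists>A Bs. seven_clique_and_triangles (verts G) (edges G) t A Bs"
        using saturated_edge_lower_bound[of t G] G n(1) big by auto
      then show "simple_graph G \<and> G \<cong>\<^sub>g ?H"
        using isomorphic_sum_graph_iff[OF s _ assms(2) n(2)] G s by blast
    next
      assume G: "simple_graph G \<and> G \<cong>\<^sub>g ?H"
      then have c: "card (verts G) = n" using card_verts_isomorphic[of G ?H] H by simp
      then obtain A Bs where X: "seven_clique_and_triangles (verts G) (edges G) t A Bs"
        using isomorphic_sum_graph_iff[OF _ c assms(2) n(2)] G by blast
      have "finite (verts G)" using G by (simp add: simple_graph_def)
      from config_saturated[OF X this assms(2)] have "saturated ?F G" by simp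
      then show "saturated ?F G \<and> card (verts G) = n \<and> card (edges G) = 3 * t + 18"
        using c config_card_edges[OF X assms(2)] by simp
    qed
    then show ?thesis unfolding sat' by blast
  qed
  ultimately show ?thesis by blast
qed

end
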